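(* Let $a,b\in\widehat{\mathcal{A}}_\hbar(\mathbb{D}_n)$ be given (the underlying Fréchet space of functions on $\mathbb{D}_n$ being independent of the allowed value $\hbar$). Then the product $a\star_{\mathbb{D}_n}b$, which depends on $\hbar$, depends holomorphically on $\hbar$ for all allowed values of $\hbar$; i.e. the map $\hbar\mapsto a\star_{\mathbb{D}_n}b$ from $\{\hbar\in\mathbb{C}: 2\hbar\notin\{0,-1,-\tfrac12,-\tfrac13,\dots\}\}$ to this Fréchet space is holomorphic.
   Context: Fix $n\ge1$. On $\mathbb{C}^{n+1}$ with coordinates $z^0,\dots,z^n$ let $\mathsf{g}=\mathrm{diag}(-1,1,\dots,1)$, $y(z)=|z^0|^2-|z^1|^2-\dots-|z^n|^2$, $C_{n+1}^+=\{z: y(z)>0\}$, $\mathbb{D}_n=\{v\in\mathbb{C}^n:|v|^2<1\}$, and $\pi\colon C_{n+1}^+\to\mathbb{D}_n$, $\pi(z)=(z^1/z^0,\dots,z^n/z^0)$. An index triple is $(P,Q,\alpha)$ with $P,Q\in\mathbb{N}_0^n$, $\alpha\in\mathbb{N}_0$, $|P|,|Q|\le\alpha$. Put $\mathsf{e}_{P,Q,\alpha}(z)=(z^0)^{\alpha-|P|}z^P(\bar z^0)^{\alpha-|Q|}\bar z^Q$ where $z^P=(z^1)^{P_1}\cdots(z^n)^{P_n}$; these form a basis of the $\mathrm{U}(1)$-invariant polynomials in $z,\bar z$. For $\hbar\ne0$ the Wick product of polynomials is $f\star g=\sum_{r\ge0}\frac{(2\hbar)^r}{r!}\sum_{i_1,\dots,i_r,j_1,\dots,j_r=0}^n\mathsf{g}^{i_1j_1}\cdots\mathsf{g}^{i_rj_r}\frac{\partial^rf}{\partial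 z^{i_1}\cdots\partial z^{i_r}}\frac{\partial^rg}{\partial\bar z^{j_1}\cdots\partial\bar z^{j_r}}$; it preserves $\mathrm{U}(1)$-invariant polynomials. With $(x)_r=x(x+1)\cdots(x+r-1)$, let $S$ be the (injective) linear map from $\mathrm{U}(1)$-invariant polynomials to $C^\infty(C_{n+1}^+)$ with $S\mathsf{e}_{P,Q,\alpha}=(2\hbar)^\alpha\big(\tfrac{y}{2\hbar}\big)_\alpha\frac{\mathsf{e}_{P,Q,\alpha}}{y^\alpha}$, and $\mathsf{f}_{P,Q,\alpha}=\frac{1}{P!(\alpha-|P|)!Q!(\alpha-|Q|)!}\big(\frac{y}{2\hbar}\big)_\alpha\frac{\mathsf{e}_{P,Q,\alpha}}{y^\alpha}$. $\mathcal{A}_\hbar(C_{n+1}^+)$ is the span of the (linearly independent) $\mathsf{f}_{P,Q,\alpha}$, with product $a\,\tilde\star\,b=S(S^{-1}a\star S^{-1}b)$. $\mathcal{A}_\hbar(C_{n+1}^+)$ carries the locally convex topology of the seminorms $\sup_{(P,Q,\alpha)}|a_{P,Q,\alpha}|/(\alpha!)^\epsilon$, $0<\epsilon<1$, for $a=\sum a_{P,Q,\alpha}\mathsf{f}_{P,Q,\alpha}$. The product and all evaluations $\delta_w(a)=a(w)$, $w\in C_{n+1}^+$, are continuous, and the completion $\widehat{\mathcal{A}}_\hbar(C_{n+1}^+)$ is a Fréchet algebra of functions on $C_{n+1}^+$, consisting of all $\sum a_{P,Q,\alpha}\mathsf{f}_{P,Q,\alpha}$ for which all these seminorms are finite. For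 allowed $\hbar$, i.e. $2\hbar\notin\{0,-1,-\frac12,-\frac13,\dots\}$, $\mathcal{J}_{y=1}=\bigcap_{y(w)=1}\ker\delta_w$ is a closed two-sided ideal, and $\widehat{\mathcal{A}}_\hbar(\mathbb{D}_n)=\widehat{\mathcal{A}}_\hbar(C_{n+1}^+)/\mathcal{J}_{y=1}$ with quotient topology and induced product $\star_{\mathbb{D}_n}$; its elements are functions on $\mathbb{D}_n$ via $[a](v)=a(w)$ for any $w$ with $\pi(w)=v$, $y(w)=1$. Explicitly, it consists of all functions $\sum_{P,Q}a_{P,Q}\mathsf{f}_{P,Q}$ with, for $\alpha=\max(|P|,|Q|)$, $$\mathsf{f}_{P,Q}(v)=\frac{1}{P!(\alpha-|P|)!Q!(\alpha-|Q|)!}\Big(\frac1{2\hbar}\Big)_\alpha\frac{v^P\bar v^Q}{(1-|v|^2)^\alpha}$$ and $\sup_{P,Q}|a_{P,Q}|/(\max(|P|,|Q|)!)^\epsilon<\infty$ for all $0<\epsilon<1$, these suprema giving a defining system of seminorms. As a subspace of the real-analytic functions on $\mathbb{D}_n$ and as a Fréchet space, $\widehat{\mathcal{A}}_\hbar(\mathbb{D}_n)$ does not depend on the allowed value $\hbar$, but the product $\star_{\mathbb{D}_n}$ does. *)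

theory Defs
  imports "HOL-Analysis.Analysis" "HOL-Library.Function_Algebras"
begin

text \<open>
  The type \<^typ>\<open>complex ^ 'n\<close> is C^n (so n = CARD('n) is at least 1), and
  \<^typ>\<open>complex ^ 'n option\<close> is C^(n+1): the component \<^term>\<open>None\<close> is z^0 and
  the components \<^term>\<open>Some i\<close> are z^1, ..., z^n.

  A function on the cone or on the ball is represented by the total function that
  vanishes outside of it. In this way the functions form a complex vector space with the
  pointwise operations of the theory of function algebras and the scaling below.
\<close>

definition fscale :: "complex \<Rightarrow> ('a \<Rightarrow> complex) \<Rightarrow> 'a \<Rightarrow> complex" where
  "fscale c f = (\<lambda>x. c * f x)"

global_interpretation cfun: vector_space fscale
  by unfold_locales (auto simp: fscale_def algebra_simps)

global_interpretation cfun2: vector_space_pair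
    "fscale :: complex \<Rightarrow> ('a \<Rightarrow> complex) \<Rightarrow> 'a \<Rightarrow> complex"
    "fscale :: complex \<Rightarrow> ('b \<Rightarrow> complex) \<Rightarrow> 'b \<Rightarrow> complex"
  by unfold_locales


subsection \<open>The cone and the ball\<close>

definition gmet :: "'n option \<Rightarrow> 'n option \<Rightarrow> complex" where
  "gmet i j = (if i = j then (if i = None then - 1 else 1) else 0)"

definition yfun :: "complex ^ ('n::finite) option \<Rightarrow> real" where
  "yfun z = (cmod (z $ None))\<^sup>2 - (\<Sum>i\<in>UNIV. (cmod (z $ Some i))\<^sup>2)"

definition Cplus :: "(complex ^ ('n::finite) option) set" where
  "Cplus = {z. yfun z > 0}"

definition Dball :: "(complex ^ ('n::finite)) set" where
  "Dball = {v. (norm v)\<^sup>2 < 1}"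

definition proj :: "complex ^ ('n::finite) option \<Rightarrow> complex ^ 'n" where
  "proj z = (\<chi> i. z $ Some i / z $ None)"


subsection \<open>Invariant polynomials and the Wick product\<close>

type_synonym 'n triple = "('n \<Rightarrow> nat) \<times> ('n \<Rightarrow> nat) \<times> nat"

definition msize :: "('n::finite \<Rightarrow> nat) \<Rightarrow> nat" where
  "msize P = (\<Sum>i\<in>UNIV. P i)"

definition mfact :: "('n::finite \<Rightarrow> nat) \<Rightarrow> complex" where
  "mfact P = (\<Prod>i\<in>UNIV. fact (P i))"

definition triples :: "('n::finite) triple set" where
  "triples = {(P, Q, \<alpha>). msize P \<le> \<alpha> \<and> msize Q \<le> \<alpha>}"

fun epoly :: "('n::finite) triple \<Rightarrow> complex ^ 'n option \<Rightarrow> complex" where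
  "epoly (P, Q, \<alpha>) z =
     (z $ None) ^ (\<alpha> - msize P) * (\<Prod>i\<in>UNIV. (z $ Some i) ^ P i) *
     cnj (z $ None) ^ (\<alpha> - msize Q) * (\<Prod>i\<in>UNIV. cnj (z $ Some i) ^ Q i)"

text \<open>The U(1)-invariant polynomials in z and its conjugate, as functions on C^(n+1);
  the \<^term>\<open>epoly T\<close> with \<^term>\<open>T \<in> triples\<close> are a basis.\<close>

definition inv_polys :: "(complex ^ ('n::finite) option \<Rightarrow> complex) set" where
  "inv_polys = cfun.span (epoly ` triples)"

text \<open>The Wirtinger derivatives with respect to z^i and to the conjugate of z^i.\<close>

definition dz :: "('m::finite) \<Rightarrow> (complex ^ 'm \<Rightarrow> complex) \<Rightarrow> complex ^ 'm \<Rightarrow> complex" where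
  "dz i f z = (frechet_derivative f (at z) (axis i 1)
               - \<i> * frechet_derivative f (at z) (axis i \<i>)) / 2"

definition dzbar :: "('m::finite) \<Rightarrow> (complex ^ 'm \<Rightarrow> complex) \<Rightarrow> complex ^ 'm \<Rightarrow> complex" where
  "dzbar i f z = (frechet_derivative f (at z) (axis i 1)
                  + \<i> * frechet_derivative f (at z) (axis i \<i>)) / 2"

text \<open>The lists are the index tuples (i_1, ..., i_r) and (j_1, ..., j_r). For polynomials
  only finitely many terms of the series in r are nonzero.\<close>

definition wick ::
  "complex \<Rightarrow> (complex ^ ('n::finite) option \<Rightarrow> complex) \<Rightarrow> (complex ^ 'n option \<Rightarrow> complex)
    \<Rightarrow> complex ^ 'n option \<Rightarrow> complex" where
  "wick h f g z = (\<Sum>r. (2 * h) ^ r / fact r *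
     (\<Sum>is\<in>{is. length is = r}. \<Sum>js\<in>{js. length js = r}.
        (\<Prod>k<r. gmet (is ! k) (js ! k)) * foldr dz is f z * foldr dzbar js g z))"


subsection \<open>The algebra on the cone\<close>

definition ybasis ::
  "complex \<Rightarrow> ('n::finite) triple \<Rightarrow> complex ^ 'n option \<Rightarrow> complex" where
  "ybasis h = (\<lambda>(P, Q, \<alpha>) w. if w \<in> Cplus
     then pochhammer (of_real (yfun w) / (2 * h)) \<alpha> * epoly (P, Q, \<alpha>) w / of_real (yfun w) ^ \<alpha>
     else 0)"

definition fbasis ::
  "complex \<Rightarrow> ('n::finite) triple \<Rightarrow> complex ^ 'n option \<Rightarrow> complex" where
  "fbasis h = (\<lambda>(P, Q, \<alpha>). fscale
     (1 / (mfact P * fact (\<alpha> - msize P) * mfact Q * fact (\<alpha> - msize Q))) (ybasis h (P, Q, \<alpha>)))"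

text \<open>The linear map with values
  (2 h)^\<alpha> (y / (2 h))_\<alpha> e / y^\<alpha> on the basis elements e with index (P, Q, \<alpha>).\<close>

definition Smap ::
  "complex \<Rightarrow> (complex ^ ('n::finite) option \<Rightarrow> complex) \<Rightarrow> complex ^ 'n option \<Rightarrow> complex" where
  "Smap h = cfun2.construct (epoly ` triples)
     (\<lambda>p. case the_inv_into triples epoly p of
        (P, Q, \<alpha>) \<Rightarrow> fscale ((2 * h) ^ \<alpha>) (ybasis h (P, Q, \<alpha>)))"

definition Acone :: "complex \<Rightarrow> (complex ^ ('n::finite) option \<Rightarrow> complex) set" where
  "Acone h = cfun.span (fbasis h ` triples)"

definition Sinv ::
  "complex \<Rightarrow> (complex ^ ('n::finite) option \<Rightarrow> complex) \<Rightarrow> complex ^ 'n option \<Rightarrow> complex" where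
  "Sinv h = inv_into inv_polys (Smap h)"

definition star_cone ::
  "complex \<Rightarrow> (complex ^ ('n::finite) option \<Rightarrow> complex) \<Rightarrow> (complex ^ 'n option \<Rightarrow> complex)
    \<Rightarrow> complex ^ 'n option \<Rightarrow> complex" where
  "star_cone h a b = Smap h (wick h (Sinv h a) (Sinv h b))"


subsection \<open>The completed algebra on the cone\<close>

definition weighted :: "real \<Rightarrow> ('n triple \<Rightarrow> complex) \<Rightarrow> 'n triple \<Rightarrow> real" where
  "weighted \<epsilon> c = (\<lambda>(P, Q, \<alpha>). cmod (c (P, Q, \<alpha>)) / (fact \<alpha>) powr \<epsilon>)"

definition admissible :: "(('n::finite) triple \<Rightarrow> complex) \<Rightarrow> bool" where
  "admissible c \<longleftrightarrow> (\<forall>T. T \<notin> triples \<longrightarrow> c T = 0) \<and>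
     (\<forall>\<epsilon>. 0 < \<epsilon> \<and> \<epsilon> < 1 \<longrightarrow> bdd_above (weighted \<epsilon> c ` triples))"

definition fseries ::
  "complex \<Rightarrow> (('n::finite) triple \<Rightarrow> complex) \<Rightarrow> complex ^ 'n option \<Rightarrow> complex" where
  "fseries h c w = (\<Sum>\<^sub>\<infinity>T\<in>triples. c T * fbasis h T w)"

definition Ahat_cone :: "complex \<Rightarrow> (complex ^ ('n::finite) option \<Rightarrow> complex) set" where
  "Ahat_cone h = fseries h ` {c. admissible c}"

text \<open>The coefficients of a function in \<^term>\<open>Ahat_cone h\<close> are uniquely determined.\<close>

definition coeffs ::
  "complex \<Rightarrow> (complex ^ ('n::finite) option \<Rightarrow> complex) \<Rightarrow> 'n triple \<Rightarrow> complex" where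
  "coeffs h a = (THE c. admissible c \<and> fseries h c = a)"

definition seminorm_cone ::
  "complex \<Rightarrow> real \<Rightarrow> (complex ^ ('n::finite) option \<Rightarrow> complex) \<Rightarrow> real" where
  "seminorm_cone h \<epsilon> a = (SUP T\<in>triples. weighted \<epsilon> (coeffs h a) T)"

definition top_cone :: "complex \<Rightarrow> (complex ^ ('n::finite) option \<Rightarrow> complex) topology" where
  "top_cone h = topology_generated_by
     {{b \<in> Ahat_cone h. seminorm_cone h \<epsilon> (b - a) < r} | a \<epsilon> r.
        a \<in> Ahat_cone h \<and> 0 < \<epsilon> \<and> \<epsilon> < 1 \<and> 0 < r}"

text \<open>The product of the completion is the continuous extension of the product of
  \<^term>\<open>Acone h\<close>. It is determined on \<^term>\<open>Ahat_cone h\<close>, where \<^term>\<open>Acone h\<close> is dense,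
  and is not used outside of it.\<close>

definition star_hat_cone ::
  "complex \<Rightarrow> (complex ^ ('n::finite) option \<Rightarrow> complex) \<Rightarrow> (complex ^ 'n option \<Rightarrow> complex)
    \<Rightarrow> complex ^ 'n option \<Rightarrow> complex" where
  "star_hat_cone h = (SOME m.
     continuous_map (prod_topology (top_cone h) (top_cone h)) (top_cone h) (\<lambda>(a, b). m a b) \<and>
     (\<forall>a\<in>Acone h. \<forall>b\<in>Acone h. m a b = star_cone h a b))"


subsection \<open>The quotient algebra on the ball\<close>

definition allowed :: "complex set" where
  "allowed = {h. 2 * h \<noteq> 0 \<and> (\<forall>k::nat. k \<ge> 1 \<longrightarrow> 2 * h \<noteq> - 1 / of_nat k)}"

text \<open>The quotient map, a class being identified with a function on the ball. On
  \<^term>\<open>Ahat_cone h\<close> its kernel is the ideal of the functions that vanish on the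
  level set y = 1, so that the image of \<^term>\<open>Ahat_cone h\<close> is the quotient by this ideal.\<close>

definition red ::
  "(complex ^ ('n::finite) option \<Rightarrow> complex) \<Rightarrow> complex ^ 'n \<Rightarrow> complex" where
  "red a = (\<lambda>v. if v \<in> Dball
     then (THE c. \<forall>w. yfun w = 1 \<and> proj w = v \<longrightarrow> a w = c) else 0)"

definition Ahat_ball :: "complex \<Rightarrow> (complex ^ ('n::finite) \<Rightarrow> complex) set" where
  "Ahat_ball h = red ` Ahat_cone h"

definition top_ball :: "complex \<Rightarrow> (complex ^ ('n::finite) \<Rightarrow> complex) topology" where
  "top_ball h = topology
     (\<lambda>U. U \<subseteq> Ahat_ball h \<and> openin (top_cone h) {a \<in> Ahat_cone h. red a \<in> U})"

definition star_ball ::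
  "complex \<Rightarrow> (complex ^ ('n::finite) \<Rightarrow> complex) \<Rightarrow> (complex ^ 'n \<Rightarrow> complex)
    \<Rightarrow> complex ^ 'n \<Rightarrow> complex" where
  "star_ball h a b = (THE c. \<forall>a'\<in>Ahat_cone h. \<forall>b'\<in>Ahat_cone h.
     red a' = a \<and> red b' = b \<longrightarrow> c = red (star_hat_cone h a' b'))"


subsection \<open>Holomorphic maps into a topological vector space of functions\<close>

text \<open>As for \<^const>\<open>holomorphic_on\<close>: complex differentiability at each point, where the
  difference quotients converge in the topology of the target space.\<close>

definition holomorphic_into ::
  "('p \<Rightarrow> complex) topology \<Rightarrow> complex set \<Rightarrow> (complex \<Rightarrow> 'p \<Rightarrow> complex) \<Rightarrow> bool" where
  "holomorphic_into X U F \<longleftrightarrow> F ` U \<subseteq> topspace X \<and>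
     (\<forall>h\<in>U. \<exists>D. limitin X (\<lambda>k. fscale (1 / (k - h)) (F k - F h)) D (at h within U))"

end

theory Submission
  imports Defs "HOL-Complex_Analysis.Conformal_Mappings"
begin

text \<open>
  The basis of the algebra on the cone is normalised in such a way that \<open>\<hbar>\<close> disappears from its
  structure constants. Write \<open>f\<^bsub>p,q\<^esub>\<close> for the basis element whose exponents in
  \<open>z\<^sup>0, ..., z\<^sup>n\<close> are \<open>p\<close> and in the conjugates \<open>q\<close>, so that \<open>|p| = |q| = \<alpha>\<close>. Then
  \<open>f\<^bsub>p,q\<^esub> \<star> f\<^bsub>r,s\<^esub>\<close> is the sum over \<open>k \<le> p, s\<close> of
  \<open>(-1)\<^bsup>k\<^sub>0\<^esup> (p+r-k)! (q+s-k)! / (q! r! k! (p-k)! (s-k)!) f\<^bsub>p+r-k,q+s-k\<^esub>\<close>. Hence the product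
  of two coefficient families is one fixed bilinear map \<open>Cmul\<close>. Every entry of it is a finite sum
  over entries of degree at most its own, and the factor \<open>1/k!\<close> pays for the growth of the
  coefficients, which makes \<open>Cmul\<close> continuous (\<open>Cmul_grows\<close>) and identifies it with the product of
  the completion (\<open>star_hat_cone_fseries\<close>).

  The parameter enters only on the level set \<open>y = 1\<close>, where \<open>f\<^bsub>p,q\<^esub>\<close> is a function independent of
  \<open>\<hbar>\<close> times \<open>(x)\<^sub>\<alpha>\<close> with \<open>x = 1/(2\<hbar>)\<close>. One function on the ball thus has coefficient families
  for the various parameters that differ by quotients of Pochhammer symbols (\<open>red_rescale\<close>), and
  the product on the ball, written in the coefficients for the fixed parameter \<open>h0\<close>, has as
  entries finite sums of such quotients (\<open>ball_product\<close>). These are holomorphic in \<open>\<hbar>\<close>. Since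
  \<open>(x)\<^sub>\<alpha>/\<alpha>!\<close> is bounded above and below by geometric factors, locally uniformly in \<open>\<hbar>\<close>, and
  geometric factors are absorbed by an arbitrarily small power of \<open>\<alpha>!\<close>, the entries are bounded
  locally uniformly in every seminorm (\<open>ball_product_grows\<close>). Cauchy's estimates then bound the
  error of the difference quotients in every seminorm by a multiple of the increment.

  Two facts carry this argument. The coefficients are determined by the function
  (\<open>fseries_inject\<close>): along a ray of the cone a function of the algebra is a Newton series in
  \<open>y/(2\<hbar>)\<close>, and such a series is determined by its values. And the product passes to the ball
  (\<open>star_ball_eq\<close>), that is, the functions vanishing on \<open>y = 1\<close> form an ideal. For this the basis
  functions are polarised, the conjugate variables becoming independent variables \<open>w\<close>: up to a
  factorial, \<open>f\<^bsub>p,q\<^esub>\<close> becomes \<open>(x)\<^sub>\<alpha> \<eta>\<^sup>p w\<^sup>q \<langle>\<eta>,w\<rangle>\<^bsup>-x-\<alpha>\<^esup>\<close>. Right multiplication by a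
  conjugate variable is then differentiation in \<open>\<eta>\<close>, and right multiplication by a variable is
  multiplication by a component of \<open>\<eta>\<close>, with shifts of \<open>x\<close> by one. Both preserve the vanishing of
  the sum on the diagonal \<open>w = \<eta>\<close> conjugate.
\<close>

section \<open>Growth of factorials\<close>

lemma fact_add_le: "fact (a + b) \<le> (2::real) ^ (a + b) * fact a * fact b"
proof -
  have "fact (a + b) = real ((a + b) choose a) * fact a * fact b"
    using binomial_fact[of a "a + b", where 'a=real] by simp
  moreover have "real ((a + b) choose a) \<le> 2 ^ (a + b)"
    using binomial_le_pow2[of "a + b" a] by (metis of_nat_le_iff of_nat_numeral of_nat_power)
  ultimately show ?thesis by (simp add: mult_right_mono)
qed

lemma fact_mult_le_fact_add: "fact a * fact b \<le> (fact (a + b) :: real)"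
proof -
  have "fact a * fact b dvd (fact (a + b) :: nat)" by (rule fact_fact_dvd_fact)
  hence "fact a * fact b \<le> (fact (a + b) :: nat)" by (rule dvd_imp_le) simp
  thus ?thesis by (metis of_nat_fact of_nat_le_iff of_nat_mult)
qed

text \<open>With \<open>b = B powr (1/\<delta>)\<close> one has \<open>B ^ n = (b ^ n) powr \<delta>\<close> and \<open>b ^ n \<le> exp b * n!\<close>. By this
  bound every estimate below may lose geometric factors.\<close>

lemma power_le_fact_powr:
  assumes "0 < \<delta>" "0 < B"
  obtains K :: real where "0 < K" "\<And>n::nat. B ^ n \<le> K * fact n powr \<delta>"
proof
  define b where "b = B powr (1 / \<delta>)"
  have b: "b > 0" "b powr \<delta> = B" using assms by (simp_all add: b_def powr_powr)
  show "0 < exp b powr \<delta>" by simp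
  show "B ^ n \<le> exp b powr \<delta> * fact n powr \<delta>" for n :: nat
  proof -
    have "b ^ n / fact n \<le> exp b"
    proof -
      have "(\<Sum>i\<in>{n}. b ^ i /\<^sub>R fact i) \<le> (\<Sum>i. b ^ i /\<^sub>R fact i)"
        using b by (intro sum_le_suminf summable_exp_generic) auto
      thus ?thesis by (simp add: exp_def divide_inverse_commute)
    qed
    hence "b ^ n \<le> exp b * fact n" by (simp add: divide_le_eq)
    hence "(b ^ n) powr \<delta> \<le> (exp b * fact n) powr \<delta>"
      using assms b by (intro powr_mono2) auto
    also have "(b ^ n) powr \<delta> = (b powr \<delta>) ^ n"
      using b(1) by (simp add: powr_powr mult.commute flip: powr_realpow)
    also have "\<dots> = B ^ n" by (simp add: b(2))
    finally show ?thesis by (simp add: powr_mult)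
  qed
qed

lemma power_mult_fact_powr_le:
  assumes "\<epsilon> < \<epsilon>'" "0 < B"
  obtains K :: real where "0 < K" "\<And>n::nat. B ^ n * fact n powr \<epsilon> \<le> K * fact n powr \<epsilon>'"
proof -
  obtain K :: real where K: "0 < K" "\<And>n::nat. B ^ n \<le> K * fact n powr (\<epsilon>' - \<epsilon>)"
    using power_le_fact_powr[of "\<epsilon>' - \<epsilon>" B] assms by auto
  show thesis
  proof (rule that[OF K(1)])
    fix n :: nat
    have "B ^ n * fact n powr \<epsilon> \<le> K * fact n powr (\<epsilon>' - \<epsilon>) * fact n powr \<epsilon>"
      using K(2)[of n] by (intro mult_right_mono) auto
    also have "\<dots> = K * fact n powr \<epsilon>'" by (simp add: powr_add[symmetric])
    finally show "B ^ n * fact n powr \<epsilon> \<le> K * fact n powr \<epsilon>'" .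
  qed
qed

section \<open>Multi-indices\<close>

lemma sum_option: "(\<Sum>j\<in>(UNIV::('n::finite) option set). f j) = f None + (\<Sum>i\<in>UNIV. f (Some i))"
  by (simp add: UNIV_option_conv sum.reindex)

lemma prod_option: "(\<Prod>j\<in>(UNIV::('n::finite) option set). f j) = f None * (\<Prod>i\<in>UNIV. f (Some i))"
  by (simp add: UNIV_option_conv prod.reindex)

text \<open>The triple \<open>(P, Q, \<alpha>)\<close> stands for the monomial with exponents \<open>enc \<alpha> P\<close> in
  \<open>z\<^sup>0, ..., z\<^sup>n\<close> and \<open>enc \<alpha> Q\<close> in their conjugates. In these exponents, which both have size
  \<open>\<alpha>\<close>, the coordinate \<open>z\<^sup>0\<close> differs from the others only by a sign in the metric.\<close>

definition enc :: "nat \<Rightarrow> ('n::finite \<Rightarrow> nat) \<Rightarrow> 'n option \<Rightarrow> nat" where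
  "enc \<alpha> P = (\<lambda>j. case j of None \<Rightarrow> \<alpha> - msize P | Some i \<Rightarrow> P i)"

definition dec :: "('n::finite option \<Rightarrow> nat) \<times> ('n option \<Rightarrow> nat) \<Rightarrow> 'n triple" where
  "dec = (\<lambda>(p, q). (p \<circ> Some, q \<circ> Some, msize p))"

definition enc_pair :: "'n::finite triple \<Rightarrow> ('n option \<Rightarrow> nat) \<times> ('n option \<Rightarrow> nat)" where
  "enc_pair = (\<lambda>(P, Q, \<alpha>). (enc \<alpha> P, enc \<alpha> Q))"

abbreviation zexp :: "'n::finite triple \<Rightarrow> 'n option \<Rightarrow> nat" where "zexp T \<equiv> fst (enc_pair T)"
abbreviation zbexp :: "'n::finite triple \<Rightarrow> 'n option \<Rightarrow> nat" where "zbexp T \<equiv> snd (enc_pair T)"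

definition deg :: "'n triple \<Rightarrow> nat" where "deg T = snd (snd T)"

definition balanced :: "(('m::finite \<Rightarrow> nat) \<times> ('m \<Rightarrow> nat)) set" where
  "balanced = {(p, q). msize p = msize q}"

lemma deg_simp [simp]: "deg (P, Q, \<alpha>) = \<alpha>" by (simp add: deg_def)

lemma msize_option: "msize p = p None + msize (p \<circ> Some)"
  by (simp add: msize_def sum_option)

lemma msize_enc: "msize P \<le> \<alpha> \<Longrightarrow> msize (enc \<alpha> P) = \<alpha>"
  by (simp add: msize_option enc_def comp_def)

lemma enc_Some [simp]: "enc \<alpha> P \<circ> Some = P" by (auto simp: enc_def)

lemma enc_msize: "enc (msize p) (p \<circ> Some) = p"
  by (auto simp: enc_def fun_eq_iff msize_option[of p] split: option.splits)

lemma dec_enc: "T \<in> triples \<Longrightarrow> dec (enc_pair T) = T"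
  by (auto simp: triples_def dec_def enc_pair_def msize_enc)

lemma enc_pair_balanced: "T \<in> triples \<Longrightarrow> enc_pair T \<in> balanced"
  by (auto simp: triples_def balanced_def enc_pair_def msize_enc)

lemma enc_dec: "x \<in> balanced \<Longrightarrow> enc_pair (dec x) = x"
  by (auto simp: balanced_def dec_def enc_pair_def enc_msize simp del: )
     (metis enc_msize)

lemma dec_triples: "x \<in> balanced \<Longrightarrow> dec x \<in> triples"
  by (auto simp: balanced_def dec_def triples_def)
     (metis le_add2 msize_option)+

lemma deg_dec: "deg (dec (p, q)) = msize p" by (simp add: dec_def)

lemma msize_enc_pair:
  assumes "T \<in> triples"
  shows "msize (zexp T) = deg T" "msize (zbexp T) = deg T"
  using assms by (auto simp: enc_pair_def triples_def msize_enc)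

lemma bij_betw_enc_pair: "bij_betw enc_pair triples balanced"
  by (rule bij_betw_byWitness[where f' = dec])
     (auto simp: dec_enc enc_dec enc_pair_balanced dec_triples)

lemma mfact_enc: "mfact (enc \<alpha> P) = fact (\<alpha> - msize P) * mfact P"
  by (simp add: mfact_def prod_option enc_def)

lemma mfact_nonzero [simp]: "mfact p \<noteq> 0" by (simp add: mfact_def)

definition rfact :: "('m::finite \<Rightarrow> nat) \<Rightarrow> real" where "rfact p = (\<Prod>i\<in>UNIV. fact (p i))"

lemma mfact_rfact: "mfact p = of_real (rfact p)" by (simp add: mfact_def rfact_def)

lemma rfact_pos [simp]: "0 < rfact p" by (simp add: rfact_def prod_pos)

text \<open>Multinomial coefficients are at most geometric; the base obtained by iterating the binomial
  bound is crude but suffices.\<close>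

lemma fact_msize_le: "fact (msize (p::'m::finite \<Rightarrow> nat)) \<le> (2 ^ CARD('m)) ^ msize p * rfact p"
proof -
  have "fact (sum p F) \<le> (2::real) ^ (card F * sum p F) * (\<Prod>i\<in>F. fact (p i))" if "finite F" for F
    using that
  proof (induction F)
    case (insert i F)
    have "fact (sum p (insert i F)) \<le> (2::real) ^ (p i + sum p F) * fact (p i) * fact (sum p F)"
      using insert by (simp add: fact_add_le)
    also have "\<dots> \<le> 2 ^ (p i + sum p F) * fact (p i) * (2 ^ (card F * sum p F) * (\<Prod>i\<in>F. fact (p i)))"
      by (intro mult_left_mono insert.IH) auto
    also have "\<dots> = 2 ^ (p i + sum p F + card F * sum p F) * (\<Prod>i\<in>insert i F. fact (p i))"
      using insert by (simp add: power_add)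
    also have "\<dots> \<le> 2 ^ (card (insert i F) * sum p (insert i F)) * (\<Prod>i\<in>insert i F. fact (p i))"
      using insert by (intro mult_right_mono power_increasing) (auto intro!: prod_nonneg mult_nonneg_nonneg simp: algebra_simps)
    finally show ?case .
  qed auto
  from this[of UNIV] show ?thesis by (simp add: msize_def rfact_def power_mult mult.commute)
qed

lemma msize_mono: "p \<le> q \<Longrightarrow> msize p \<le> msize q"
  by (auto simp: msize_def le_fun_def intro: sum_mono)

lemma index_le_msize: "p i \<le> msize p" for i :: "'m::finite"
  by (simp add: msize_def sum_nonneg_leq_bound member_le_sum)

lemma finite_bounded_funs: "finite {p :: 'm::finite \<Rightarrow> nat. \<forall>i. p i \<le> N}"
  and card_bounded_funs: "card {p :: 'm::finite \<Rightarrow> nat. \<forall>i. p i \<le> N} = (N + 1) ^ CARD('m)"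
proof -
  have eq: "{p :: 'm \<Rightarrow> nat. \<forall>i. p i \<le> N} = (UNIV \<rightarrow>\<^sub>E {..N})" by (auto simp: PiE_def)
  show "finite {p :: 'm \<Rightarrow> nat. \<forall>i. p i \<le> N}" unfolding eq by (intro finite_PiE) auto
  show "card {p :: 'm \<Rightarrow> nat. \<forall>i. p i \<le> N} = (N + 1) ^ CARD('m)"
    unfolding eq by (subst card_PiE) auto
qed

lemma finite_le_mindex: "finite {r :: 'm::finite \<Rightarrow> nat. r \<le> t}"
  by (rule finite_subset[OF _ finite_bounded_funs[of "msize t"]])
     (auto simp: le_fun_def intro: order_trans[OF _ index_le_msize])

definition triples_le :: "nat \<Rightarrow> 'n::finite triple set" where
  "triples_le N = {T \<in> triples. deg T \<le> N}"

lemma finite_triples_le: "finite (triples_le N)"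
proof -
  have "triples_le N \<subseteq> {P. \<forall>i. P i \<le> N} \<times> {P. \<forall>i. P i \<le> N} \<times> {..N}"
    by (auto simp: triples_le_def triples_def intro: order_trans[OF index_le_msize])
  thus ?thesis by (rule finite_subset) (intro finite_cartesian_product finite_bounded_funs finite_atMost)
qed

lemma card_triples_eq_le:
  "card {T :: 'n::finite triple. T \<in> triples \<and> deg T = \<alpha>} \<le> (2 ^ (2 * CARD('n))) ^ \<alpha>"
proof -
  have "{T :: 'n triple. T \<in> triples \<and> deg T = \<alpha>} \<subseteq> {P. \<forall>i. P i \<le> \<alpha>} \<times> {P. \<forall>i. P i \<le> \<alpha>} \<times> {\<alpha>}"
    by (auto simp: triples_def intro: order_trans[OF index_le_msize])
  hence "card {T :: 'n triple. T \<in> triples \<and> deg T = \<alpha>}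
      \<le> card ({P :: 'n \<Rightarrow> nat. \<forall>i. P i \<le> \<alpha>} \<times> {P :: 'n \<Rightarrow> nat. \<forall>i. P i \<le> \<alpha>} \<times> {\<alpha>})"
    by (intro card_mono finite_cartesian_product finite_bounded_funs) auto
  also have "\<dots> = (\<alpha> + 1) ^ CARD('n) * (\<alpha> + 1) ^ CARD('n)"
    by (simp add: card_cartesian_product card_bounded_funs)
  also have "\<dots> \<le> (2 ^ \<alpha>) ^ CARD('n) * (2 ^ \<alpha>) ^ CARD('n)"
    by (intro mult_mono power_mono) (use less_exp[of \<alpha>] in \<open>simp_all add: Suc_le_eq\<close>)
  also have "\<dots> = (2 ^ (2 * CARD('n))) ^ \<alpha>"
    by (simp flip: power_mult power_add add: algebra_simps mult_2)
  finally show ?thesis .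
qed

text \<open>The base is half the inverse of the rate at which the number of triples of degree \<open>\<alpha>\<close> may
  grow.\<close>

lemma summable_geometric_triples:
  "(\<lambda>T. (1 / (2 * 2 ^ (2 * CARD('n)))) ^ deg T :: real) summable_on (triples :: 'n::finite triple set)"
    (is "?f summable_on _")
proof (rule nonneg_bdd_above_summable_on)
  let ?M = "2 ^ (2 * CARD('n)) :: real"
  show "bdd_above (sum ?f ` {F. F \<subseteq> (triples :: 'n triple set) \<and> finite F})"
  proof (rule bdd_aboveI2)
    fix F assume "F \<in> {F. F \<subseteq> (triples :: 'n triple set) \<and> finite F}"
    hence F: "F \<subseteq> triples" "finite F" by auto
    obtain N where N: "\<And>T. T \<in> F \<Longrightarrow> deg T \<le> N"
      using F(2) by (metis (no_types, opaque_lifting) finite_imageI finite_nat_set_iff_bounded_le imageI)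
    have "sum ?f F \<le> sum ?f (triples_le N)"
      using F N by (intro sum_mono2 finite_triples_le) (auto simp: triples_le_def)
    also have "\<dots> = (\<Sum>\<alpha>\<le>N. \<Sum>T\<in>{T \<in> triples_le N. deg T = \<alpha>}. ?f T)"
      by (subst sum.group) (auto simp: triples_le_def intro: finite_triples_le[unfolded triples_le_def])
    also have "\<dots> \<le> (\<Sum>\<alpha>\<le>N. (1 / 2) ^ \<alpha>)"
    proof (rule sum_mono)
      fix \<alpha> assume "\<alpha> \<in> {..N}"
      hence "{T :: 'n triple. T \<in> triples_le N \<and> deg T = \<alpha>} = {T. T \<in> triples \<and> deg T = \<alpha>}"
        by (auto simp: triples_le_def)
      hence "(\<Sum>T\<in>{T :: 'n triple. T \<in> triples_le N \<and> deg T = \<alpha>}. ?f T)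
          = real (card {T :: 'n triple. T \<in> triples \<and> deg T = \<alpha>}) * (1 / (2 * ?M)) ^ \<alpha>"
        by simp
      also have "\<dots> \<le> ?M ^ \<alpha> * (1 / (2 * ?M)) ^ \<alpha>"
        using card_triples_eq_le[where 'n='n, of \<alpha>]
        by (intro mult_right_mono) (auto simp flip: of_nat_le_iff[where 'a=real])
      also have "\<dots> = (1 / 2) ^ \<alpha>" by (simp flip: power_mult_distrib)
      finally show "(\<Sum>T\<in>{T :: 'n triple. T \<in> triples_le N \<and> deg T = \<alpha>}. ?f T) \<le> (1 / 2) ^ \<alpha>" .
    qed
    also have "\<dots> \<le> (\<Sum>\<alpha>. (1 / 2) ^ \<alpha>)"
      by (intro sum_le_suminf summable_geometric) auto
    finally show "sum ?f F \<le> (\<Sum>\<alpha>. (1 / 2) ^ \<alpha>)" .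
  qed
qed auto

section \<open>Admissible coefficients\<close>

text \<open>The constant is explicit because the bounds have to be uniform in the parameter in the end.\<close>

definition grows :: "real \<Rightarrow> real \<Rightarrow> ('n::finite triple \<Rightarrow> complex) \<Rightarrow> bool" where
  "grows \<epsilon> C c \<longleftrightarrow> (\<forall>T\<in>triples. cmod (c T) \<le> C * fact (deg T) powr \<epsilon>)"

lemma weighted_deg: "weighted \<epsilon> c T = cmod (c T) / fact (deg T) powr \<epsilon>"
  by (cases T) (simp add: weighted_def)

lemma weighted_le_iff: "weighted \<epsilon> c T \<le> C \<longleftrightarrow> cmod (c T) \<le> C * fact (deg T) powr \<epsilon>"
  by (simp add: weighted_deg divide_le_eq)

lemma grows_weighted: "grows \<epsilon> C c \<longleftrightarrow> (\<forall>T\<in>triples. weighted \<epsilon> c T \<le> C)"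
  by (simp add: grows_def weighted_le_iff)

lemma admissible_iff:
  "admissible c \<longleftrightarrow> (\<forall>T. T \<notin> triples \<longrightarrow> c T = 0) \<and> (\<forall>\<epsilon>. 0 < \<epsilon> \<and> \<epsilon> < 1 \<longrightarrow> (\<exists>C. grows \<epsilon> C c))"
  by (auto simp: admissible_def grows_weighted bdd_above_def)

lemma grows_mono: "grows \<epsilon> C c \<Longrightarrow> C \<le> C' \<Longrightarrow> grows \<epsilon> C' c"
  by (force simp: grows_weighted)

lemma admissible_growsE:
  assumes "admissible c" "0 < \<epsilon>" "\<epsilon> < 1"
  obtains C where "0 < C" "grows \<epsilon> C c"
proof -
  obtain C where "grows \<epsilon> C c" using assms by (auto simp: admissible_iff)
  hence "grows \<epsilon> (max C 1) c" by (rule grows_mono) simp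
  thus thesis by (intro that[of "max C 1"]) auto
qed

lemma admissible_outside: "admissible c \<Longrightarrow> T \<notin> triples \<Longrightarrow> c T = 0"
  unfolding admissible_def by blast

lemma zero_triple: "(\<lambda>_. 0, \<lambda>_. 0, 0) \<in> triples" by (simp add: triples_def msize_def)

lemma triples_nonempty [simp]: "triples \<noteq> {}" using zero_triple by blast

lemma grows_nonneg: "grows \<epsilon> C (c :: 'n::finite triple \<Rightarrow> complex) \<Longrightarrow> 0 \<le> C"
proof -
  assume "grows \<epsilon> C c"
  hence "cmod (c (\<lambda>_. 0, \<lambda>_. 0, 0)) \<le> C * fact 0 powr \<epsilon>"
    using zero_triple by (force simp: grows_def)
  thus ?thesis using norm_ge_zero[of "c (\<lambda>_. 0, \<lambda>_. 0, 0)"] by (simp del: norm_ge_zero)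
qed

lemma grows_add: "grows \<epsilon> C c \<Longrightarrow> grows \<epsilon> D d \<Longrightarrow> grows \<epsilon> (C + D) (c + d)"
  by (auto simp: grows_def algebra_simps intro: order_trans[OF norm_triangle_ineq] add_mono)

lemma grows_uminus: "grows \<epsilon> C (- c) \<longleftrightarrow> grows \<epsilon> C c"
  by (simp add: grows_def)

lemma grows_fscale: "grows \<epsilon> C c \<Longrightarrow> grows \<epsilon> (cmod k * C) (fscale k c)"
  by (auto simp: grows_def fscale_def norm_mult mult.assoc intro: mult_left_mono)

lemma admissible_add: "admissible c \<Longrightarrow> admissible d \<Longrightarrow> admissible (c + d)"
  unfolding admissible_iff using grows_add by fastforce

lemma admissible_uminus: "admissible c \<Longrightarrow> admissible (- c)"
  unfolding admissible_iff by (simp add: grows_uminus)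

lemma admissible_diff: "admissible c \<Longrightarrow> admissible d \<Longrightarrow> admissible (c - d)"
  using admissible_add[OF _ admissible_uminus] by fastforce

lemma admissible_fscale: "admissible c \<Longrightarrow> admissible (fscale k c)"
  unfolding admissible_iff using grows_fscale by (fastforce simp: fscale_def)

definition nrm :: "real \<Rightarrow> ('n::finite triple \<Rightarrow> complex) \<Rightarrow> real" where
  "nrm \<epsilon> c = (SUP T\<in>triples. weighted \<epsilon> c T)"

lemma grows_nrm: "admissible c \<Longrightarrow> 0 < \<epsilon> \<Longrightarrow> \<epsilon> < 1 \<Longrightarrow> grows \<epsilon> (nrm \<epsilon> c) c"
  by (auto simp: grows_weighted nrm_def admissible_def intro: cSUP_upper)

lemma nrm_le: "grows \<epsilon> C c \<Longrightarrow> nrm \<epsilon> c \<le> C"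
  by (auto simp: grows_weighted nrm_def intro: cSUP_least)

lemma nrm_nonneg: "admissible c \<Longrightarrow> 0 < \<epsilon> \<Longrightarrow> \<epsilon> < 1 \<Longrightarrow> 0 \<le> nrm \<epsilon> c"
  by (rule grows_nonneg[OF grows_nrm])

lemma nrm_add: "admissible c \<Longrightarrow> admissible d \<Longrightarrow> 0 < \<epsilon> \<Longrightarrow> \<epsilon> < 1 \<Longrightarrow> nrm \<epsilon> (c + d) \<le> nrm \<epsilon> c + nrm \<epsilon> d"
  by (intro nrm_le grows_add grows_nrm)

lemma nrm_uminus: "nrm \<epsilon> (- c) = nrm \<epsilon> c"
  by (simp add: nrm_def weighted_deg)

lemma nrm_zero: "nrm \<epsilon> 0 = 0"
  by (simp add: nrm_def weighted_deg)

lemma nrm_eq_0: "admissible c \<Longrightarrow> 0 < \<epsilon> \<Longrightarrow> \<epsilon> < 1 \<Longrightarrow> nrm \<epsilon> c \<le> 0 \<Longrightarrow> c = 0"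
proof -
  assume *: "admissible c" "0 < \<epsilon>" "\<epsilon> < 1" "nrm \<epsilon> c \<le> 0"
  have "c T = 0" for T
  proof (cases "T \<in> triples")
    case True
    have "cmod (c T) \<le> nrm \<epsilon> c * fact (deg T) powr \<epsilon>" using grows_nrm[OF *(1-3)] True by (auto simp: grows_def)
    also have "\<dots> \<le> 0" using *(4) by (simp add: mult_nonpos_nonneg)
    finally show ?thesis by simp
  qed (rule admissible_outside[OF *(1)])
  thus "c = 0" by auto
qed

text \<open>The denominator \<open>P! (\<alpha>-|P|)! Q! (\<alpha>-|Q|)!\<close> of the basis functions.\<close>

definition tfact :: "'n::finite triple \<Rightarrow> real" where
  "tfact T = rfact (zexp T) * rfact (zbexp T)"

lemma tfact_pos [simp]: "0 < tfact T" by (simp add: tfact_def)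

lemma fact_deg_le: "T \<in> triples \<Longrightarrow> fact (deg T) ^ 2 \<le> (4 ^ CARD('n option)) ^ deg T * tfact (T :: 'n::finite triple)"
proof -
  assume T: "T \<in> triples"
  let ?K = "2 ^ CARD('n option) :: real"
  have "fact (deg T) \<le> ?K ^ deg T * rfact (zexp T)"
       "fact (deg T) \<le> ?K ^ deg T * rfact (zbexp T)"
    using fact_msize_le[of "zexp T"] fact_msize_le[of "zbexp T"]
    by (simp_all add: msize_enc_pair[OF T])
  hence "fact (deg T) * fact (deg T) \<le> (?K ^ deg T * rfact (zexp T)) * (?K ^ deg T * rfact (zbexp T))"
    by (intro mult_mono) (auto simp: less_imp_le)
  also have "\<dots> = (?K * ?K) ^ deg T * tfact T" by (simp only: tfact_def power_mult_distrib mult_ac)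
  also have "?K * ?K = 4 ^ CARD('n option)" by (simp flip: power_mult_distrib)
  finally show ?thesis by (simp add: power2_eq_square)
qed

text \<open>All series converge for this reason: \<open>\<alpha>! / (p! q!)\<close> is \<open>1/\<alpha>!\<close> up to a geometric factor, which
  beats the growth \<open>(\<alpha>!) powr (1/2)\<close> of the coefficients.\<close>

lemma summable_grows:
  assumes "grows (1/2) C (c :: 'n::finite triple \<Rightarrow> complex)" "0 < B"
  shows "(\<lambda>T. cmod (c T) * (B ^ deg T * fact (deg T) / tfact T)) summable_on triples"
proof -
  have C: "0 \<le> C" "grows (1/2) C c" using assms(1) grows_nonneg by auto
  define \<theta> :: real where "\<theta> = 1 / (2 * 2 ^ (2 * CARD('n)))"
  have \<theta>: "0 < \<theta>" by (simp add: \<theta>_def)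
  define D where "D = B * 4 ^ CARD('n option) / \<theta>"
  have D: "0 < D" using assms \<theta> by (simp add: D_def)
  obtain K :: real where K: "0 < K" "\<And>n::nat. D ^ n \<le> K * fact n powr (1/2)"
    using power_le_fact_powr[of "1/2" D] D by auto
  have "(\<lambda>T. C * K * \<theta> ^ deg T) summable_on (triples :: 'n triple set)"
    using summable_geometric_triples[where 'n='n] unfolding \<theta>_def by (rule summable_on_cmult_right)
  thus ?thesis
  proof (rule summable_on_comparison_test)
    fix T :: "'n triple" assume T: "T \<in> triples"
    have f: "fact (deg T) / tfact T \<le> (4 ^ CARD('n option)) ^ deg T / fact (deg T)"
      using fact_deg_le[OF T] by (simp add: field_simps power2_eq_square)
    have "cmod (c T) * (B ^ deg T * fact (deg T) / tfact T)
        = B ^ deg T * cmod (c T) * (fact (deg T) / tfact T)" by simp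
    also have "\<dots> \<le> B ^ deg T * (C * fact (deg T) powr (1/2)) * ((4 ^ CARD('n option)) ^ deg T / fact (deg T))"
      using C T assms f by (intro mult_mono) (auto simp: grows_def intro: less_imp_le)
    also have "\<dots> = C * \<theta> ^ deg T * (D ^ deg T * (fact (deg T) powr (1/2) / fact (deg T)))"
      using \<theta> by (simp add: D_def power_mult_distrib power_divide)
    also have "\<dots> \<le> C * \<theta> ^ deg T * ((K * fact (deg T) powr (1/2)) * (fact (deg T) powr (1/2) / fact (deg T)))"
      using C K \<theta> by (intro mult_left_mono mult_right_mono) auto
    also have "\<dots> = C * K * \<theta> ^ deg T"
      by (simp add: powr_half_sqrt mult.assoc)
    finally show "cmod (c T) * (B ^ deg T * fact (deg T) / tfact T) \<le> C * K * \<theta> ^ deg T" .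
  qed (use assms in \<open>auto simp: less_imp_le\<close>)
qed

lemma summable_coeffs:
  assumes "admissible (c :: 'n::finite triple \<Rightarrow> complex)" "0 < B"
  shows "(\<lambda>T. cmod (c T) * (B ^ deg T * fact (deg T) / tfact T)) summable_on triples"
  using admissible_growsE[OF assms(1), of "1/2"] summable_grows[OF _ assms(2)] by auto

section \<open>Monomials and their Wirtinger derivatives\<close>

definition mpow :: "('m::finite \<Rightarrow> nat) \<Rightarrow> complex ^ 'm \<Rightarrow> complex" where
  "mpow p z = (\<Prod>j\<in>UNIV. (z $ j) ^ p j)"

definition vcnj :: "complex ^ 'm \<Rightarrow> complex ^ 'm" where
  "vcnj z = (\<chi> j. cnj (z $ j))"

definition zmono :: "('m::finite \<Rightarrow> nat) \<Rightarrow> ('m \<Rightarrow> nat) \<Rightarrow> complex ^ 'm \<Rightarrow> complex" where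
  "zmono p q z = mpow p z * mpow q (vcnj z)"

lemma vcnj_nth [simp]: "vcnj z $ j = cnj (z $ j)" by (simp add: vcnj_def)

lemma mpow_add: "mpow (p + r) z = mpow p z * mpow r z"
  by (simp add: mpow_def power_add prod.distrib)

lemma mpow_0 [simp]: "mpow 0 z = 1" by (simp add: mpow_def)

lemma zmono_mult: "zmono p q z * zmono r s z = zmono (p + r) (q + s) z"
  by (simp add: zmono_def mpow_add)

lemma epoly_zmono: "epoly T z = zmono (zexp T) (zbexp T) z"
  by (cases T) (simp add: zmono_def mpow_def enc_pair_def prod_option enc_def)

lemma mpow_has_derivative:
  "(mpow p has_derivative (\<lambda>v. \<Sum>j\<in>UNIV. of_nat (p j) * v $ j * mpow (p(j := p j - 1)) z)) (at z)"
proof -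
  have 1: "((\<lambda>z. (z $ j) ^ p j) has_derivative
       (\<lambda>v. of_nat (p j) * v $ j * (z $ j) ^ (p j - 1))) (at z)" for j
    by (auto intro!: derivative_eq_intros bounded_linear_imp_has_derivative
        bounded_linear_vec_nth simp: fun_eq_iff)
  have 2: "mpow (p(j := p j - 1)) z = (z $ j) ^ (p j - 1) * (\<Prod>k\<in>UNIV - {j}. (z $ k) ^ p k)" for j
    unfolding mpow_def by (subst prod.remove[of UNIV j]) (auto intro!: prod.cong)
  have "((\<lambda>z. \<Prod>j\<in>UNIV. (z $ j) ^ p j) has_derivative (\<lambda>v. \<Sum>j\<in>UNIV.
      (of_nat (p j) * v $ j * (z $ j) ^ (p j - 1)) * (\<Prod>k\<in>UNIV - {j}. (z $ k) ^ p k))) (at z)"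
    by (rule has_derivative_prod[OF 1])
  moreover have "mpow p = (\<lambda>z. \<Prod>j\<in>UNIV. (z $ j) ^ p j)" by (simp add: fun_eq_iff mpow_def)
  ultimately show ?thesis unfolding 2 by (simp add: mult.assoc)
qed

lemma bounded_linear_vcnj: "bounded_linear (vcnj :: complex ^ 'm::finite \<Rightarrow> _)"
proof -
  have "linear (vcnj :: complex ^ 'm \<Rightarrow> _)"
    by (auto intro!: linearI simp: vec_eq_iff complex_eq_iff)
  thus ?thesis by (simp add: linear_conv_bounded_linear)
qed

lemma zmono_has_derivative:
  "(zmono p q has_derivative (\<lambda>v.
      (\<Sum>j\<in>UNIV. of_nat (p j) * v $ j * zmono (p(j := p j - 1)) q z) +
      (\<Sum>j\<in>UNIV. of_nat (q j) * cnj (v $ j) * zmono p (q(j := q j - 1)) z))) (at z)"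
proof -
  have c: "(vcnj has_derivative vcnj) (at z)"
    by (rule bounded_linear_imp_has_derivative[OF bounded_linear_vcnj])
  have "((\<lambda>z. mpow q (vcnj z)) has_derivative
      (\<lambda>v. \<Sum>j\<in>UNIV. of_nat (q j) * vcnj v $ j * mpow (q(j := q j - 1)) (vcnj z))) (at z)"
    by (rule has_derivative_compose[OF c mpow_has_derivative])
  from has_derivative_mult[OF mpow_has_derivative this]
  show ?thesis
    unfolding zmono_def[abs_def]
    by (rule has_derivative_eq_rhs)
       (simp add: fun_eq_iff sum_distrib_left sum_distrib_right mult_ac add.commute)
qed

lemma zpoly_has_derivative:
  "((\<lambda>z. \<Sum>x\<in>A. c x * zmono (f x) (g x) z) has_derivative (\<lambda>v. \<Sum>x\<in>A. c x * (
      (\<Sum>j\<in>UNIV. of_nat (f x j) * v $ j * zmono ((f x)(j := f x j - 1)) (g x) z) +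
      (\<Sum>j\<in>UNIV. of_nat (g x j) * cnj (v $ j) * zmono (f x) ((g x)(j := g x j - 1)) z)))) (at z)"
  by (intro has_derivative_sum has_derivative_mult_right zmono_has_derivative)

lemma sum_axis: "(\<Sum>j\<in>UNIV. a j * (axis i w :: complex ^ 'm::finite) $ j * b j) = a i * w * b i"
proof -
  have "(\<Sum>j\<in>UNIV. a j * (axis i w :: complex ^ 'm) $ j * b j)
      = (\<Sum>j\<in>UNIV. if i = j then a j * w * b j else 0)"
    by (rule sum.cong) (auto simp: axis_def)
  thus ?thesis by simp
qed

lemma sum_axis_cnj:
  "(\<Sum>j\<in>UNIV. a j * cnj ((axis i w :: complex ^ 'm::finite) $ j) * b j) = a i * cnj w * b i"
proof -
  have "(\<Sum>j\<in>UNIV. a j * cnj ((axis i w :: complex ^ 'm) $ j) * b j)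
      = (\<Sum>j\<in>UNIV. if i = j then a j * cnj w * b j else 0)"
    by (rule sum.cong) (auto simp: axis_def)
  thus ?thesis by simp
qed

lemma dz_zpoly:
  "dz i (\<lambda>z. \<Sum>x\<in>A. c x * zmono (f x) (g x) z)
    = (\<lambda>z. \<Sum>x\<in>A. (c x * of_nat (f x i)) * zmono ((f x)(i := f x i - 1)) (g x) z)"
  unfolding dz_def frechet_derivative_at[OF zpoly_has_derivative, symmetric] sum_axis sum_axis_cnj
  by (rule ext) (simp add: sum_distrib_left sum_divide_distrib algebra_simps flip: sum_subtractf)

lemma dzbar_zpoly:
  "dzbar i (\<lambda>z. \<Sum>x\<in>A. c x * zmono (f x) (g x) z)
    = (\<lambda>z. \<Sum>x\<in>A. (c x * of_nat (g x i)) * zmono (f x) ((g x)(i := g x i - 1)) z)"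
  unfolding dzbar_def frechet_derivative_at[OF zpoly_has_derivative, symmetric] sum_axis sum_axis_cnj
  by (rule ext) (simp add: sum_distrib_left sum_divide_distrib algebra_simps flip: sum.distrib)

text \<open>The product of falling factorials that the derivatives along the letters of a word put in
  front of a monomial.\<close>

definition fall :: "'m list \<Rightarrow> ('m::finite \<Rightarrow> nat) \<Rightarrow> complex" where
  "fall is p = (if count_list is \<le> p then mfact p / mfact (p - count_list is) else 0)"

lemma count_list_Cons_upd: "count_list (i # is) = (count_list is)(i := Suc (count_list is i))"
  by (auto simp: fun_eq_iff)

lemma lower_Cons: "p - count_list (i # is) = (p - count_list is)(i := (p - count_list is) i - 1)"
  by (auto simp: fun_eq_iff)

lemma mfact_lower: "0 < p i \<Longrightarrow> mfact p = of_nat (p i) * mfact (p(i := p i - 1))"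
proof -
  assume "0 < p i"
  hence "fact (p i) = (of_nat (p i) * fact (p i - 1) :: complex)" by (cases "p i") auto
  moreover have "mfact p = fact (p i) * (\<Prod>k\<in>UNIV - {i}. fact (p k))"
    unfolding mfact_def by (subst prod.remove[of UNIV i]) auto
  moreover have "mfact (p(i := p i - 1)) = fact (p i - 1) * (\<Prod>k\<in>UNIV - {i}. fact (p k))"
    unfolding mfact_def by (subst prod.remove[of UNIV i]) (auto intro!: prod.cong)
  ultimately show ?thesis by simp
qed

lemma fall_Nil [simp]: "fall [] p = 1"
  by (simp add: fall_def le_fun_def fun_diff_def)

lemma fall_Cons: "fall (i # is) p = fall is p * of_nat ((p - count_list is) i)"
proof (cases "count_list is \<le> p")
  case le: True
  show ?thesis
  proof (cases "(p - count_list is) i = 0")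
    case True
    hence "\<not> count_list (i # is) \<le> p" by (auto simp: le_fun_def not_le intro!: exI[of _ i])
    thus ?thesis using True by (simp add: fall_def del: count_list.simps)
  next
    case False
    hence "count_list (i # is) \<le> p" using le by (auto simp: le_fun_def Suc_le_eq)
    thus ?thesis
      using le False mfact_lower[of "p - count_list is" i]
      unfolding fall_def lower_Cons by (simp del: count_list.simps)
  qed
next
  case False
  hence "\<not> count_list (i # is) \<le> p"
    by (auto simp: le_fun_def not_le) (metis less_SucI)
  with False show ?thesis by (simp add: fall_def del: count_list.simps)
qed

lemma foldr_dz_zpoly:
  "foldr dz is (\<lambda>z. \<Sum>x\<in>A. c x * zmono (f x) (g x) z)
    = (\<lambda>z. \<Sum>x\<in>A. (c x * fall is (f x)) * zmono (f x - count_list is) (g x) z)"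
proof (induction "is")
  case Nil
  have "f x - count_list [] = f x" for x by (simp add: fun_eq_iff)
  thus ?case by simp
next
  case (Cons i "is")
  show ?case
    unfolding foldr_Cons comp_apply Cons.IH dz_zpoly by (simp only: fall_Cons lower_Cons mult.assoc)
qed

lemma foldr_dzbar_zpoly:
  "foldr dzbar is (\<lambda>z. \<Sum>x\<in>A. c x * zmono (f x) (g x) z)
    = (\<lambda>z. \<Sum>x\<in>A. (c x * fall is (g x)) * zmono (f x) (g x - count_list is) z)"
proof (induction "is")
  case Nil
  have "g x - count_list [] = g x" for x by (simp add: fun_eq_iff)
  thus ?case by simp
next
  case (Cons i "is")
  show ?case
    unfolding foldr_Cons comp_apply Cons.IH dzbar_zpoly by (simp only: fall_Cons lower_Cons mult.assoc)
qed

lemma msize_count_list: "msize (count_list (is :: 'm::finite list)) = length is"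
  unfolding msize_def
proof (induction "is")
  case (Cons a "is")
  have "(\<Sum>j\<in>UNIV. count_list (a # is) j) = (\<Sum>j\<in>UNIV. count_list is j + (if a = j then 1 else 0))"
    by (intro sum.cong) auto
  also have "\<dots> = length is + 1" using Cons by (simp only: sum.distrib) simp
  finally show ?case by (simp only: length_Cons)
qed simp

lemma ex_count_list: "\<exists>is. count_list is = (p :: 'm::finite \<Rightarrow> nat)"
proof (induction "msize p" arbitrary: p)
  case 0
  hence "p = count_list []" by (auto simp: msize_def fun_eq_iff)
  thus ?case by metis
next
  case (Suc n)
  then obtain i where i: "0 < p i" by (force simp: msize_def)
  have "msize p = Suc (msize (p(i := p i - 1)))"
    using i by (simp add: msize_def sum.remove[of UNIV i])
  with Suc obtain "is" where "count_list is = p(i := p i - 1)" by (metis nat.inject)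
  hence "count_list (i # is) = p" using i by (simp add: count_list_Cons_upd fun_eq_iff)
  thus ?case by metis
qed

section \<open>Linear independence of the monomials\<close>

lemma frechet_derivative_zero_on_open:
  assumes "open U" "z \<in> U" "\<And>z. z \<in> U \<Longrightarrow> f z = 0"
  shows "frechet_derivative f (at z) = (\<lambda>_. 0)"
proof -
  have "(f has_derivative (\<lambda>_. 0)) (at z)"
    by (rule has_derivative_transform_within_open[OF has_derivative_const assms(1,2)]) (use assms in auto)
  thus ?thesis by (metis frechet_derivative_at)
qed

lemma foldr_dz_zero_on_open:
  "open U \<Longrightarrow> (\<And>z. z \<in> U \<Longrightarrow> f z = 0) \<Longrightarrow> z \<in> U \<Longrightarrow> foldr dz is f z = 0"
  by (induction "is" arbitrary: z) (auto simp: dz_def frechet_derivative_zero_on_open)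

lemma foldr_dzbar_zero_on_open:
  "open U \<Longrightarrow> (\<And>z. z \<in> U \<Longrightarrow> f z = 0) \<Longrightarrow> z \<in> U \<Longrightarrow> foldr dzbar is f z = 0"
  by (induction "is" arbitrary: z) (auto simp: dzbar_def frechet_derivative_zero_on_open)

lemma msize_diff: "q \<le> p \<Longrightarrow> msize (p - q) = msize p - msize q"
  by (simp add: msize_def le_fun_def sum_subtractf_nat)

lemma msize_le_eq: "p \<le> q \<Longrightarrow> msize q \<le> msize p \<Longrightarrow> p = q"
proof -
  assume *: "p \<le> q" "msize q \<le> msize p"
  have "msize (q - p) = 0" using * by (simp add: msize_diff)
  hence "\<forall>i. q i - p i = 0" by (simp add: msize_def)
  with *(1) show "p = q" by (auto simp: fun_eq_iff le_fun_def intro: antisym)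
qed

text \<open>The derivative that belongs to a monomial of maximal degree isolates the coefficient of this
  monomial.\<close>

lemma zmono_independent:
  fixes A :: "(('m::finite \<Rightarrow> nat) \<times> ('m \<Rightarrow> nat)) set"
  assumes "finite A" "open U" "U \<noteq> {}"
    and zero: "\<And>z. z \<in> U \<Longrightarrow> (\<Sum>x\<in>A. c x * zmono (fst x) (snd x) z) = 0"
    and "x \<in> A"
  shows "c x = 0"
proof (rule ccontr)
  assume "c x \<noteq> 0"
  let ?N = "\<lambda>x :: ('m \<Rightarrow> nat) \<times> ('m \<Rightarrow> nat). msize (fst x) + msize (snd x)"
  define S where "S = {x \<in> A. c x \<noteq> 0}"
  have "x \<in> S" using assms(5) \<open>c x \<noteq> 0\<close> by (simp add: S_def)
  moreover have "finite S" using assms(1) by (simp add: S_def)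
  ultimately have S: "finite S" "S \<noteq> {}" by auto
  obtain x0 where x0: "x0 \<in> S" "\<And>x. x \<in> S \<Longrightarrow> ?N x \<le> ?N x0"
  proof -
    have "Max (?N ` S) \<in> ?N ` S" using S by (intro Max_in) auto
    then obtain x0 where "x0 \<in> S" "Max (?N ` S) = ?N x0" by auto
    thus thesis using S(1) by (intro that[of x0]) (auto simp flip: \<open>Max (?N ` S) = ?N x0\<close>)
  qed
  obtain p0 q0 where [simp]: "x0 = (p0, q0)" by (cases x0)
  obtain is0 js0 where l: "count_list is0 = p0" "count_list js0 = q0" using ex_count_list by metis
  obtain z where z: "z \<in> U" using assms by auto
  let ?f = "\<lambda>z. \<Sum>x\<in>A. c x * zmono (fst x) (snd x) z"
  \<comment> \<open>The derivative of type \<open>(p0, q0)\<close> annihilates every other monomial of at most the same degree.\<close>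
  have v: "foldr dzbar js0 ?f z = 0" if "z \<in> U" for z
    by (rule foldr_dzbar_zero_on_open[OF assms(2) zero that])
  have "0 = foldr dz is0 (foldr dzbar js0 ?f) z"
    by (rule sym, rule foldr_dz_zero_on_open[OF assms(2) v z])
  also have "\<dots> = (\<Sum>x\<in>A. ((c x * fall js0 (snd x)) * fall is0 (fst x))
      * zmono (fst x - count_list is0) (snd x - count_list js0) z)"
    unfolding foldr_dzbar_zpoly foldr_dz_zpoly ..
  also have "\<dots> = (\<Sum>x\<in>A. if x = x0 then c x0 * mfact q0 * mfact p0 else 0)"
  proof (rule sum.cong[OF refl])
    fix x assume "x \<in> A"
    obtain p q where [simp]: "x = (p, q)" by (cases x)
    show "((c x * fall js0 (snd x)) * fall is0 (fst x))
      * zmono (fst x - count_list is0) (snd x - count_list js0) z = (if x = x0 then c x0 * mfact q0 * mfact p0 else 0)"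
    proof (cases "x = x0")
      case True
      have "mfact (0 :: 'm \<Rightarrow> nat) = 1" "f - f = (0 :: 'm \<Rightarrow> nat)" for f
        by (simp_all add: mfact_def fun_eq_iff)
      with True show ?thesis by (simp add: fall_def l zmono_def)
    next
      case False
      have "((c x * fall js0 (snd x)) * fall is0 (fst x))
          * zmono (fst x - count_list is0) (snd x - count_list js0) z = 0"
      proof (cases "c x = 0")
        case nz: False
        hence "?N x \<le> ?N x0" using x0(2)[of x] \<open>x \<in> A\<close> by (simp add: S_def)
        hence "\<not> (p0 \<le> p \<and> q0 \<le> q)"
          using False msize_mono[of p0 p] msize_mono[of q0 q] msize_le_eq[of p0 p] msize_le_eq[of q0 q] by auto
        thus ?thesis by (auto simp: fall_def l)
      qed simp
      thus ?thesis by (simp only: False if_False)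
    qed
  qed
  also have "\<dots> = c x0 * mfact q0 * mfact p0" using assms(1) x0(1) by (simp add: S_def)
  finally show False using x0(1) by (simp add: S_def)
qed

section \<open>The Wick product of polynomials\<close>

definition gsign :: "'n::finite option list \<Rightarrow> complex" where
  "gsign is = (\<Prod>k<length is. gmet (is ! k) (is ! k))"

lemma norm_gsign: "cmod (gsign is) = 1"
  unfolding gsign_def prod_norm[symmetric] by (intro prod.neutral) (auto simp: gmet_def)

lemma finite_lists_length: "finite {is :: 'm::finite list. length is = r}"
  using finite_lists_length_eq[of "UNIV :: 'm set" r] by simp

lemma finite_lists_length_le': "finite {is :: 'm::finite list. length is \<le> r}"
  using finite_lists_length_le[of "UNIV :: 'm set" r] by simp

lemma sum_gmet:
  fixes "is" :: "'n::finite option list"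
  assumes "length is = r"
  shows "(\<Sum>js\<in>{js. length js = r}. (\<Prod>k<r. gmet (is ! k) (js ! k)) * X js) = gsign is * X is"
proof -
  have "(\<Prod>k<r. gmet (is ! k) (js ! k)) = (if js = is then gsign is else 0)"
    if "length js = r" for js :: "'n option list"
  proof (cases "js = is")
    case False
    have "\<exists>k<r. js ! k \<noteq> is ! k"
      using False that assms nth_equalityI[of js "is"] by auto
    then obtain k where "k < r" "js ! k \<noteq> is ! k" by auto
    hence "\<exists>k\<in>{..<r}. gmet (is ! k) (js ! k) = 0" by (intro bexI[of _ k]) (auto simp: gmet_def)
    thus ?thesis using False by simp
  qed (use assms in \<open>simp add: gsign_def\<close>)
  hence "(\<Sum>js\<in>{js. length js = r}. (\<Prod>k<r. gmet (is ! k) (js ! k)) * X js)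
      = (\<Sum>js\<in>{js. length js = r}. if js = is then gsign is * X is else 0)"
    by (intro sum.cong) auto
  thus ?thesis using assms finite_lists_length[where 'm="'n option", of r] by simp
qed

lemma fall_eq_0: "msize p < length is \<Longrightarrow> fall is p = 0"
  using msize_mono[of "count_list is" p] by (auto simp: fall_def msize_count_list)

text \<open>The metric is diagonal, so of the double sum over index tuples only the pairs of equal words
  remain. The bound \<open>L\<close> on the length of the words may be any bound for the exponents
  of the left factor.\<close>

lemma wick_zpoly:
  fixes f g f' g' :: "'i \<Rightarrow> 'n::finite option \<Rightarrow> nat"
  assumes L: "\<And>x. x \<in> A \<Longrightarrow> msize (f x) \<le> L"
  shows "wick h (\<lambda>z. \<Sum>x\<in>A. c x * zmono (f x) (g x) z) (\<lambda>z. \<Sum>y\<in>B. d y * zmono (f' y) (g' y) z) z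
    = (\<Sum>x\<in>A. \<Sum>y\<in>B. c x * d y * (\<Sum>is\<in>{is. length is \<le> L}.
        (2 * h) ^ length is / fact (length is) * gsign is * fall is (f x) * fall is (g' y)
          * zmono (f x - count_list is + f' y) (g x + (g' y - count_list is)) z))"
proof -
  define t where "t = (\<lambda>is x y. (2 * h) ^ length is / fact (length is) * gsign is * fall is (f x) * fall is (g' y)
          * zmono (f x - count_list is + f' y) (g x + (g' y - count_list is)) z)"
  have "wick h (\<lambda>z. \<Sum>x\<in>A. c x * zmono (f x) (g x) z) (\<lambda>z. \<Sum>y\<in>B. d y * zmono (f' y) (g' y) z) z
      = (\<Sum>r. \<Sum>is\<in>{is. length is = r}. \<Sum>x\<in>A. \<Sum>y\<in>B. c x * d y * t is x y)"
    unfolding wick_def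
  proof (intro suminf_cong)
    fix r
    show "(2 * h) ^ r / fact r * (\<Sum>is\<in>{is. length is = r}. \<Sum>js\<in>{js. length js = r}.
        (\<Prod>k<r. gmet (is ! k) (js ! k)) *
          foldr dz is (\<lambda>z. \<Sum>x\<in>A. c x * zmono (f x) (g x) z) z *
          foldr dzbar js (\<lambda>z. \<Sum>y\<in>B. d y * zmono (f' y) (g' y) z) z)
      = (\<Sum>is\<in>{is. length is = r}. \<Sum>x\<in>A. \<Sum>y\<in>B. c x * d y * t is x y)"
    proof (subst sum_distrib_left, rule sum.cong[OF refl])
      fix "is" :: "'n option list" assume "is \<in> {is. length is = r}"
      hence r: "length is = r" by simp
      show "(2 * h) ^ r / fact r * (\<Sum>js\<in>{js. length js = r}.
        (\<Prod>k<r. gmet (is ! k) (js ! k)) *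
          foldr dz is (\<lambda>z. \<Sum>x\<in>A. c x * zmono (f x) (g x) z) z *
          foldr dzbar js (\<lambda>z. \<Sum>y\<in>B. d y * zmono (f' y) (g' y) z) z)
        = (\<Sum>x\<in>A. \<Sum>y\<in>B. c x * d y * t is x y)"
        (is "_ * (\<Sum>js\<in>{js. length js = r}. ?g js * ?F * ?G js) = _")
      proof -
        have "(\<Sum>js\<in>{js. length js = r}. ?g js * ?F * ?G js) = gsign is * (?F * ?G is)"
          using sum_gmet[OF r, of "\<lambda>js. ?F * ?G js"] by (simp only: mult.assoc)
        hence "(2 * h) ^ r / fact r * (\<Sum>js\<in>{js. length js = r}. ?g js * ?F * ?G js)
            = (2 * h) ^ r / fact r * (gsign is * (?F * ?G is))" by (simp only:)
        also have "\<dots> = (\<Sum>x\<in>A. \<Sum>y\<in>B. c x * d y * t is x y)"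
          unfolding foldr_dz_zpoly foldr_dzbar_zpoly sum_product unfolding sum_distrib_left
          by (intro sum.cong refl) (simp add: t_def r zmono_mult[symmetric])
        finally show ?thesis .
      qed
    qed
  qed
  also have "\<dots> = (\<Sum>r\<le>L. \<Sum>is\<in>{is. length is = r}. \<Sum>x\<in>A. \<Sum>y\<in>B. c x * d y * t is x y)"
  proof (rule suminf_finite)
    fix r assume "r \<notin> {..L}"
    hence "t is x y = 0" if "length is = r" "x \<in> A" for "is" x y
      using L[OF that(2)] that(1) by (simp add: t_def fall_eq_0)
    thus "(\<Sum>is\<in>{is. length is = r}. \<Sum>x\<in>A. \<Sum>y\<in>B. c x * d y * t is x y) = 0"
      by (intro sum.neutral ballI) auto
  qed simp
  also have "\<dots> = (\<Sum>is\<in>{is. length is \<le> L}. \<Sum>x\<in>A. \<Sum>y\<in>B. c x * d y * t is x y)"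
  proof -
    have "(\<Sum>is\<in>{is. length is \<le> L}. \<Sum>x\<in>A. \<Sum>y\<in>B. c x * d y * t is x y)
        = (\<Sum>r\<le>L. \<Sum>is\<in>{is \<in> {is. length is \<le> L}. length is = r}. \<Sum>x\<in>A. \<Sum>y\<in>B. c x * d y * t is x y)"
      by (rule sum.group[symmetric]) (auto simp: finite_lists_length_le')
    also have "\<dots> = (\<Sum>r\<le>L. \<Sum>is\<in>{is. length is = r}. \<Sum>x\<in>A. \<Sum>y\<in>B. c x * d y * t is x y)"
      by (intro sum.cong) auto
    finally show ?thesis ..
  qed
  also have "\<dots> = (\<Sum>x\<in>A. \<Sum>y\<in>B. \<Sum>is\<in>{is. length is \<le> L}. c x * d y * t is x y)"
    by (subst sum.swap, intro sum.cong refl, subst sum.swap) (rule refl)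
  finally show ?thesis by (simp add: t_def sum_distrib_left)
qed

section \<open>Bounds and convergence of the basis functions\<close>

lemma norm_mpow_le:
  assumes "\<And>j. cmod (z $ j) \<le> R"
  shows "cmod (mpow p z) \<le> R ^ msize p"
proof -
  have "cmod (mpow p z) = (\<Prod>j\<in>UNIV. cmod (z $ j) ^ p j)"
    by (simp add: mpow_def norm_power flip: prod_norm)
  also have "\<dots> \<le> (\<Prod>j\<in>UNIV. R ^ p j)"
    using assms by (intro prod_mono conjI power_mono) auto
  finally show ?thesis by (simp add: msize_def power_sum)
qed

lemma norm_pochhammer_le:
  assumes "cmod u \<le> \<Delta>" "1 \<le> \<Delta>"
  shows "cmod (pochhammer u n) \<le> \<Delta> ^ n * fact n"
proof (induction n)
  case (Suc n)
  have "cmod (u + of_nat n) \<le> \<Delta> + real n"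
    using norm_triangle_ineq[of u "of_nat n"] assms by simp
  also have "\<dots> \<le> \<Delta> * (real n + 1)"
    using mult_right_mono[OF assms(2), of "real n"] by (simp add: algebra_simps)
  finally have "cmod (pochhammer u n) * cmod (u + of_nat n) \<le> \<Delta> ^ n * fact n * (\<Delta> * (real n + 1))"
    using Suc assms by (intro mult_mono) auto
  thus ?case unfolding pochhammer_Suc norm_mult by (simp add: mult_ac add_ac)
qed simp

lemma tfact_eq: "complex_of_real (tfact (P, Q, \<alpha>))
    = mfact P * fact (\<alpha> - msize P) * mfact Q * fact (\<alpha> - msize Q)"
  by (simp add: tfact_def enc_pair_def mfact_enc mult_ac flip: mfact_rfact)

lemma fbasis_Cplus:
  assumes "w \<in> Cplus"
  shows "fbasis h T w = pochhammer (of_real (yfun w) / (2 * h)) (deg T)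
    * (epoly T w / (of_real (yfun w) ^ deg T * of_real (tfact T)))"
  using assms by (cases T) (simp add: fbasis_def fscale_def ybasis_def tfact_eq divide_simps)

lemma fbasis_outside: "w \<notin> Cplus \<Longrightarrow> fbasis h T w = 0"
  by (cases T) (simp add: fbasis_def fscale_def ybasis_def)

lemma norm_epoly_le:
  assumes "T \<in> triples" "\<And>j. cmod (w $ j) \<le> R"
  shows "cmod (epoly T w) \<le> (R * R) ^ deg T"
proof -
  have "cmod (epoly T w) \<le> R ^ deg T * R ^ deg T"
    unfolding epoly_zmono zmono_def norm_mult
    using norm_mpow_le[of w R "zexp T"] norm_mpow_le[of "vcnj w" R "zbexp T"] assms
    by (intro mult_mono) (auto simp: msize_enc_pair intro: order_trans[OF norm_ge_zero])
  thus ?thesis by (simp add: power_mult_distrib)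
qed

text \<open>Allowing a range of arguments \<open>u\<close> serves two purposes: \<open>u = y/(2h)\<close> gives the convergence of the
  series at a point, and variable \<open>u\<close> gives locally uniform convergence of Newton series.\<close>

lemma norm_pochhammer_epoly_le:
  obtains B where "0 < B"
    "\<And>u T. cmod u \<le> \<Delta> \<Longrightarrow> T \<in> triples \<Longrightarrow>
      cmod (pochhammer u (deg T) * (epoly T w / (of_real y ^ deg T * of_real (tfact T))))
        \<le> B ^ deg T * fact (deg T) / tfact T"
proof -
  define R where "R = 1 + norm w"
  have R: "cmod (w $ j) \<le> R" for j using Finite_Cartesian_Product.norm_nth_le[of w j] by (simp add: R_def)
  define D where "D = max \<Delta> 1"
  define Y where "Y = (if y = 0 then 1 else inverse \<bar>y\<bar>)"
  have Y: "0 < Y" "inverse (\<bar>y\<bar> ^ n) \<le> Y ^ n" for n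
    by (auto simp: Y_def power_inverse power_0_left)
  have R0: "0 < R" using norm_ge_zero[of w] by (simp add: R_def del: norm_ge_zero)
  show thesis
  proof (rule that[of "D * (R * R) * Y"])
    show "0 < D * (R * R) * Y" using Y R0 by (simp add: D_def)
    fix u and T :: "'a triple" assume u: "cmod u \<le> \<Delta>" and T: "T \<in> triples"
    have "cmod (pochhammer u (deg T) * (epoly T w / (of_real y ^ deg T * of_real (tfact T))))
      = cmod (pochhammer u (deg T)) * (cmod (epoly T w) * inverse (\<bar>y\<bar> ^ deg T)) / tfact T"
      using tfact_pos[of T] by (simp add: norm_mult norm_divide norm_inverse norm_power divide_inverse mult_ac del: tfact_pos)
    also have "\<dots> \<le> (D ^ deg T * fact (deg T)) * ((R * R) ^ deg T * Y ^ deg T) / tfact T"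
      using norm_pochhammer_le[of u D] norm_epoly_le[OF T R] u Y R0
      by (intro divide_right_mono mult_mono) (auto simp: D_def less_imp_le)
    also have "\<dots> = (D * (R * R) * Y) ^ deg T * fact (deg T) / tfact T"
      by (simp add: power_mult_distrib mult_ac)
    finally show "cmod (pochhammer u (deg T) * (epoly T w / (of_real y ^ deg T * of_real (tfact T))))
      \<le> (D * (R * R) * Y) ^ deg T * fact (deg T) / tfact T" .
  qed
qed

lemma fbasis_bound:
  obtains B where "0 < B"
    "\<And>T. T \<in> triples \<Longrightarrow> cmod (fbasis h T w) \<le> B ^ deg T * fact (deg T) / tfact T"
proof (cases "w \<in> Cplus")
  case True
  obtain B where "0 < B" "\<And>u T. cmod u \<le> cmod (of_real (yfun w) / (2 * h)) \<Longrightarrow> T \<in> triples \<Longrightarrow>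
      cmod (pochhammer u (deg T) * (epoly T w / (of_real (yfun w) ^ deg T * of_real (tfact T))))
        \<le> B ^ deg T * fact (deg T) / tfact T"
    by (rule norm_pochhammer_epoly_le[of "cmod (of_real (yfun w) / (2 * h))" w "yfun w"]) blast
  thus thesis by (intro that[of B]) (simp_all add: fbasis_Cplus[OF True])
next
  case False
  thus thesis by (intro that[of 1]) (simp_all add: fbasis_outside less_imp_le)
qed

lemma fseries_abs_summable:
  assumes "admissible c"
  shows "(\<lambda>T. cmod (c T * fbasis h T w)) summable_on triples"
proof -
  obtain B where B: "0 < B"
    "\<And>T. T \<in> triples \<Longrightarrow> cmod (fbasis h T w) \<le> B ^ deg T * fact (deg T) / tfact T"
    by (rule fbasis_bound[of h w]) blast
  show ?thesis
  proof (rule summable_on_comparison_test[OF summable_coeffs[OF assms B(1)]])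
    fix T :: "'a triple" assume "T \<in> triples"
    from mult_left_mono[OF B(2)[OF this] norm_ge_zero[of "c T"]]
    show "cmod (c T * fbasis h T w) \<le> cmod (c T) * (B ^ deg T * fact (deg T) / tfact T)"
      by (simp only: norm_mult)
  qed simp
qed

lemma fseries_has_sum:
  "admissible c \<Longrightarrow> ((\<lambda>T. c T * fbasis h T w) has_sum fseries h c w) triples"
  unfolding fseries_def by (rule has_sum_infsum[OF abs_summable_summable[OF fseries_abs_summable]])

lemma fseries_add:
  assumes "admissible c" "admissible d"
  shows "fseries h (c + d) = fseries h c + fseries h d"
proof
  fix w
  have "((\<lambda>T. (c + d) T * fbasis h T w) has_sum (fseries h c w + fseries h d w)) triples"
    using has_sum_add[OF fseries_has_sum[OF assms(1)] fseries_has_sum[OF assms(2)]]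
    by (simp add: algebra_simps)
  from has_sum_unique[OF this fseries_has_sum[OF admissible_add[OF assms]]]
  show "fseries h (c + d) w = (fseries h c + fseries h d) w" by simp
qed

lemma fseries_fscale: "fseries h (fscale k c) = fscale k (fseries h c)"
  by (rule ext) (simp add: fseries_def fscale_def mult.assoc infsum_cmult_right')

lemma fseries_uminus: "fseries h (- c) = - fseries h c"
  by (rule ext) (simp add: fseries_def infsum_uminus)

lemma fseries_diff:
  "admissible c \<Longrightarrow> admissible d \<Longrightarrow> fseries h (c - d) = fseries h c - fseries h d"
  using fseries_add[of c "- d" h] admissible_uminus[of d] by (simp add: fseries_uminus)

section \<open>Uniqueness of the coefficients\<close>

lemma yfun_scale: "yfun (\<chi> j. k * w $ j) = (cmod k)\<^sup>2 * yfun w"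
  by (simp add: yfun_def norm_mult power_mult_distrib sum_distrib_left right_diff_distrib)

lemma mpow_scale: "mpow p (\<chi> j. k * w $ j) = k ^ msize p * mpow p w"
  by (simp add: mpow_def power_mult_distrib prod.distrib msize_def power_sum)

lemma epoly_scale:
  assumes "T \<in> triples"
  shows "epoly T (\<chi> j. k * w $ j) = of_real ((cmod k)\<^sup>2) ^ deg T * epoly T w"
proof -
  have "vcnj (\<chi> j. k * w $ j) = (\<chi> j. cnj k * vcnj w $ j)" by (simp add: vcnj_def vec_eq_iff)
  hence "epoly T (\<chi> j. k * w $ j) = (k ^ deg T * cnj k ^ deg T) * epoly T w"
    unfolding epoly_zmono zmono_def by (simp only: mpow_scale msize_enc_pair[OF assms] mult_ac)
  thus ?thesis by (simp only: complex_norm_square power_mult_distrib)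
qed

lemma open_Cplus: "open (Cplus :: (complex ^ 'n::finite option) set)"
  unfolding Cplus_def yfun_def by (intro open_Collect_less continuous_intros)

lemma Cplus_nonempty: "(Cplus :: (complex ^ 'n::finite option) set) \<noteq> {}"
proof -
  have "(\<chi> j. if j = None then 1 else 0) \<in> (Cplus :: (complex ^ 'n option) set)"
    by (simp add: Cplus_def yfun_def)
  thus ?thesis by blast
qed

text \<open>A Newton series \<open>\<Sum>\<alpha>. g\<^sub>\<alpha> (u)\<^sub>\<alpha>\<close> that converges locally uniformly is an entire function of
  \<open>u\<close>. If it vanishes on a ray, then it vanishes at the points \<open>0, -1, -2, ...\<close>, where it
  terminates and so determines its coefficients one after the other.\<close>

lemma newton_series_unique:
  fixes e :: "'n::finite triple \<Rightarrow> complex"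
  assumes bound: "\<And>\<Delta>. \<exists>M. M summable_on triples \<and>
      (\<forall>u T. cmod u \<le> \<Delta> \<longrightarrow> T \<in> triples \<longrightarrow> cmod (pochhammer u (deg T) * e T) \<le> M T)"
    and a: "a \<noteq> 0"
    and zero: "\<And>s::real. 0 < s \<Longrightarrow> (\<Sum>\<^sub>\<infinity>T\<in>triples. pochhammer (of_real s * a) (deg T) * e T) = 0"
  shows "(\<Sum>T\<in>{T \<in> triples. deg T = m}. e T) = 0"
proof -
  define \<Phi> where "\<Phi> u = (\<Sum>\<^sub>\<infinity>T\<in>triples. pochhammer u (deg T) * e T)" for u
  have "\<Phi> holomorphic_on ball 0 \<Delta>" for \<Delta>
  proof -
    obtain M where M: "M summable_on triples"
      "\<And>u T. cmod u \<le> \<Delta> \<Longrightarrow> T \<in> triples \<Longrightarrow> cmod (pochhammer u (deg T) * e T) \<le> M T"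
      using bound[of \<Delta>] by auto
    have "uniform_limit (cball 0 \<Delta>) (\<lambda>F u. \<Sum>T\<in>F. pochhammer u (deg T) * e T)
        (\<lambda>u. \<Sum>\<^sub>\<infinity>T\<in>triples. pochhammer u (deg T) * e T) (finite_subsets_at_top triples)"
      by (rule Weierstrass_m_test_general[OF _ M(1)]) (use M(2) in auto)
    thus ?thesis unfolding \<Phi>_def[abs_def]
      by (rule holomorphic_uniform_limit[rotated])
         (auto intro!: always_eventually continuous_intros holomorphic_intros)
  qed
  hence hol: "\<Phi> holomorphic_on UNIV"
    unfolding holomorphic_on_def
    by (metis UNIV_I at_within_open dist_0_norm field_differentiable_at_within gt_ex mem_ball open_ball)
  have "(\<lambda>s. \<Phi> (s * a)) s = 0" for s
  proof (rule analytic_continuation[where f = "\<lambda>s. \<Phi> (s * a)" and S = UNIV and U = "of_real ` {0<..}" and \<xi> = 1])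
    have "((\<lambda>u. \<Phi> u) \<circ> (\<lambda>s. s * a)) holomorphic_on UNIV"
      by (rule holomorphic_on_compose_gen[OF _ hol]) (auto intro!: holomorphic_intros)
    thus "(\<lambda>s. \<Phi> (s * a)) holomorphic_on UNIV" by (simp add: comp_def)
    show "(1::complex) islimpt of_real ` {0<..}"
      unfolding islimpt_approachable
    proof (intro allI impI)
      fix \<epsilon> :: real assume "0 < \<epsilon>"
      thus "\<exists>x'\<in>complex_of_real ` {0<..}. x' \<noteq> 1 \<and> dist x' 1 < \<epsilon>"
        by (intro bexI[OF _ imageI[of "1 + \<epsilon> / 2"]]) (auto simp: dist_norm)
    qed
  qed (auto simp: \<Phi>_def zero)
  from this[of "u / a" for u] have \<Phi>0: "\<Phi> u = 0" for u using a by simp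
  define g where "g m = (\<Sum>T\<in>{T \<in> triples. deg T = m}. e T)" for m
  have "\<Phi> (- of_nat m) = (\<Sum>\<alpha>\<le>m. pochhammer (- of_nat m) \<alpha> * g \<alpha>)" for m
  proof -
    have "\<Phi> (- of_nat m) = (\<Sum>T\<in>triples_le m. pochhammer (- of_nat m) (deg T) * e T)"
      unfolding \<Phi>_def infsum_finite[OF finite_triples_le, symmetric]
      by (rule infsum_cong_neutral) (auto simp: triples_le_def pochhammer_of_nat_eq_0_iff)
    also have "\<dots> = (\<Sum>\<alpha>\<le>m. \<Sum>T\<in>{T \<in> triples_le m. deg T = \<alpha>}. pochhammer (- of_nat m) (deg T) * e T)"
      by (rule sum.group[OF finite_triples_le finite_atMost, symmetric]) (auto simp: triples_le_def)
    also have "\<dots> = (\<Sum>\<alpha>\<le>m. pochhammer (- of_nat m) \<alpha> * g \<alpha>)"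
      unfolding g_def sum_distrib_left
      by (intro sum.cong refl) (auto simp: triples_le_def)
    finally show ?thesis .
  qed
  hence rec: "(\<Sum>\<alpha>\<le>m. pochhammer (- of_nat m) \<alpha> * g \<alpha>) = 0" for m using \<Phi>0 by metis
  have "g m = 0"
  proof (induction m rule: less_induct)
    case (less m)
    have "0 = (\<Sum>\<alpha>\<in>{..m}. pochhammer (- of_nat m) \<alpha> * g \<alpha>)" using rec by simp
    also have "\<dots> = pochhammer (- of_nat m) m * g m + (\<Sum>\<alpha>\<in>{..m} - {m}. pochhammer (- of_nat m) \<alpha> * g \<alpha>)"
      by (rule sum.remove) auto
    also have "(\<Sum>\<alpha>\<in>{..m} - {m}. pochhammer (- of_nat m) \<alpha> * g \<alpha>) = 0"
      using less by (intro sum.neutral) auto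
    finally show "g m = 0" by (simp add: pochhammer_of_nat_eq_0_iff)
  qed
  thus ?thesis by (simp add: g_def)
qed

lemma inj_on_enc_pair: "inj_on enc_pair triples"
  using bij_betw_enc_pair by (rule bij_betw_imp_inj_on)

lemma epoly_independent:
  fixes A :: "'n::finite triple set"
  assumes "finite A" "A \<subseteq> triples" "open U" "U \<noteq> {}"
    and zero: "\<And>z. z \<in> U \<Longrightarrow> (\<Sum>T\<in>A. c T * epoly T z) = 0" and "T \<in> A"
  shows "c T = 0"
proof -
  have inj: "inj_on enc_pair A" using inj_on_subset[OF inj_on_enc_pair assms(2)] .
  have "(c \<circ> dec) (enc_pair T) = 0"
  proof (rule zmono_independent[of "enc_pair ` A" U])
    fix z assume "z \<in> U"
    have "(\<Sum>x\<in>enc_pair ` A. (c \<circ> dec) x * zmono (fst x) (snd x) z) = (\<Sum>T\<in>A. c T * epoly T z)"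
      using assms(2) by (subst sum.reindex[OF inj]) (auto simp: epoly_zmono dec_enc subset_iff intro!: sum.cong)
    thus "(\<Sum>x\<in>enc_pair ` A. (c \<circ> dec) x * zmono (fst x) (snd x) z) = 0" using zero \<open>z \<in> U\<close> by simp
  qed (use assms in auto)
  thus ?thesis using assms by (auto simp: dec_enc)
qed

text \<open>On the ray through a point of the cone only the Pochhammer symbols vary, so the series becomes a
  Newton series. The vanishing of its coefficients is a polynomial identity on the cone for every
  degree.\<close>

lemma fseries_eq_0_imp:
  fixes c :: "'n::finite triple \<Rightarrow> complex"
  assumes c: "admissible c" and "h \<noteq> 0" and zero: "fseries h c = 0"
  shows "c = 0"
proof
  fix T :: "'n triple"
  show "c T = 0 T"
  proof (cases "T \<in> triples")
    case T: True
    define m where "m = deg T"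
    define A where "A = {T :: 'n triple. T \<in> triples \<and> deg T = m}"
    have "finite A" by (rule finite_subset[OF _ finite_triples_le[of m]]) (auto simp: A_def triples_le_def)
    have "(\<Sum>T\<in>A. (c T / of_real (tfact T)) * epoly T w) = 0" if w: "w \<in> Cplus" for w
    proof -
      define y where "y = yfun w"
      have y: "0 < y" using w by (simp add: Cplus_def y_def)
      define e where "e T = c T * (epoly T w / (of_real y ^ deg T * of_real (tfact T)))" for T
      have em: "e T = (c T / of_real (tfact T)) * epoly T w / of_real y ^ m" if "T \<in> A" for T
        using that by (simp add: e_def A_def)
      have "(\<Sum>T\<in>{T \<in> triples. deg T = m}. e T) = 0"
      proof (rule newton_series_unique)
        fix \<Delta>
        obtain B where B: "0 < B" "\<And>u T. cmod u \<le> \<Delta> \<Longrightarrow> T \<in> triples \<Longrightarrow>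
          cmod (pochhammer u (deg T) * (epoly T w / (of_real y ^ deg T * of_real (tfact T))))
            \<le> B ^ deg T * fact (deg T) / tfact T"
          by (rule norm_pochhammer_epoly_le[of \<Delta> w y]) blast
        show "\<exists>M. M summable_on triples \<and>
          (\<forall>u T. cmod u \<le> \<Delta> \<longrightarrow> T \<in> triples \<longrightarrow> cmod (pochhammer u (deg T) * e T) \<le> M T)"
        proof (intro exI conjI allI impI)
          show "(\<lambda>T. cmod (c T) * (B ^ deg T * fact (deg T) / tfact T)) summable_on triples"
            by (rule summable_coeffs[OF c B(1)])
          fix u and T :: "'n triple" assume "cmod u \<le> \<Delta>" "T \<in> triples"
          from mult_left_mono[OF B(2)[OF this] norm_ge_zero[of "c T"]]
          show "cmod (pochhammer u (deg T) * e T) \<le> cmod (c T) * (B ^ deg T * fact (deg T) / tfact T)"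
            by (simp add: e_def norm_mult norm_divide mult_ac)
        qed
      next
        show "of_real y / (2 * h) \<noteq> 0" using y \<open>h \<noteq> 0\<close> by simp
      next
        fix s :: real assume s: "0 < s"
        define w' where "w' = (\<chi> j. complex_of_real (sqrt s) * w $ j)"
        have y': "yfun w' = s * y" using s by (simp add: w'_def yfun_scale y_def)
        hence w': "w' \<in> Cplus" using s y by (simp add: Cplus_def)
        have "0 = fseries h c w'" using zero by simp
        also have "\<dots> = (\<Sum>\<^sub>\<infinity>T\<in>triples. pochhammer (of_real s * (of_real y / (2 * h))) (deg T) * e T)"
          unfolding fseries_def
        proof (rule infsum_cong)
          fix T :: "'n triple" assume T: "T \<in> triples"
          have "epoly T w' = of_real s ^ deg T * epoly T w"
            unfolding w'_def epoly_scale[OF T] using s by simp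
          thus "c T * fbasis h T w' = pochhammer (of_real s * (of_real y / (2 * h))) (deg T) * e T"
            using s unfolding fbasis_Cplus[OF w'] e_def y' by (simp add: power_mult_distrib)
        qed
        finally show "(\<Sum>\<^sub>\<infinity>T\<in>triples. pochhammer (of_real s * (of_real y / (2 * h))) (deg T) * e T) = 0" ..
      qed
      hence "(\<Sum>T\<in>A. (c T / of_real (tfact T)) * epoly T w / of_real y ^ m) = 0"
        unfolding A_def[symmetric] by (simp only: em cong: sum.cong)
      thus ?thesis using y unfolding sum_divide_distrib[symmetric] by simp
    qed
    moreover have "A \<subseteq> triples" "T \<in> A" using T by (auto simp: A_def m_def)
    ultimately have "c T / of_real (tfact T) = 0"
      using epoly_independent[OF \<open>finite A\<close> _ open_Cplus Cplus_nonempty, of "\<lambda>T. c T / of_real (tfact T)" T]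
      by blast
    thus ?thesis using tfact_pos[of T] by (simp del: tfact_pos)
  qed (use admissible_outside[OF c] in simp)
qed

lemma fseries_inject:
  assumes "admissible c" "admissible d" "h \<noteq> 0" "fseries h c = fseries h d"
  shows "c = d"
  using fseries_eq_0_imp[OF admissible_diff[OF assms(1,2)] assms(3)] fseries_diff[OF assms(1,2), of h] assms(4)
  by simp

lemma coeffs_fseries:
  assumes "admissible c" "h \<noteq> 0"
  shows "coeffs h (fseries h c) = c"
  unfolding coeffs_def using assms by (intro the_equality) (auto intro: fseries_inject)

section \<open>The product in terms of coefficients\<close>

definition mchoose :: "('m::finite \<Rightarrow> nat) \<Rightarrow> ('m \<Rightarrow> nat) \<Rightarrow> nat" where
  "mchoose t r = (\<Prod>i\<in>UNIV. t i choose r i)"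

lemma mchoose_mfact:
  "r \<le> t \<Longrightarrow> of_nat (mchoose t r) = mfact t / (mfact r * mfact (t - r))"
  by (simp add: mchoose_def mfact_def le_fun_def binomial_fact prod_dividef prod.distrib)

lemma sum_mchoose: "(\<Sum>r\<in>{r. r \<le> t}. mchoose t r) = 2 ^ msize (t :: 'm::finite \<Rightarrow> nat)"
proof -
  have "{r. r \<le> t} = (\<Pi>\<^sub>E i\<in>UNIV. {..t i})" by (auto simp: le_fun_def PiE_def)
  hence "(\<Sum>r\<in>{r. r \<le> t}. mchoose t r) = (\<Prod>i\<in>UNIV. \<Sum>k\<le>t i. t i choose k)"
    unfolding mchoose_def by (simp add: prod_sum_PiE)
  thus ?thesis by (simp add: choose_row_sum msize_def power_sum)
qed

text \<open>Exponents of different size do not occur in invariant functions; their coefficient is 0.\<close>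

definition pcoeff ::
  "('n::finite triple \<Rightarrow> complex) \<Rightarrow> ('n option \<Rightarrow> nat) \<Rightarrow> ('n option \<Rightarrow> nat) \<Rightarrow> complex" where
  "pcoeff c p q = (if msize p = msize q then c (dec (p, q)) else 0)"

text \<open>In \<open>f\<^bsub>p,q\<^esub> \<star> f\<^bsub>r,s\<^esub>\<close> a word \<open>is\<close> of contractions removes its letters from \<open>p\<close> and from \<open>s\<close>.
  If \<open>t, u\<close> are the exponents of the result, then \<open>p\<close> and \<open>s\<close> are determined by \<open>r, q\<close> and the
  word, and the degrees determine the length of the word. When \<open>msize q + msize r < deg T\<close>, the
  truncated subtraction yields the empty word, whose term is 0 because its exponents have
  different sizes. Summation over words instead of multi-indices replaces \<open>1/k!\<close> by
  \<open>1/(length is)!\<close>.\<close>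

definition Cmul ::
  "('n::finite triple \<Rightarrow> complex) \<Rightarrow> ('n triple \<Rightarrow> complex) \<Rightarrow> 'n triple \<Rightarrow> complex" where
  "Cmul c d T = (if T \<in> triples then
     (\<Sum>r\<in>{r. r \<le> zexp T}. \<Sum>q\<in>{q. q \<le> zbexp T}.
      \<Sum>is\<in>{is. length is = msize q + msize r - deg T}.
        gsign is / fact (length is) * of_nat (mchoose (zexp T) r)
          * of_nat (mchoose (zbexp T) q)
          * pcoeff c (zexp T - r + count_list is) q
          * pcoeff d r (zbexp T - q + count_list is)) else 0)"

lemma pcoeff_add: "pcoeff (c + d) p q = pcoeff c p q + pcoeff d p q"
  and pcoeff_uminus: "pcoeff (- c) p q = - pcoeff c p q"
  by (simp_all add: pcoeff_def)

lemma Cmul_add_left: "Cmul (c + c') d = Cmul c d + Cmul c' d"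
  by (rule ext) (simp add: Cmul_def pcoeff_add distrib_left distrib_right sum.distrib)

lemma Cmul_add_right: "Cmul c (d + d') = Cmul c d + Cmul c d'"
  by (rule ext) (simp add: Cmul_def pcoeff_add distrib_left distrib_right sum.distrib)

lemma Cmul_uminus_left: "Cmul (- c) d = - Cmul c d"
  by (rule ext) (simp add: Cmul_def pcoeff_uminus sum_negf)

lemma Cmul_uminus_right: "Cmul c (- d) = - Cmul c d"
  by (rule ext) (simp add: Cmul_def pcoeff_uminus sum_negf)

lemma Cmul_diff_left: "Cmul (c - c') d = Cmul c d - Cmul c' d"
  using Cmul_add_left[of c "- c'" d] by (simp add: Cmul_uminus_left)

lemma Cmul_diff_right: "Cmul c (d - d') = Cmul c d - Cmul c d'"
  using Cmul_add_right[of c d "- d'"] by (simp add: Cmul_uminus_right)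

lemma msize_add: "msize (p + q) = msize p + msize q"
  by (simp add: msize_def sum.distrib)

lemma pcoeff_bound:
  assumes "grows \<epsilon> C c" "msize p = msize q"
  shows "cmod (pcoeff c p q) \<le> C * fact (msize q) powr \<epsilon>"
  using assms dec_triples[of "(p, q)"] by (auto simp: pcoeff_def grows_def balanced_def deg_dec)

lemma card_lists_length: "card {is :: 'm::finite list. length is = l} = CARD('m) ^ l"
  using card_lists_length_eq[of "UNIV :: 'm set" l] by simp

text \<open>For an entry of degree \<open>\<gamma>\<close> and words of length \<open>l\<close>, the degrees \<open>\<alpha>, \<beta> \<le> \<gamma>\<close> of the two factors
  satisfy \<open>\<alpha> + \<beta> = \<gamma> + l\<close>. Hence \<open>\<alpha>! \<beta>! \<le> 4\<^sup>\<gamma> \<gamma>! l!\<close>, and the growth beyond \<open>\<gamma>!\<close> is absorbed by the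
  factor \<open>1/l!\<close>. The binomial coefficients sum to \<open>2\<^sup>\<gamma>\<close> each, and there are at most \<open>(n+1)\<^sup>\<gamma>\<close>
  words.\<close>

lemma Cmul_entry_bound:
  fixes c d :: "'n::finite triple \<Rightarrow> complex"
  assumes c: "grows \<epsilon> C c" and d: "grows \<epsilon> D d" and \<epsilon>: "0 \<le> \<epsilon>" "\<epsilon> \<le> 1" and T: "T \<in> triples"
  shows "cmod (Cmul c d T)
    \<le> C * D * (16 * real CARD('n option)) ^ deg T * fact (deg T) powr \<epsilon>"
proof -
  define \<gamma> where "\<gamma> = deg T"
  define t u where "t = zexp T" and "u = zbexp T"
  have tu: "msize t = \<gamma>" "msize u = \<gamma>" using msize_enc_pair[OF T] by (simp_all add: t_def u_def \<gamma>_def)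
  define N where "N = real CARD('n option)"
  have N: "1 \<le> N" by (simp add: N_def)
  have C: "0 \<le> C" and D: "0 \<le> D" using c d by (auto intro: grows_nonneg)
  define E where "E = C * D * 4 ^ \<gamma> * fact \<gamma> powr \<epsilon>"
  have E: "0 \<le> E" using C D by (simp add: E_def)
  define F where "F r q is = gsign is / fact (length is) * of_nat (mchoose t r) * of_nat (mchoose u q)
      * pcoeff c (t - r + count_list is) q * pcoeff d r (u - q + count_list is)" for r q "is"
  have F: "cmod (F r q is) \<le> real (mchoose t r) * real (mchoose u q) * E"
    if rq: "r \<le> t" "q \<le> u" and l: "length is = msize q + msize r - \<gamma>" for r q "is"
  proof (cases "msize (t - r + count_list is) = msize q \<and> msize r = msize (u - q + count_list is)")
    case True
    define l where "l = length is"
    have le: "msize r \<le> \<gamma>" "msize q \<le> \<gamma>" using rq tu msize_mono by metis+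
    have l_eq: "msize q + msize r = \<gamma> + l" and l_le: "l \<le> \<gamma>"
      using True rq le by (simp_all add: msize_add msize_diff msize_count_list tu l_def)
    have "fact (msize q) * fact (msize r) \<le> (fact (\<gamma> + l) :: real)"
      using fact_mult_le_fact_add[of "msize q" "msize r"] l_eq by simp
    also have "\<dots> \<le> 2 ^ (\<gamma> + l) * fact \<gamma> * fact l" by (rule fact_add_le)
    also have "\<dots> \<le> 2 ^ (\<gamma> + \<gamma>) * fact \<gamma> * fact l"
      using l_le by (intro mult_right_mono power_increasing) auto
    finally have "(fact (msize q) * fact (msize r)) powr \<epsilon> \<le> (2 ^ (\<gamma> + \<gamma>) * fact \<gamma> * fact l :: real) powr \<epsilon>"
      using \<epsilon> by (intro powr_mono2) auto
    also have "\<dots> = (2 ^ (\<gamma> + \<gamma>) * fact l) powr \<epsilon> * fact \<gamma> powr \<epsilon>"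
      by (simp add: powr_mult mult_ac)
    also have "\<dots> \<le> (2 ^ (\<gamma> + \<gamma>) * fact l) powr 1 * fact \<gamma> powr \<epsilon>"
    proof (intro mult_right_mono powr_mono \<epsilon>)
      show "1 \<le> (2 :: real) ^ (\<gamma> + \<gamma>) * fact l"
        using mult_mono[of 1 "2 ^ (\<gamma> + \<gamma>)" 1 "fact l :: real"] fact_ge_1[of l, where 'a=real] by simp
    qed simp
    also have "\<dots> = 4 ^ \<gamma> * fact l * fact \<gamma> powr \<epsilon>"
      by (simp add: power_add flip: power_mult_distrib)
    finally have fe: "fact (msize q) powr \<epsilon> * fact (msize r) powr \<epsilon> \<le> 4 ^ \<gamma> * fact l * fact \<gamma> powr \<epsilon>"
      by (simp add: powr_mult)
    have "cmod (pcoeff c (t - r + count_list is) q) * cmod (pcoeff d r (u - q + count_list is))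
        \<le> (C * fact (msize q) powr \<epsilon>) * (D * fact (msize r) powr \<epsilon>)"
      using pcoeff_bound[OF c] pcoeff_bound[OF d] True C D by (intro mult_mono) auto
    also have "\<dots> = C * D * (fact (msize q) powr \<epsilon> * fact (msize r) powr \<epsilon>)" by simp
    also have "\<dots> \<le> C * D * (4 ^ \<gamma> * fact l * fact \<gamma> powr \<epsilon>)"
      using C D fe by (intro mult_left_mono) auto
    also have "\<dots> = fact l * E" by (simp add: E_def)
    finally have *: "cmod (pcoeff c (t - r + count_list is) q) * cmod (pcoeff d r (u - q + count_list is))
        \<le> fact l * E" .
    have "cmod (F r q is) = real (mchoose t r) * real (mchoose u q) / fact l *
        (cmod (pcoeff c (t - r + count_list is) q) * cmod (pcoeff d r (u - q + count_list is)))"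
      by (simp add: F_def norm_mult norm_divide norm_gsign l_def)
    also have "\<dots> \<le> real (mchoose t r) * real (mchoose u q) / fact l * (fact l * E)"
      by (intro mult_left_mono *) auto
    finally show ?thesis by simp
  next
    case False
    hence "F r q is = 0" by (auto simp: F_def pcoeff_def)
    thus ?thesis using E by simp
  qed
  have "cmod (Cmul c d T) = cmod (\<Sum>r\<in>{r. r \<le> t}. \<Sum>q\<in>{q. q \<le> u}.
      \<Sum>is\<in>{is. length is = msize q + msize r - \<gamma>}. F r q is)"
    using T by (simp add: Cmul_def F_def t_def u_def \<gamma>_def)
  also have "\<dots> \<le> (\<Sum>r\<in>{r. r \<le> t}. \<Sum>q\<in>{q. q \<le> u}.
      real (mchoose t r) * real (mchoose u q) * (N ^ \<gamma> * E))"
  proof (intro sum_norm_le)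
    fix r q assume "r \<in> {r. r \<le> t}" "q \<in> {q. q \<le> u}"
    hence rq: "r \<le> t" "q \<le> u" by auto
    let ?l = "msize q + msize r - \<gamma>"
    have "?l \<le> \<gamma>" using msize_mono[OF rq(1)] msize_mono[OF rq(2)] tu by simp
    have "cmod (\<Sum>is\<in>{is. length is = ?l}. F r q is)
        \<le> of_nat (card {is :: 'n option list. length is = ?l}) * (real (mchoose t r) * real (mchoose u q) * E)"
      by (intro order_trans[OF norm_sum] sum_bounded_above F rq) auto
    also have "\<dots> = real (mchoose t r) * real (mchoose u q) * (N ^ ?l * E)"
      unfolding card_lists_length by (simp add: N_def)
    also have "\<dots> \<le> real (mchoose t r) * real (mchoose u q) * (N ^ \<gamma> * E)"
      using E N \<open>?l \<le> \<gamma>\<close> by (intro mult_left_mono mult_right_mono power_increasing) auto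
    finally show "cmod (\<Sum>is\<in>{is. length is = ?l}. F r q is)
        \<le> real (mchoose t r) * real (mchoose u q) * (N ^ \<gamma> * E)" .
  qed
  also have "\<dots> = (\<Sum>r\<in>{r. r \<le> t}. real (mchoose t r)) * (\<Sum>q\<in>{q. q \<le> u}. real (mchoose u q)) * (N ^ \<gamma> * E)"
    unfolding sum_product unfolding sum_distrib_right by (rule refl)
  also have "\<dots> = 2 ^ \<gamma> * 2 ^ \<gamma> * (N ^ \<gamma> * E)"
    using sum_mchoose[of t] sum_mchoose[of u] tu by (simp flip: of_nat_sum)
  also have "\<dots> = C * D * (16 * N) ^ \<gamma> * fact \<gamma> powr \<epsilon>"
  proof -
    have "(16::real) ^ \<gamma> = 2 ^ \<gamma> * 2 ^ \<gamma> * 4 ^ \<gamma>" by (simp flip: power_mult_distrib)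
    thus ?thesis by (simp add: E_def power_mult_distrib)
  qed
  finally show ?thesis by (simp add: N_def \<gamma>_def)
qed

lemma Cmul_grows:
  assumes "\<epsilon> < \<epsilon>'" "0 \<le> \<epsilon>" "\<epsilon> \<le> 1"
  obtains K where "0 < K"
    "\<And>(c :: 'n::finite triple \<Rightarrow> complex) d C D. grows \<epsilon> C c \<Longrightarrow> grows \<epsilon> D d \<Longrightarrow> grows \<epsilon>' (K * C * D) (Cmul c d)"
proof -
  obtain K :: real where K: "0 < K"
    "\<And>n::nat. (16 * real CARD('n option)) ^ n * fact n powr \<epsilon> \<le> K * fact n powr \<epsilon>'"
    by (rule power_mult_fact_powr_le[OF assms(1), of "16 * real CARD('n option)"]) auto
  show thesis
  proof (rule that[OF K(1)])
    fix c d :: "'n triple \<Rightarrow> complex" and C D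
    assume cd: "grows \<epsilon> C c" "grows \<epsilon> D d"
    show "grows \<epsilon>' (K * C * D) (Cmul c d)" unfolding grows_def
    proof
      fix T :: "'n triple" assume T: "T \<in> triples"
      have "cmod (Cmul c d T) \<le> C * D * ((16 * real CARD('n option)) ^ deg T * fact (deg T) powr \<epsilon>)"
        using Cmul_entry_bound[OF cd assms(2,3) T] by (simp only: mult.assoc)
      also have "\<dots> \<le> C * D * (K * fact (deg T) powr \<epsilon>')"
        using grows_nonneg[OF cd(1)] grows_nonneg[OF cd(2)] by (intro mult_left_mono K(2)) auto
      finally show "cmod (Cmul c d T) \<le> K * C * D * fact (deg T) powr \<epsilon>'" by (simp add: mult_ac)
    qed
  qed
qed

lemma admissible_Cmul:
  fixes c d :: "'n::finite triple \<Rightarrow> complex"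
  assumes "admissible c" "admissible d"
  shows "admissible (Cmul c d)"
  unfolding admissible_iff
proof (intro conjI allI impI)
  show "Cmul c d T = 0" if "T \<notin> triples" for T using that by (simp add: Cmul_def)
  fix \<epsilon> :: real assume \<epsilon>: "0 < \<epsilon> \<and> \<epsilon> < 1"
  obtain C where C: "grows (\<epsilon> / 2) C c" using admissible_growsE[OF assms(1), of "\<epsilon> / 2"] \<epsilon> by auto
  obtain D where D: "grows (\<epsilon> / 2) D d" using admissible_growsE[OF assms(2), of "\<epsilon> / 2"] \<epsilon> by auto
  obtain K where "0 < K"
    "\<And>(c :: 'n triple \<Rightarrow> complex) d C D. grows (\<epsilon> / 2) C c \<Longrightarrow> grows (\<epsilon> / 2) D d \<Longrightarrow> grows \<epsilon> (K * C * D) (Cmul c d)"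
    by (rule Cmul_grows[of "\<epsilon> / 2" \<epsilon>]) (use \<epsilon> in auto)
  from this(2)[OF C D] show "\<exists>C. grows \<epsilon> C (Cmul c d)" by blast
qed

definition supp_le :: "nat \<Rightarrow> ('n::finite triple \<Rightarrow> complex) \<Rightarrow> bool" where
  "supp_le N c \<longleftrightarrow> (\<forall>T. T \<notin> triples_le N \<longrightarrow> c T = 0)"

lemma supp_le_mono: "supp_le N c \<Longrightarrow> N \<le> M \<Longrightarrow> supp_le M c"
  by (auto simp: supp_le_def triples_le_def)

lemma pcoeff_supp: "supp_le N c \<Longrightarrow> pcoeff c p q \<noteq> 0 \<Longrightarrow> msize p = msize q \<and> msize q \<le> N"
proof -
  assume "supp_le N c" "pcoeff c p q \<noteq> 0"
  hence m: "msize p = msize q" and "dec (p, q) \<in> triples_le N"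
    unfolding pcoeff_def supp_le_def by (metis, metis)
  thus ?thesis by (simp add: triples_le_def deg_dec)
qed

lemma supp_le_admissible:
  fixes c :: "'n::finite triple \<Rightarrow> complex"
  assumes "supp_le N c"
  shows "admissible c"
  unfolding admissible_iff
proof (intro conjI allI impI)
  show "c T = 0" if "T \<notin> triples" for T
    using that assms unfolding supp_le_def triples_le_def by blast
  fix \<epsilon> :: real assume \<epsilon>: "0 < \<epsilon> \<and> \<epsilon> < 1"
  show "\<exists>C. grows \<epsilon> C c"
    unfolding grows_weighted
  proof (intro exI ballI)
    fix T assume "T \<in> (triples :: 'n triple set)"
    show "weighted \<epsilon> c T \<le> (\<Sum>T\<in>triples_le N. weighted \<epsilon> c T)"
    proof (cases "T \<in> triples_le N")
      case True
      thus ?thesis by (intro member_le_sum finite_triples_le) (auto simp: weighted_deg)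
    next
      case False
      hence "c T = 0" using assms unfolding supp_le_def by blast
      hence "weighted \<epsilon> c T = 0" by (simp add: weighted_deg)
      thus ?thesis by (simp add: sum_nonneg weighted_deg)
    qed
  qed
qed

lemma Cmul_supp:
  assumes "supp_le N c" "supp_le M d"
  shows "supp_le (N + M) (Cmul c d)"
  unfolding supp_le_def
proof (intro allI impI)
  fix T :: "'a triple" assume T: "T \<notin> triples_le (N + M)"
  show "Cmul c d T = 0"
  proof (cases "T \<in> triples")
    case True
    define t u where "t = zexp T" and "u = zbexp T"
    have tu: "msize t = deg T" using msize_enc_pair[OF True] by (simp add: t_def)
    have "pcoeff c (t - r + count_list is) q * pcoeff d r (u - q + count_list is) = 0"
      if "r \<le> t" for r q "is"
    proof (rule ccontr)
      assume "\<not> ?thesis"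
      hence nz: "pcoeff c (t - r + count_list is) q \<noteq> 0" "pcoeff d r (u - q + count_list is) \<noteq> 0" by auto
      from pcoeff_supp[OF assms(1) nz(1)] pcoeff_supp[OF assms(2) nz(2)]
      have "msize (t - r + count_list is) = msize q" "msize q \<le> N" "msize r \<le> M" by auto
      hence "deg T \<le> N + M" using that by (simp add: msize_add msize_diff tu)
      with T True show False by (simp add: triples_le_def)
    qed
    thus ?thesis using True
      by (auto simp: Cmul_def t_def u_def mult.assoc intro!: sum.neutral)
  qed (simp add: Cmul_def)
qed

text \<open>Reading the entries of the product by pairs of factors: the index \<open>(T, r, q, is)\<close> of a term
  corresponds to the index \<open>(x, y, is)\<close> where \<open>x\<close> has exponents \<open>p, q\<close> and \<open>y\<close> has exponents
  \<open>r, s\<close>. Terms outside of this correspondence have a vanishing coefficient.\<close>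

lemma sum_Cmul:
  fixes c d :: "'n::finite triple \<Rightarrow> complex" and \<Lambda> :: "('n option \<Rightarrow> nat) \<Rightarrow> ('n option \<Rightarrow> nat) \<Rightarrow> complex"
  assumes c: "supp_le N c" and d: "supp_le N d"
  shows "(\<Sum>T\<in>triples_le (N + N). Cmul c d T * \<Lambda> (zexp T) (zbexp T))
    = (\<Sum>x\<in>triples_le N. \<Sum>y\<in>triples_le N. c x * d y * (\<Sum>is\<in>{is. length is \<le> N}.
        if count_list is \<le> zexp x \<and> count_list is \<le> zbexp y then
          gsign is / fact (length is)
          * of_nat (mchoose (zexp x - count_list is + zexp y) (zexp y))
          * of_nat (mchoose (zbexp x + (zbexp y - count_list is)) (zbexp x))
          * \<Lambda> (zexp x - count_list is + zexp y)
              (zbexp x + (zbexp y - count_list is))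
        else 0))"
    (is "?lhs = ?rhs")
proof -
  define W where "W = (\<lambda>t u r q (is :: 'n option list). gsign is / fact (length is)
      * of_nat (mchoose t r) * of_nat (mchoose u q) * \<Lambda> t u :: complex)"
  define F where "F = (\<lambda>(T :: 'n triple, r, q, is). W (zexp T) (zbexp T) r q is
      * pcoeff c (zexp T - r + count_list is) q * pcoeff d r (zbexp T - q + count_list is))"
  define G where "G = (\<lambda>(x, y, is). c x * d y
      * W (zexp x - count_list is + zexp y) (zbexp x + (zbexp y - count_list is)) (zexp y) (zbexp x) is)"
  define S where "S = (SIGMA T:triples_le (N + N) :: 'n triple set. SIGMA r:{r. r \<le> zexp T}. SIGMA q:{q. q \<le> zbexp T}.
      {is :: 'n option list. length is = msize q + msize r - deg T})"
  define R :: "('n triple \<times> 'n triple \<times> 'n option list) set" where "R = triples_le N \<times> triples_le N \<times> {is :: 'n option list. length is \<le> N}"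
  define S1 where "S1 = {(T, r, q, is) \<in> S. (zexp T - r + count_list is, q) \<in> balanced \<and> msize q \<le> N \<and>
      (r, zbexp T - q + count_list is) \<in> balanced \<and> msize r \<le> N}"
  define R1 where "R1 = {(x, y, is) \<in> R. count_list is \<le> zexp x \<and> count_list is \<le> zbexp y}"
  have finS: "finite S" unfolding S_def
    by (intro finite_SigmaI finite_triples_le finite_le_mindex finite_lists_length)
  have finR: "finite R" unfolding R_def
    by (intro finite_cartesian_product finite_triples_le finite_lists_length_le')
  have "?lhs = (\<Sum>T\<in>triples_le (N + N). \<Sum>r\<in>{r. r \<le> zexp T}. \<Sum>q\<in>{q. q \<le> zbexp T}.
      \<Sum>is\<in>{is. length is = msize q + msize r - deg T}. F (T, r, q, is))"
  proof (rule sum.cong[OF refl])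
    fix T :: "'n triple" assume "T \<in> triples_le (N + N)"
    hence T: "T \<in> triples" by (simp add: triples_le_def)
    show "Cmul c d T * \<Lambda> (zexp T) (zbexp T) = (\<Sum>r\<in>{r. r \<le> zexp T}. \<Sum>q\<in>{q. q \<le> zbexp T}.
      \<Sum>is\<in>{is. length is = msize q + msize r - deg T}. F (T, r, q, is))"
      unfolding Cmul_def if_P[OF T] sum_distrib_right F_def W_def prod.case
      by (intro sum.cong refl) (simp only: mult_ac)
  qed
  also have "\<dots> = sum F S"
    unfolding S_def
    by (simp add: sum.Sigma finite_triples_le finite_le_mindex finite_lists_length split_def)
  also have "\<dots> = sum F S1"
  proof (rule sum.mono_neutral_right[OF finS])
    show "\<forall>i\<in>S - S1. F i = 0"
    proof (clarify, rule ccontr)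
      fix T r q "is" assume *: "(T, r, q, is) \<in> S" "(T, r, q, is) \<notin> S1" "F (T, r, q, is) \<noteq> 0"
      hence "pcoeff c (zexp T - r + count_list is) q \<noteq> 0" "pcoeff d r (zbexp T - q + count_list is) \<noteq> 0"
        by (auto simp: F_def)
      from pcoeff_supp[OF c this(1)] pcoeff_supp[OF d this(2)] *(1,2)
      show False by (auto simp: S1_def balanced_def)
    qed
  qed (auto simp: S1_def)
  also have "\<dots> = sum G R1"
  proof (rule sum.reindex_bij_witness[where
        j = "\<lambda>(T, r, q, is). (dec (zexp T - r + count_list is, q), dec (r, zbexp T - q + count_list is), is)" and
        i = "\<lambda>(x, y, is). (dec (zexp x - count_list is + zexp y, zbexp x + (zbexp y - count_list is)), zexp y, zbexp x, is)"])
    fix a assume "a \<in> S1"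
    then obtain T r q "is" where a: "a = (T, r, q, is)" and T: "T \<in> triples" "deg T \<le> N + N"
      and rq: "r \<le> zexp T" "q \<le> zbexp T" and l: "length is = msize q + msize r - deg T"
      and b: "(zexp T - r + count_list is, q) \<in> balanced" "(r, zbexp T - q + count_list is) \<in> balanced"
      and N: "msize q \<le> N" "msize r \<le> N"
      by (auto simp: S1_def S_def triples_le_def)
    have e1: "zexp T - r + count_list is - count_list is + r = zexp T"
      using rq by (auto simp: le_fun_def fun_eq_iff)
    have e2: "q + (zbexp T - q + count_list is - count_list is) = zbexp T"
      using rq by (auto simp: le_fun_def fun_eq_iff)
    have le: "count_list is \<le> zexp T - r + count_list is" "count_list is \<le> zbexp T - q + count_list is"
      by (auto simp: le_fun_def)
    note d = enc_dec[OF b(1)] enc_dec[OF b(2)]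
    show "(case case a of (T, r, q, is) \<Rightarrow> (dec (zexp T - r + count_list is, q), dec (r, zbexp T - q + count_list is), is) of
        (x, y, is) \<Rightarrow> (dec (zexp x - count_list is + zexp y, zbexp x + (zbexp y - count_list is)), zexp y, zbexp x, is)) = a"
      by (simp only: a prod.case d fst_conv snd_conv e1 e2 prod.collapse dec_enc[OF T(1)])
    have "length is \<le> N"
      using msize_mono[OF le(1)] b(1) N by (simp add: balanced_def msize_count_list)
    moreover have "dec (zexp T - r + count_list is, q) \<in> triples_le N" "dec (r, zbexp T - q + count_list is) \<in> triples_le N"
      using b N dec_triples[OF b(1)] dec_triples[OF b(2)] by (auto simp: triples_le_def deg_dec balanced_def)
    ultimately show "(case a of (T, r, q, is) \<Rightarrow> (dec (zexp T - r + count_list is, q), dec (r, zbexp T - q + count_list is), is)) \<in> R1"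
      using le by (simp add: a R1_def R_def d)
    have "G (dec (zexp T - r + count_list is, q), dec (r, zbexp T - q + count_list is), is) = F (T, r, q, is)"
      unfolding G_def F_def prod.case d fst_conv snd_conv e1 e2 using b by (simp add: pcoeff_def balanced_def)
    thus "G (case a of (T, r, q, is) \<Rightarrow> (dec (zexp T - r + count_list is, q), dec (r, zbexp T - q + count_list is), is)) = F a"
      by (simp add: a)
  next
    fix b assume "b \<in> R1"
    then obtain x y "is" where b: "b = (x, y, is)" and x: "x \<in> triples" "deg x \<le> N"
      and y: "y \<in> triples" "deg y \<le> N" and l: "length is \<le> N"
      and le: "count_list is \<le> zexp x" "count_list is \<le> zbexp y"
      by (auto simp: R1_def R_def triples_le_def)
    note sx = msize_enc_pair[OF x(1)] and sy = msize_enc_pair[OF y(1)]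
    have lx: "length is \<le> deg x" using msize_mono[OF le(1)] by (simp add: sx msize_count_list)
    have ly: "length is \<le> deg y" using msize_mono[OF le(2)] by (simp add: sy msize_count_list)
    have bal: "(zexp x - count_list is + zexp y, zbexp x + (zbexp y - count_list is)) \<in> balanced"
      using le lx ly by (simp add: balanced_def msize_add msize_diff sx sy msize_count_list)
    note d = enc_dec[OF bal]
    have e1: "zexp x - count_list is + zexp y - zexp y + count_list is = zexp x"
      using le by (auto simp: le_fun_def fun_eq_iff)
    have e2: "zbexp x + (zbexp y - count_list is) - zbexp x + count_list is = zbexp y"
      using le by (auto simp: le_fun_def fun_eq_iff)
    have e3: "zexp x - count_list is + count_list is = zexp x" "zbexp y - count_list is + count_list is = zbexp y"
      using le by (auto simp: le_fun_def fun_eq_iff)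
    show "(case case b of (x, y, is) \<Rightarrow> (dec (zexp x - count_list is + zexp y, zbexp x + (zbexp y - count_list is)), zexp y, zbexp x, is) of
        (T, r, q, is) \<Rightarrow> (dec (zexp T - r + count_list is, q), dec (r, zbexp T - q + count_list is), is)) = b"
      by (simp only: b prod.case d fst_conv snd_conv e1 e2 prod.collapse dec_enc[OF x(1)] dec_enc[OF y(1)])
    have "deg (dec (zexp x - count_list is + zexp y, zbexp x + (zbexp y - count_list is))) = deg x - length is + deg y"
      using le by (simp add: deg_dec msize_add msize_diff sx sy msize_count_list)
    moreover have "zexp y \<le> zexp x - count_list is + zexp y" "zbexp x \<le> zbexp x + (zbexp y - count_list is)"
      by (auto simp: le_fun_def)
    ultimately show "(case b of (x, y, is) \<Rightarrow> (dec (zexp x - count_list is + zexp y, zbexp x + (zbexp y - count_list is)), zexp y, zbexp x, is)) \<in> S1"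
      using x y lx ly dec_triples[OF bal] enc_pair_balanced[OF x(1)] enc_pair_balanced[OF y(1)]
      by (simp add: b S1_def S_def triples_le_def d e1 e2 e3 sx sy)
  qed
  also have "\<dots> = (\<Sum>a\<in>R. if a \<in> R1 then G a else 0)"
    using finR by (subst sum.inter_restrict[symmetric]) (auto simp: R1_def intro!: sum.cong)
  also have "\<dots> = (\<Sum>x\<in>triples_le N. \<Sum>y\<in>triples_le N. \<Sum>is\<in>{is. length is \<le> N}.
      if (x, y, is) \<in> R1 then G (x, y, is) else 0)"
    unfolding R_def sum.cartesian_product' ..
  also have "\<dots> = ?rhs"
    unfolding sum_distrib_left
    by (intro sum.cong refl) (auto simp: R1_def R_def G_def W_def)
  finally show ?thesis .
qed

section \<open>The product of polynomials\<close>

lemma structure_constant: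
  assumes "k \<le> p" "k \<le> s"
  shows "of_nat (mchoose (p - k + r) r) * of_nat (mchoose (q + (s - k)) q) / (mfact (p - k + r) * mfact (q + (s - k)))
    = (mfact p / mfact (p - k)) * (mfact s / mfact (s - k)) / (mfact p * mfact q * (mfact r * mfact s))"
proof -
  have "p - k + r - r = p - k" "q + (s - k) - q = s - k" by (auto simp: fun_eq_iff)
  moreover have "r \<le> p - k + r" "q \<le> q + (s - k)" by (auto simp: le_fun_def)
  ultimately show ?thesis by (simp add: mchoose_mfact)
qed

lemma tfact_mfact: "complex_of_real (tfact T) = mfact (zexp T) * mfact (zbexp T)"
  by (simp add: tfact_def mfact_rfact)

text \<open>With the factorials moved to the basis, the binomial coefficients become the falling factorials
  produced by differentiation.\<close>

lemma sum_Cmul_fall: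
  fixes c d :: "'n::finite triple \<Rightarrow> complex" and \<Lambda> :: "('n option \<Rightarrow> nat) \<Rightarrow> ('n option \<Rightarrow> nat) \<Rightarrow> complex"
  assumes c: "supp_le N c" and d: "supp_le N d"
  shows "(\<Sum>T\<in>triples_le (N + N). Cmul c d T / of_real (tfact T) * \<Lambda> (zexp T) (zbexp T))
    = (\<Sum>x\<in>triples_le N. \<Sum>y\<in>triples_le N. c x / of_real (tfact x) * (d y / of_real (tfact y)) *
        (\<Sum>is\<in>{is. length is \<le> N}. gsign is / fact (length is) * (fall is (zexp x) * fall is (zbexp y))
          * \<Lambda> (zexp x - count_list is + zexp y) (zbexp x + (zbexp y - count_list is))))"
proof -
  have "(\<Sum>T\<in>triples_le (N + N). Cmul c d T / of_real (tfact T) * \<Lambda> (zexp T) (zbexp T))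
    = (\<Sum>T\<in>triples_le (N + N). Cmul c d T * (\<Lambda> (zexp T) (zbexp T) / (mfact (zexp T) * mfact (zbexp T))))"
    by (intro sum.cong refl) (simp add: tfact_mfact)
  also have "\<dots> = (\<Sum>x\<in>triples_le N. \<Sum>y\<in>triples_le N. c x / of_real (tfact x) * (d y / of_real (tfact y)) *
        (\<Sum>is\<in>{is. length is \<le> N}. gsign is / fact (length is) * (fall is (zexp x) * fall is (zbexp y))
          * \<Lambda> (zexp x - count_list is + zexp y) (zbexp x + (zbexp y - count_list is))))"
    unfolding sum_Cmul[OF c d, where \<Lambda> = "\<lambda>t u. \<Lambda> t u / (mfact t * mfact u)"] sum_distrib_left
  proof (intro sum.cong refl)
    fix x y :: "'n triple" and "is" :: "'n option list"
    let ?k = "count_list is"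
    let ?t = "zexp x - ?k + zexp y" and ?u = "zbexp x + (zbexp y - ?k)"
    show "c x * d y * (if ?k \<le> zexp x \<and> ?k \<le> zbexp y then gsign is / fact (length is)
          * of_nat (mchoose ?t (zexp y)) * of_nat (mchoose ?u (zbexp x)) * (\<Lambda> ?t ?u / (mfact ?t * mfact ?u)) else 0)
      = c x / of_real (tfact x) * (d y / of_real (tfact y)) *
        (gsign is / fact (length is) * (fall is (zexp x) * fall is (zbexp y)) * \<Lambda> ?t ?u)"
    proof (cases "?k \<le> zexp x \<and> ?k \<le> zbexp y")
      case True
      have "c x * d y * (gsign is / fact (length is) * of_nat (mchoose ?t (zexp y)) * of_nat (mchoose ?u (zbexp x))
          * (\<Lambda> ?t ?u / (mfact ?t * mfact ?u)))
        = c x * d y * (gsign is / fact (length is)) * \<Lambda> ?t ?u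
          * (of_nat (mchoose ?t (zexp y)) * of_nat (mchoose ?u (zbexp x)) / (mfact ?t * mfact ?u))"
        by (simp only: times_divide_eq_left times_divide_eq_right mult_ac)
      also have "\<dots> = c x * d y * (gsign is / fact (length is)) * \<Lambda> ?t ?u
          * (fall is (zexp x) * fall is (zbexp y) / (of_real (tfact x) * of_real (tfact y)))"
        using structure_constant[of ?k "zexp x" "zbexp y" "zexp y" "zbexp x"] True
        by (simp only: fall_def tfact_mfact simp_thms if_True)
      finally show ?thesis by (simp only: True simp_thms if_True) (simp add: mult_ac)
    next
      case False
      hence "fall is (zexp x) * fall is (zbexp y) = 0" by (auto simp: fall_def)
      thus ?thesis using False by auto
    qed
  qed
  finally show ?thesis .
qed

text \<open>The preimage under \<open>Smap h\<close> of the function with coefficients \<open>c\<close> supported in degree at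
  most \<open>N\<close>.\<close>

definition fpoly :: "complex \<Rightarrow> nat \<Rightarrow> ('n::finite triple \<Rightarrow> complex) \<Rightarrow> complex ^ 'n option \<Rightarrow> complex" where
  "fpoly h N c = (\<lambda>z. \<Sum>T\<in>triples_le N. c T / ((2 * h) ^ deg T * of_real (tfact T)) * epoly T z)"

text \<open>A word of length \<open>l\<close> contributes \<open>(2h)\<^sup>l\<close> and lowers the degree by \<open>l\<close>, so the powers of \<open>2h\<close> cancel
  against those in the normalisation.\<close>

lemma wick_fpoly:
  fixes c d :: "'n::finite triple \<Rightarrow> complex"
  assumes h: "h \<noteq> 0" and c: "supp_le N c" and d: "supp_le N d"
  shows "wick h (fpoly h N c) (fpoly h N d) = fpoly h (N + N) (Cmul c d)"
proof
  fix z :: "complex ^ 'n option"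
  define H where "H = 2 * h"
  have H: "H \<noteq> 0" using h by (simp add: H_def)
  have "wick h (fpoly h N c) (fpoly h N d) z
    = (\<Sum>x\<in>triples_le N. \<Sum>y\<in>triples_le N.
        c x / (H ^ deg x * of_real (tfact x)) * (d y / (H ^ deg y * of_real (tfact y))) *
        (\<Sum>is\<in>{is. length is \<le> N}. H ^ length is / fact (length is) * gsign is * fall is (zexp x) * fall is (zbexp y)
          * zmono (zexp x - count_list is + zexp y) (zbexp x + (zbexp y - count_list is)) z))"
    unfolding fpoly_def epoly_zmono H_def by (rule wick_zpoly) (auto simp: triples_le_def msize_enc_pair)
  also have "\<dots> = (\<Sum>x\<in>triples_le N. \<Sum>y\<in>triples_le N. c x / of_real (tfact x) * (d y / of_real (tfact y)) *
        (\<Sum>is\<in>{is. length is \<le> N}. gsign is / fact (length is) * (fall is (zexp x) * fall is (zbexp y))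
          * (zmono (zexp x - count_list is + zexp y) (zbexp x + (zbexp y - count_list is)) z
            / H ^ msize (zexp x - count_list is + zexp y))))"
    unfolding sum_distrib_left
  proof (intro sum.cong refl)
    fix x y :: "'n triple" and "is" :: "'n option list"
    assume "x \<in> triples_le N" "y \<in> triples_le N"
    hence xy: "x \<in> triples" "y \<in> triples" by (auto simp: triples_le_def)
    let ?t = "zexp x - count_list is + zexp y" and ?u = "zbexp x + (zbexp y - count_list is)"
    show "c x / (H ^ deg x * of_real (tfact x)) * (d y / (H ^ deg y * of_real (tfact y))) *
        (H ^ length is / fact (length is) * gsign is * fall is (zexp x) * fall is (zbexp y) * zmono ?t ?u z)
      = c x / of_real (tfact x) * (d y / of_real (tfact y)) *
        (gsign is / fact (length is) * (fall is (zexp x) * fall is (zbexp y)) * (zmono ?t ?u z / H ^ msize ?t))"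
    proof (cases "count_list is \<le> zexp x")
      case True
      have "length is \<le> deg x"
        using msize_mono[OF True] xy by (simp add: msize_count_list msize_enc_pair)
      hence "deg x + deg y = length is + msize ?t"
        using True xy by (simp add: msize_add msize_diff msize_count_list msize_enc_pair)
      hence "H ^ deg x * H ^ deg y = H ^ length is * H ^ msize ?t" by (simp only: power_add[symmetric])
      hence pw: "H ^ length is / (H ^ deg x * H ^ deg y) = 1 / H ^ msize ?t" using H by simp
      have rearrange: "A / (a * A') * (D / (b * D')) * (l / f * g * p * q * m)
          = A / A' * (D / D') * (g / f * (p * q) * (m * (l / (a * b))))" for A a A' D b D' l f g p q m :: complex
        by (simp add: mult_ac)
      show ?thesis unfolding rearrange pw by simp
    next
      case False
      thus ?thesis by (simp add: fall_def)
    qed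
  qed
  also have "\<dots> = (\<Sum>T\<in>triples_le (N + N). Cmul c d T / of_real (tfact T) * (zmono (zexp T) (zbexp T) z / H ^ msize (zexp T)))"
    by (rule sum_Cmul_fall[OF c d, where \<Lambda> = "\<lambda>t u. zmono t u z / H ^ msize t", symmetric])
  also have "\<dots> = fpoly h (N + N) (Cmul c d) z"
    unfolding fpoly_def by (intro sum.cong refl) (simp add: epoly_zmono msize_enc_pair triples_le_def H_def)
  finally show "wick h (fpoly h N c) (fpoly h N d) z = fpoly h (N + N) (Cmul c d) z" .
qed

lemma sum_fun_apply: "(\<Sum>x\<in>A. f x) z = (\<Sum>x\<in>A. f x z)" for f :: "'a \<Rightarrow> 'b \<Rightarrow> complex"
  by (induction A rule: infinite_finite_induct) auto

lemma inj_on_epoly: "inj_on epoly (triples :: 'n::finite triple set)"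
proof (rule inj_onI, rule ccontr)
  fix T T' :: "'n triple" assume *: "T \<in> triples" "T' \<in> triples" "epoly T = epoly T'" "T \<noteq> T'"
  have "(if T = T then 1 else - 1) = (0 :: complex)"
    by (rule epoly_independent[of "{T, T'}" UNIV "\<lambda>S. if S = T then 1 else - 1"]) (use * in auto)
  thus False by simp
qed

lemma independent_epoly: "cfun.independent (epoly ` (triples :: 'n::finite triple set))"
  unfolding cfun.dependent_explicit
proof clarify
  fix t u v
  assume t: "finite t" "t \<subseteq> epoly ` (triples :: 'n triple set)" "(\<Sum>v\<in>t. fscale (u v) v) = 0" and v: "v \<in> t" "u v \<noteq> 0"
  obtain A where A: "A \<subseteq> triples" "inj_on epoly A" "t = epoly ` A"
    using t(2) by (auto simp: subset_image_inj)
  obtain T where T: "T \<in> A" "v = epoly T" using v(1) A by auto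
  have "u (epoly T) = 0"
  proof (rule epoly_independent[of A UNIV "\<lambda>T. u (epoly T)"])
    show "finite A" using t(1) A finite_imageD by blast
    fix z
    have "(\<Sum>v\<in>t. fscale (u v) v) z = 0" using t(3) by simp
    thus "(\<Sum>T\<in>A. u (epoly T) * epoly T z) = 0"
      using A by (simp add: sum_fun_apply fscale_def sum.reindex)
  qed (use A T in auto)
  thus False using v T by simp
qed

lemma fbasis_fscale: "fbasis h T = fscale (1 / of_real (tfact T)) (ybasis h T)"
  by (cases T) (simp add: fbasis_def tfact_eq)

lemma fscale_fscale: "fscale a (fscale b f) = fscale (a * b) f"
  by (simp add: fscale_def mult.assoc)

lemma Smap_epoly:
  assumes "T \<in> triples"
  shows "Smap h (epoly T) = fscale ((2 * h) ^ deg T * of_real (tfact T)) (fbasis h T)"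
proof -
  have "Smap h (epoly T) = (case the_inv_into triples epoly (epoly T) of
        (P, Q, \<alpha>) \<Rightarrow> fscale ((2 * h) ^ \<alpha>) (ybasis h (P, Q, \<alpha>)))"
    unfolding Smap_def by (rule cfun2.construct_basis[OF independent_epoly imageI[OF assms]])
  also have "\<dots> = fscale ((2 * h) ^ deg T) (ybasis h T)"
    unfolding the_inv_into_f_f[OF inj_on_epoly assms] by (cases T) simp
  finally show ?thesis
    using tfact_pos[of T] by (simp add: fbasis_fscale fscale_fscale del: tfact_pos)
qed

lemma fpoly_sum: "fpoly h N c = (\<Sum>T\<in>triples_le N. fscale (c T / ((2 * h) ^ deg T * of_real (tfact T))) (epoly T))"
  by (rule ext) (simp add: fpoly_def sum_fun_apply fscale_def)

lemma fseries_supp: "supp_le N c \<Longrightarrow> fseries h c = (\<Sum>T\<in>triples_le N. fscale (c T) (fbasis h T))"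
proof (rule ext)
  fix w assume c: "supp_le N c"
  have "fseries h c w = (\<Sum>\<^sub>\<infinity>T\<in>triples_le N. c T * fbasis h T w)"
    unfolding fseries_def
  proof (rule infsum_cong_neutral)
    fix T :: "'a triple" assume "T \<in> triples - triples_le N"
    hence "c T = 0" using c unfolding supp_le_def by blast
    thus "c T * fbasis h T w = 0" by simp
  qed (auto simp: triples_le_def)
  thus "fseries h c w = (\<Sum>T\<in>triples_le N. fscale (c T) (fbasis h T)) w"
    by (simp add: finite_triples_le sum_fun_apply fscale_def)
qed

lemma Smap_fpoly:
  fixes c :: "'n::finite triple \<Rightarrow> complex"
  assumes "h \<noteq> 0" "supp_le N c"
  shows "Smap h (fpoly h N c) = fseries h c"
proof -
  have "Smap h (\<Sum>T\<in>A. fscale (a T) (epoly T)) = (\<Sum>T\<in>A. fscale (a T) (Smap h (epoly T)))"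
    for A and a :: "'n triple \<Rightarrow> complex"
  proof -
    interpret l: Vector_Spaces.linear fscale fscale "Smap h :: (complex ^ 'n option \<Rightarrow> complex) \<Rightarrow> _"
      unfolding Smap_def by (rule cfun2.linear_construct[OF independent_epoly])
    show ?thesis by (simp add: l.sum l.scale)
  qed
  hence "Smap h (fpoly h N c) = (\<Sum>T\<in>triples_le N. fscale (c T / ((2 * h) ^ deg T * of_real (tfact T))) (Smap h (epoly T)))"
    unfolding fpoly_sum .
  also have "\<dots> = (\<Sum>T\<in>triples_le N. fscale (c T) (fbasis h T))"
  proof (rule sum.cong[OF refl])
    fix T :: "'n triple" assume "T \<in> triples_le N"
    hence T: "T \<in> triples" by (simp add: triples_le_def)
    show "fscale (c T / ((2 * h) ^ deg T * of_real (tfact T))) (Smap h (epoly T)) = fscale (c T) (fbasis h T)"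
      unfolding Smap_epoly[OF T] fscale_fscale using assms(1) tfact_pos[of T] by (simp del: tfact_pos)
  qed
  finally show ?thesis using fseries_supp[OF assms(2)] by simp
qed

lemma fpoly_mono:
  assumes "supp_le N c" "N \<le> M"
  shows "fpoly h N c = fpoly h M c"
proof
  fix z
  show "fpoly h N c z = fpoly h M c z"
    unfolding fpoly_def
  proof (rule sum.mono_neutral_left[OF finite_triples_le])
    show "triples_le N \<subseteq> triples_le M" using assms(2) by (auto simp: triples_le_def)
    show "\<forall>T\<in>triples_le M - triples_le N. c T / ((2 * h) ^ deg T * of_real (tfact T)) * epoly T z = 0"
      using assms(1) unfolding supp_le_def by auto
  qed
qed

lemma span_triplesE:
  assumes "a \<in> cfun.span (b ` (triples :: 'n::finite triple set))"
  obtains N and r :: "'n::finite triple \<Rightarrow> complex" where "supp_le N r" "a = (\<Sum>T\<in>triples_le N. fscale (r T) (b T))"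
proof -
  obtain t r where t: "finite t" "t \<subseteq> b ` (triples :: 'n triple set)" "a = (\<Sum>v\<in>t. fscale (r v) v)"
    using assms unfolding cfun.span_explicit by auto
  obtain A where A: "A \<subseteq> triples" "inj_on b A" "t = b ` A"
    using t(2) by (auto simp: subset_image_inj)
  have finA: "finite A" using t(1) A finite_imageD by blast
  obtain N where N: "\<And>T. T \<in> A \<Longrightarrow> deg T \<le> N"
    using finA by (metis (no_types, opaque_lifting) finite_imageI finite_nat_set_iff_bounded_le imageI)
  define r' where "r' T = (if T \<in> A then r (b T) else 0)" for T
  have sub: "A \<subseteq> triples_le N" using A N by (auto simp: triples_le_def)
  have "a = (\<Sum>T\<in>A. fscale (r' T) (b T))" using t(3) A by (simp add: sum.reindex r'_def)
  also have "\<dots> = (\<Sum>T\<in>triples_le N. fscale (r' T) (b T))"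
    using sub by (intro sum.mono_neutral_left finite_triples_le) (auto simp: r'_def)
  finally show thesis
    using sub by (intro that[of N r']) (auto simp: supp_le_def r'_def)
qed

lemma inv_polysE:
  assumes "h \<noteq> 0" "p \<in> inv_polys"
  obtains N c where "supp_le N c" "p = fpoly h N c"
proof -
  obtain N and r :: "'a triple \<Rightarrow> complex" where r: "supp_le N r" "p = (\<Sum>T\<in>triples_le N. fscale (r T) (epoly T))"
    using assms(2) unfolding inv_polys_def by (rule span_triplesE)
  define c where "c T = r T * ((2 * h) ^ deg T * of_real (tfact T))" for T
  have "c T / ((2 * h) ^ deg T * of_real (tfact T)) = r T" for T
    using assms(1) tfact_pos[of T] by (simp add: c_def del: tfact_pos)
  hence "p = fpoly h N c" using r(2) by (simp add: fpoly_sum)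
  moreover have "supp_le N c" using r(1) by (auto simp: supp_le_def c_def)
  ultimately show thesis by (intro that)
qed

lemma fpoly_inv_polys: "fpoly h N c \<in> inv_polys"
  unfolding inv_polys_def fpoly_sum
  by (intro cfun.span_sum cfun.span_scale cfun.span_base) (auto simp: triples_le_def)

lemma inj_on_Smap:
  assumes "h \<noteq> 0"
  shows "inj_on (Smap h) (inv_polys :: (complex ^ 'n::finite option \<Rightarrow> complex) set)"
proof (rule inj_onI)
  fix p p' :: "complex ^ 'n option \<Rightarrow> complex"
  assume *: "p \<in> inv_polys" "p' \<in> inv_polys" "Smap h p = Smap h p'"
  obtain N c where c: "supp_le N c" "p = fpoly h N c" using inv_polysE[OF assms *(1)] by blast
  obtain M d where d: "supp_le M d" "p' = fpoly h M d" using inv_polysE[OF assms *(2)] by blast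
  have "fseries h c = fseries h d" using *(3) c d assms by (simp add: Smap_fpoly)
  hence "c = d" using c d assms by (intro fseries_inject supp_le_admissible)
  thus "p = p'"
    using c d fpoly_mono[OF c(1), of "max N M" h] fpoly_mono[OF d(1), of "max N M" h] by simp
qed

lemma Sinv_fseries:
  assumes "h \<noteq> 0" "supp_le N c"
  shows "Sinv h (fseries h c) = fpoly h N c"
  unfolding Sinv_def Smap_fpoly[OF assms, symmetric]
  by (rule inv_into_f_f[OF inj_on_Smap[OF assms(1)] fpoly_inv_polys])

lemma star_cone_fseries:
  assumes "h \<noteq> 0" "supp_le N c" "supp_le N d"
  shows "star_cone h (fseries h c) (fseries h d) = fseries h (Cmul c d)"
  unfolding star_cone_def Sinv_fseries[OF assms(1,2)] Sinv_fseries[OF assms(1,3)] wick_fpoly[OF assms]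
  by (rule Smap_fpoly[OF assms(1) Cmul_supp[OF assms(2,3)]])

lemma AconeE:
  assumes "a \<in> Acone h"
  obtains N c where "supp_le N c" "a = fseries h c"
proof -
  obtain N and r :: "'a triple \<Rightarrow> complex" where "supp_le N r" "a = (\<Sum>T\<in>triples_le N. fscale (r T) (fbasis h T))"
    using assms unfolding Acone_def by (rule span_triplesE)
  thus thesis by (intro that[of N r]) (auto simp: fseries_supp)
qed

lemma fseries_Acone: "supp_le N c \<Longrightarrow> fseries h c \<in> Acone h"
  unfolding Acone_def
  by (subst fseries_supp, assumption, intro cfun.span_sum cfun.span_scale cfun.span_base) (auto simp: triples_le_def)

section \<open>The topology of the completed algebra\<close>

lemma allowed_nonzero: "h \<in> allowed \<Longrightarrow> h \<noteq> 0"
  by (auto simp: allowed_def)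

lemma Ahat_coneE:
  assumes "a \<in> Ahat_cone h"
  obtains c where "admissible c" "a = fseries h c"
  using assms by (auto simp: Ahat_cone_def)

lemma fseries_Ahat_cone: "admissible c \<Longrightarrow> fseries h c \<in> Ahat_cone h"
  by (auto simp: Ahat_cone_def)

lemma seminorm_cone_fseries:
  assumes "admissible c" "admissible d" "h \<noteq> 0"
  shows "seminorm_cone h \<epsilon> (fseries h c - fseries h d) = nrm \<epsilon> (c - d)"
  unfolding seminorm_cone_def nrm_def fseries_diff[OF assms(1,2), symmetric]
    coeffs_fseries[OF admissible_diff[OF assms(1,2)] assms(3)] ..

text \<open>The subbasic neighbourhoods in terms of coefficients.\<close>

definition nball :: "complex \<Rightarrow> real \<Rightarrow> real \<Rightarrow> ('n::finite triple \<Rightarrow> complex) \<Rightarrow> (complex ^ 'n option \<Rightarrow> complex) set" where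
  "nball h \<epsilon> r d = fseries h ` {c. admissible c \<and> nrm \<epsilon> (c - d) < r}"

lemma nball_eq:
  assumes "admissible d" "h \<noteq> 0"
  shows "{b \<in> Ahat_cone h. seminorm_cone h \<epsilon> (b - fseries h d) < r} = nball h \<epsilon> r d"
  using assms by (auto simp: nball_def Ahat_cone_def seminorm_cone_fseries)

lemma fseries_in_nball:
  assumes "admissible c" "h \<noteq> 0"
  shows "fseries h c \<in> nball h \<epsilon> r d \<longleftrightarrow> nrm \<epsilon> (c - d) < r"
  using assms by (auto simp: nball_def dest: fseries_inject[OF assms(1) _ assms(2)])

lemma top_cone_eq:
  assumes "h \<noteq> 0"
  shows "top_cone h = topology_generated_by
    {nball h \<epsilon> r d | (d :: 'n::finite triple \<Rightarrow> complex) \<epsilon> r. admissible d \<and> 0 < \<epsilon> \<and> \<epsilon> < 1 \<and> 0 < r}"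
proof -
  have "{{b \<in> Ahat_cone h. seminorm_cone h \<epsilon> (b - a) < r} | a \<epsilon> r.
        a \<in> Ahat_cone h \<and> 0 < \<epsilon> \<and> \<epsilon> < 1 \<and> 0 < r}
    = {nball h \<epsilon> r d | (d :: 'n triple \<Rightarrow> complex) \<epsilon> r. admissible d \<and> 0 < \<epsilon> \<and> \<epsilon> < 1 \<and> (0::real) < r}"
    (is "?A = ?B")
  proof (intro equalityI subsetI)
    fix U assume "U \<in> ?A"
    then obtain a \<epsilon> r where *: "U = {b \<in> Ahat_cone h. seminorm_cone h \<epsilon> (b - a) < r}"
      "a \<in> Ahat_cone h" "0 < \<epsilon>" "\<epsilon> < 1" "0 < r" by blast
    obtain d where d: "admissible d" "a = fseries h d" using *(2) by (rule Ahat_coneE)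
    have "U = nball h \<epsilon> r d" unfolding *(1) d(2) by (rule nball_eq[OF d(1) assms])
    thus "U \<in> ?B" using * d by blast
  next
    fix U assume "U \<in> ?B"
    then obtain d \<epsilon> r where *: "U = nball h \<epsilon> r d" "admissible d" "0 < \<epsilon>" "\<epsilon> < 1" "0 < r" by blast
    have "U = {b \<in> Ahat_cone h. seminorm_cone h \<epsilon> (b - fseries h d) < r}"
      unfolding *(1) by (rule nball_eq[OF *(2) assms, symmetric])
    thus "U \<in> ?A" using * fseries_Ahat_cone[OF *(2), of h] by blast
  qed
  thus ?thesis by (simp add: top_cone_def)
qed

lemma openin_nball:
  "h \<noteq> 0 \<Longrightarrow> admissible d \<Longrightarrow> 0 < \<epsilon> \<Longrightarrow> \<epsilon> < 1 \<Longrightarrow> 0 < r \<Longrightarrow> openin (top_cone h) (nball h \<epsilon> r d)"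
  unfolding top_cone_eq by (rule topology_generated_by_Basis) blast

lemma topspace_top_cone: "h \<noteq> 0 \<Longrightarrow> topspace (top_cone h) = Ahat_cone h"
proof (intro equalityI subsetI)
  fix a assume h: "h \<noteq> 0" and "a \<in> topspace (top_cone h)"
  thus "a \<in> Ahat_cone h"
    by (auto simp: top_cone_eq nball_def intro: fseries_Ahat_cone)
next
  fix a assume h: "h \<noteq> 0" and "a \<in> Ahat_cone h"
  then obtain c where c: "admissible c" "a = fseries h c" using Ahat_coneE by blast
  have "a \<in> nball h (1/2) 1 c"
    using c h by (simp add: fseries_in_nball nrm_zero)
  moreover have "openin (top_cone h) (nball h (1/2) 1 c)" using c h by (intro openin_nball) auto
  ultimately show "a \<in> topspace (top_cone h)" using openin_subset by blast
qed

lemma nrm_diff_commute: "nrm \<epsilon> (c - d) = nrm \<epsilon> (d - c)"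
  using nrm_uminus[of \<epsilon> "c - d"] by simp

lemma nrm_triangle:
  assumes "admissible a" "admissible b" "admissible c" "0 < \<epsilon>" "\<epsilon> < 1"
  shows "nrm \<epsilon> (a - c) \<le> nrm \<epsilon> (a - b) + nrm \<epsilon> (b - c)"
  using nrm_add[OF admissible_diff[OF assms(1,2)] admissible_diff[OF assms(2,3)] assms(4,5)] by simp

lemma limitin_top_cone:
  assumes h: "h \<noteq> 0" and c: "admissible c" and C: "eventually (\<lambda>k. admissible (C k)) F"
    and lim: "\<And>\<epsilon> r. 0 < \<epsilon> \<Longrightarrow> \<epsilon> < 1 \<Longrightarrow> 0 < r \<Longrightarrow> eventually (\<lambda>k. nrm \<epsilon> (C k - c) < r) F"
  shows "limitin (top_cone h) (\<lambda>k. fseries h (C k)) (fseries h c) F"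
  unfolding limitin_def topspace_top_cone[OF h]
proof (intro conjI allI impI)
  show "fseries h c \<in> Ahat_cone h" by (rule fseries_Ahat_cone[OF c])
  fix U assume "openin (top_cone h) U \<and> fseries h c \<in> U"
  hence "generate_topology_on {nball h \<epsilon> r d | d \<epsilon> r. admissible d \<and> 0 < \<epsilon> \<and> \<epsilon> < 1 \<and> (0::real) < r} U"
    and "fseries h c \<in> U"
    unfolding top_cone_eq[OF h] openin_topology_generated_by_iff by auto
  thus "eventually (\<lambda>k. fseries h (C k) \<in> U) F"
  proof (induction rule: generate_topology_on.induct)
    case (Int a b)
    thus ?case by (auto intro: eventually_conj)
  next
    case (UN K)
    then obtain k where "k \<in> K" "fseries h c \<in> k" by auto
    with UN have "eventually (\<lambda>x. fseries h (C x) \<in> k) F" by blast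
    thus ?case by eventually_elim (use \<open>k \<in> K\<close> in auto)
  next
    case (Basis s)
    then obtain d \<epsilon> r where s: "s = nball h \<epsilon> r d" "admissible d" "0 < \<epsilon>" "\<epsilon> < 1" "0 < r" by blast
    have "nrm \<epsilon> (c - d) < r" using Basis.prems fseries_in_nball[OF c h] by (simp add: s(1))
    hence "eventually (\<lambda>k. nrm \<epsilon> (C k - c) < r - nrm \<epsilon> (c - d)) F" by (intro lim s) auto
    with C show ?case
    proof eventually_elim
      case (elim k)
      thus ?case using nrm_triangle[OF elim(1) c s(2,3,4)] fseries_in_nball[OF elim(1) h] by (simp add: s(1))
    qed
  qed auto
qed

lemma limitin_top_cone_unique:
  assumes h: "h \<noteq> 0" and c: "admissible c" and d: "admissible d" and F: "F \<noteq> bot"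
    and lim: "limitin (top_cone h) f (fseries h c) F" "limitin (top_cone h) f (fseries h d) F"
  shows "c = d"
proof -
  have "nrm (1/2) (c - d) \<le> 0 + r" if r: "0 < r" for r :: real
  proof -
    have "eventually (\<lambda>k. f k \<in> nball h (1/2) (r / 2) c) F" "eventually (\<lambda>k. f k \<in> nball h (1/2) (r / 2) d) F"
      using lim r openin_nball[OF h c, of "1/2" "r/2"] openin_nball[OF h d, of "1/2" "r/2"]
        fseries_in_nball[OF c h, of "1/2" "r/2" c] fseries_in_nball[OF d h, of "1/2" "r/2" d]
      by (auto simp: limitin_def nrm_zero)
    hence "eventually (\<lambda>k. f k \<in> nball h (1/2) (r / 2) c \<and> f k \<in> nball h (1/2) (r / 2) d) F"
      by (rule eventually_conj)
    then obtain k where k: "f k \<in> nball h (1/2) (r / 2) c" "f k \<in> nball h (1/2) (r / 2) d"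
      using eventually_happens'[OF F] by blast
    then obtain e where e: "admissible e" "f k = fseries h e" by (auto simp: nball_def)
    have "nrm (1/2) (e - c) < r / 2" "nrm (1/2) (e - d) < r / 2"
      using k e h by (simp_all add: fseries_in_nball)
    thus ?thesis using nrm_triangle[OF c e(1) d, of "1/2"] nrm_diff_commute[of "1/2" c e] by simp
  qed
  hence "nrm (1/2) (c - d) \<le> 0" by (rule field_le_epsilon)
  from nrm_eq_0[OF admissible_diff[OF c d] _ _ this] show "c = d" by simp
qed

section \<open>Approximation by finite sums\<close>

definition trunc :: "'n::finite triple set \<Rightarrow> ('n triple \<Rightarrow> complex) \<Rightarrow> 'n triple \<Rightarrow> complex" where
  "trunc A c = (\<lambda>T. if T \<in> A then c T else 0)"

lemma finite_triplesE:
  assumes "finite A" "A \<subseteq> triples"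
  obtains N where "A \<subseteq> triples_le N"
proof -
  obtain N where "\<And>T. T \<in> A \<Longrightarrow> deg T \<le> N"
    using assms(1) by (metis (no_types, opaque_lifting) finite_imageI finite_nat_set_iff_bounded_le imageI)
  hence "A \<subseteq> triples_le N" using assms(2) by (auto simp: triples_le_def)
  thus thesis by (rule that)
qed

lemma supp_le_trunc: "A \<subseteq> triples_le N \<Longrightarrow> supp_le N (trunc A c)"
  by (auto simp: supp_le_def trunc_def)

lemma admissible_trunc:
  assumes "finite A" "A \<subseteq> triples"
  shows "admissible (trunc A c)"
proof -
  obtain N where "A \<subseteq> triples_le N" using assms by (rule finite_triplesE)
  thus ?thesis by (rule supp_le_admissible[OF supp_le_trunc])
qed

text \<open>Coefficients bounded by \<open>(\<alpha>!) powr (\<epsilon>/2)\<close> are small against the weight \<open>(\<alpha>!) powr \<epsilon>\<close> in high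
  degree.\<close>

lemma trunc_tendsto:
  fixes c :: "'n::finite triple \<Rightarrow> complex"
  assumes c: "admissible c" and \<epsilon>: "0 < \<epsilon>" "\<epsilon> < 1" and r: "0 < r"
  shows "eventually (\<lambda>A. nrm \<epsilon> (trunc A c - c) < r) (finite_subsets_at_top triples)"
proof -
  obtain C where C: "0 < C" "grows (\<epsilon> / 2) C c" using admissible_growsE[OF c, of "\<epsilon> / 2"] \<epsilon> by auto
  obtain K :: real where K: "0 < K" "\<And>n::nat. 2 ^ n \<le> K * fact n powr (\<epsilon> / 2)"
    using power_le_fact_powr[of "\<epsilon> / 2" 2] \<epsilon> by auto
  obtain N where N: "2 * C * K / r < 2 ^ N" using real_arch_pow[of 2 "2 * C * K / r"] by auto
  have "nrm \<epsilon> (trunc A c - c) \<le> r / 2" if A: "triples_le N \<subseteq> A" for A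
  proof (rule nrm_le, unfold grows_def, rule ballI)
    fix T :: "'n triple" assume T: "T \<in> triples"
    show "cmod ((trunc A c - c) T) \<le> r / 2 * fact (deg T) powr \<epsilon>"
    proof (cases "T \<in> triples_le N")
      case True
      thus ?thesis using A r by (auto simp: trunc_def)
    next
      case False
      hence "N \<le> deg T" using T by (simp add: triples_le_def)
      hence "2 * C * K / r \<le> 2 ^ deg T" using N power_increasing[of N "deg T" "2::real"] by linarith
      also have "\<dots> \<le> K * fact (deg T) powr (\<epsilon> / 2)" by (rule K)
      finally have "C \<le> r / 2 * fact (deg T) powr (\<epsilon> / 2)" using K(1) r by (simp add: field_simps)
      hence "C * fact (deg T) powr (\<epsilon> / 2) \<le> r / 2 * fact (deg T) powr (\<epsilon> / 2) * fact (deg T) powr (\<epsilon> / 2)"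
        by (rule mult_right_mono) simp
      moreover have "r / 2 * fact (deg T) powr (\<epsilon> / 2) * fact (deg T) powr (\<epsilon> / 2) = r / 2 * fact (deg T) powr \<epsilon>"
        by (simp add: powr_add[symmetric])
      moreover have "cmod (c T) \<le> C * fact (deg T) powr (\<epsilon> / 2)" using C(2) T unfolding grows_def by blast
      ultimately have "cmod (c T) \<le> r / 2 * fact (deg T) powr \<epsilon>" by linarith
      moreover have "cmod ((trunc A c - c) T) \<le> cmod (c T)" by (simp add: trunc_def)
      ultimately show ?thesis by linarith
    qed
  qed
  hence "nrm \<epsilon> (trunc A c - c) \<le> r / 2 \<and> r / 2 < r" if "triples_le N \<subseteq> A" for A using r that by simp
  hence "nrm \<epsilon> (trunc A c - c) < r" if "triples_le N \<subseteq> A" for A using order_le_less_trans that by blast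
  thus ?thesis
    unfolding eventually_finite_subsets_at_top
    by (intro exI[of _ "triples_le N"]) (simp add: finite_triples_le, simp add: triples_le_def)
qed

lemma eventually_finite_subset:
  "eventually (\<lambda>A. finite A \<and> A \<subseteq> S) (finite_subsets_at_top S)"
  unfolding eventually_finite_subsets_at_top by (intro exI[of _ "{}"]) auto

lemma limitin_trunc:
  assumes "h \<noteq> 0" "admissible c"
  shows "limitin (top_cone h) (\<lambda>A. fseries h (trunc A c)) (fseries h c) (finite_subsets_at_top triples)"
  using assms
  by (intro limitin_top_cone trunc_tendsto)
     (auto intro: eventually_mono[OF eventually_finite_subset] admissible_trunc)

section \<open>The product of the completed algebra\<close>

lemma Cmul_nrm:
  assumes "0 < \<epsilon>" "\<epsilon> < 1"
  obtains K where "0 < K"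
    "\<And>c d :: 'n::finite triple \<Rightarrow> complex. admissible c \<Longrightarrow> admissible d \<Longrightarrow>
      nrm \<epsilon> (Cmul c d) \<le> K * nrm (\<epsilon> / 2) c * nrm (\<epsilon> / 2) d"
proof -
  obtain K where "0 < K"
    "\<And>(c :: 'n triple \<Rightarrow> complex) d C D. grows (\<epsilon> / 2) C c \<Longrightarrow> grows (\<epsilon> / 2) D d \<Longrightarrow> grows \<epsilon> (K * C * D) (Cmul c d)"
    by (rule Cmul_grows[of "\<epsilon> / 2" \<epsilon>]) (use assms in auto)
  note K = this
  show thesis
  proof (rule that[OF K(1)])
    fix c d :: "'n triple \<Rightarrow> complex" assume "admissible c" "admissible d"
    thus "nrm \<epsilon> (Cmul c d) \<le> K * nrm (\<epsilon> / 2) c * nrm (\<epsilon> / 2) d"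
      using assms by (intro nrm_le K(2) grows_nrm) auto
  qed
qed

lemma Cmul_continuous:
  fixes a b :: "'n::finite triple \<Rightarrow> complex"
  assumes \<epsilon>: "0 < \<epsilon>" "\<epsilon> < 1" and r: "0 < r" and ab: "admissible a" "admissible b"
  obtains \<delta> where "0 < \<delta>" "\<And>c d. admissible c \<Longrightarrow> admissible d \<Longrightarrow>
    nrm (\<epsilon> / 2) (c - a) < \<delta> \<Longrightarrow> nrm (\<epsilon> / 2) (d - b) < \<delta> \<Longrightarrow> nrm \<epsilon> (Cmul c d - Cmul a b) < r"
proof -
  obtain K where K: "0 < K" "\<And>c d :: 'n triple \<Rightarrow> complex. admissible c \<Longrightarrow> admissible d \<Longrightarrow>
      nrm \<epsilon> (Cmul c d) \<le> K * nrm (\<epsilon> / 2) c * nrm (\<epsilon> / 2) d"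
    by (rule Cmul_nrm[OF \<epsilon>]) blast
  define n :: "('n triple \<Rightarrow> complex) \<Rightarrow> real" where "n = nrm (\<epsilon> / 2)"
  have n0: "0 \<le> n x" if "admissible x" for x :: "'n triple \<Rightarrow> complex"
    unfolding n_def using nrm_nonneg[OF that] \<epsilon> by simp
  \<comment> \<open>\<open>L\<close> bounds the three terms of the bilinear increment once \<open>\<delta> \<le> 1\<close>.\<close>
  define L where "L = K * (1 + n a + n b) + 1"
  have L: "0 < L" using K(1) n0[OF ab(1)] n0[OF ab(2)] by (simp add: L_def add_nonneg_pos)
  define \<delta> where "\<delta> = min 1 (r / L)"
  have \<delta>: "0 < \<delta>" "\<delta> \<le> 1" "\<delta> * L \<le> r" using r L by (auto simp: \<delta>_def min_def field_simps)
  show thesis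
  proof (rule that[OF \<delta>(1)])
    fix c d :: "'n triple \<Rightarrow> complex"
    assume cd: "admissible c" "admissible d" and "nrm (\<epsilon> / 2) (c - a) < \<delta>" "nrm (\<epsilon> / 2) (d - b) < \<delta>"
    hence lt: "n (c - a) \<le> \<delta>" "n (d - b) \<le> \<delta>" by (simp_all add: n_def)
    have ad: "admissible (c - a)" "admissible (d - b)" using cd ab by (auto intro: admissible_diff)
    have eq: "Cmul c d - Cmul a b = Cmul (c - a) (d - b) + (Cmul (c - a) b + Cmul a (d - b))"
      by (simp add: Cmul_diff_left Cmul_diff_right)
    have "nrm \<epsilon> (Cmul c d - Cmul a b) \<le> nrm \<epsilon> (Cmul (c - a) (d - b)) + (nrm \<epsilon> (Cmul (c - a) b) + nrm \<epsilon> (Cmul a (d - b)))"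
      unfolding eq using ad ab \<epsilon>
      by (intro order_trans[OF nrm_add] add_left_mono nrm_add admissible_add admissible_Cmul)
    also have "\<dots> \<le> K * n (c - a) * n (d - b) + (K * n (c - a) * n b + K * n a * n (d - b))"
      unfolding n_def using ad ab by (intro add_mono K)
    also have "\<dots> \<le> K * \<delta> * 1 + (K * \<delta> * n b + K * n a * \<delta>)"
      using lt \<delta> K(1) n0[OF ab(1)] n0[OF ab(2)] n0[OF ad(1)] n0[OF ad(2)]
      by (intro add_mono mult_mono order_trans[OF lt(2)]) auto
    also have "\<dots> < \<delta> * L" using \<delta>(1) by (simp add: L_def algebra_simps)
    finally show "nrm \<epsilon> (Cmul c d - Cmul a b) < r" using \<delta>(3) by simp
  qed
qed

lemma continuous_Cmul:
  assumes h: "h \<noteq> 0"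
  shows "continuous_map (prod_topology (top_cone h) (top_cone h)) (top_cone h)
    (\<lambda>(a, b). fseries h (Cmul (coeffs h a) (coeffs h (b :: complex ^ 'n::finite option \<Rightarrow> complex))))"
    (is "continuous_map ?X _ ?f")
proof -
  let ?B = "{nball h \<epsilon> r d | (d :: 'n triple \<Rightarrow> complex) \<epsilon> r. admissible d \<and> 0 < \<epsilon> \<and> \<epsilon> < 1 \<and> (0::real) < r}"
  have top: "topspace ?X = Ahat_cone h \<times> Ahat_cone h" by (simp add: topspace_top_cone[OF h])
  have f: "?f (fseries h c, fseries h d) = fseries h (Cmul c d)" if "admissible c" "admissible d" for c d
    using that h by (simp add: coeffs_fseries)
  have "continuous_map ?X (topology_generated_by ?B) ?f"
  proof (rule continuous_on_generated_topo)
    fix U assume "U \<in> ?B"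
    then obtain e \<epsilon> r where U: "U = nball h \<epsilon> r e" "admissible e" "0 < \<epsilon>" "\<epsilon> < 1" "0 < r" by blast
    show "openin ?X (?f -` U \<inter> topspace ?X)"
    proof (subst openin_subopen, intro ballI)
      fix x assume "x \<in> ?f -` U \<inter> topspace ?X"
      then obtain a b where x: "x = (fseries h a, fseries h b)" and ab: "admissible a" "admissible b"
        and "?f x \<in> U"
        unfolding top by (auto elim!: Ahat_coneE)
      hence lt: "nrm \<epsilon> (Cmul a b - e) < r"
        using f[OF ab] fseries_in_nball[OF admissible_Cmul[OF ab] h, of \<epsilon> r e] by (simp add: U(1))
      obtain \<delta> where \<delta>: "0 < \<delta>" "\<And>c d. admissible c \<Longrightarrow> admissible d \<Longrightarrow>
        nrm (\<epsilon> / 2) (c - a) < \<delta> \<Longrightarrow> nrm (\<epsilon> / 2) (d - b) < \<delta> \<Longrightarrow>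
          nrm \<epsilon> (Cmul c d - Cmul a b) < r - nrm \<epsilon> (Cmul a b - e)"
        by (rule Cmul_continuous[OF U(3,4) _ ab, of "r - nrm \<epsilon> (Cmul a b - e)"]) (use lt in auto)
      show "\<exists>V. openin ?X V \<and> x \<in> V \<and> V \<subseteq> ?f -` U \<inter> topspace ?X"
      proof (intro exI conjI)
        show "openin ?X (nball h (\<epsilon> / 2) \<delta> a \<times> nball h (\<epsilon> / 2) \<delta> b)"
          using U \<delta>(1) ab h by (subst openin_prod_Times_iff) (auto intro!: openin_nball)
        show "x \<in> nball h (\<epsilon> / 2) \<delta> a \<times> nball h (\<epsilon> / 2) \<delta> b"
          using ab h \<delta>(1) by (simp add: x fseries_in_nball nrm_zero)
        show "nball h (\<epsilon> / 2) \<delta> a \<times> nball h (\<epsilon> / 2) \<delta> b \<subseteq> ?f -` U \<inter> topspace ?X"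
        proof
          fix y assume "y \<in> nball h (\<epsilon> / 2) \<delta> a \<times> nball h (\<epsilon> / 2) \<delta> b"
          then obtain c d where y: "y = (fseries h c, fseries h d)" and cd: "admissible c" "admissible d"
            and n: "nrm (\<epsilon> / 2) (c - a) < \<delta>" "nrm (\<epsilon> / 2) (d - b) < \<delta>"
            by (auto simp: nball_def)
          have "nrm \<epsilon> (Cmul c d - e) < r"
            using \<delta>(2)[OF cd n] nrm_triangle[OF admissible_Cmul[OF cd] admissible_Cmul[OF ab] U(2-4)] by simp
          hence "?f y \<in> U"
            unfolding y f[OF cd] U(1) by (simp add: fseries_in_nball[OF admissible_Cmul[OF cd] h])
          moreover have "y \<in> topspace ?X" unfolding top y using cd by (auto intro: fseries_Ahat_cone)
          ultimately show "y \<in> ?f -` U \<inter> topspace ?X" by simp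
        qed
      qed
    qed
  next
    have "\<Union> ?B = Ahat_cone h"
      using topspace_top_cone[OF h] unfolding top_cone_eq[OF h] by simp
    moreover have "?f ` (Ahat_cone h \<times> Ahat_cone h) \<subseteq> Ahat_cone h"
    proof clarsimp
      fix a b :: "complex ^ 'n option \<Rightarrow> complex" assume "a \<in> Ahat_cone h" "b \<in> Ahat_cone h"
      then obtain c d where "admissible c" "admissible d" "a = fseries h c" "b = fseries h d"
        by (metis Ahat_coneE)
      thus "fseries h (Cmul (coeffs h a) (coeffs h b)) \<in> Ahat_cone h"
        using h by (simp add: coeffs_fseries fseries_Ahat_cone admissible_Cmul)
    qed
    ultimately show "?f ` topspace ?X \<subseteq> \<Union> ?B" unfolding top by simp
  qed
  thus ?thesis unfolding top_cone_eq[OF h] .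
qed

text \<open>The product of the completion is determined by density and separation, and exists by
  continuity of the product of coefficients; so it is the product of coefficients.\<close>

lemma star_hat_cone_fseries:
  fixes c d :: "'n::finite triple \<Rightarrow> complex"
  assumes h: "h \<noteq> 0" and c: "admissible c" and d: "admissible d"
  shows "star_hat_cone h (fseries h c) (fseries h d) = fseries h (Cmul c d)"
proof -
  define P where "P m \<longleftrightarrow>
     continuous_map (prod_topology (top_cone h) (top_cone h)) (top_cone h) (\<lambda>(a, b). m a b) \<and>
     (\<forall>a\<in>Acone h. \<forall>b\<in>Acone h. m a b = star_cone h a b)"
    for m :: "(complex ^ 'n option \<Rightarrow> complex) \<Rightarrow> (complex ^ 'n option \<Rightarrow> complex) \<Rightarrow> complex ^ 'n option \<Rightarrow> complex"
  define m0 :: "(complex ^ 'n option \<Rightarrow> complex) \<Rightarrow> (complex ^ 'n option \<Rightarrow> complex) \<Rightarrow> complex ^ 'n option \<Rightarrow> complex"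
    where "m0 a b = fseries h (Cmul (coeffs h a) (coeffs h b))" for a b
  have fin: "m (fseries h (trunc A c)) (fseries h (trunc A d)) = fseries h (Cmul (trunc A c) (trunc A d))"
    if m: "P m" and A: "finite A" "A \<subseteq> triples" for m A
  proof -
    obtain N where "A \<subseteq> triples_le N" using A by (rule finite_triplesE)
    note N = supp_le_trunc[OF this]
    have "\<forall>a\<in>Acone h. \<forall>b\<in>Acone h. m a b = star_cone h a b" using m unfolding P_def by (rule conjunct2)
    hence "m (fseries h (trunc A c)) (fseries h (trunc A d)) = star_cone h (fseries h (trunc A c)) (fseries h (trunc A d))"
      using fseries_Acone[OF N] by blast
    thus ?thesis by (simp only: star_cone_fseries[OF h N N])
  qed
  have Pm0: "P m0"
    unfolding P_def
  proof (intro conjI ballI)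
    show "continuous_map (prod_topology (top_cone h) (top_cone h)) (top_cone h) (\<lambda>(a, b). m0 a b)"
      unfolding m0_def by (rule continuous_Cmul[OF h])
    fix a b :: "complex ^ 'n option \<Rightarrow> complex" assume "a \<in> Acone h" "b \<in> Acone h"
    then obtain N c M d where *: "supp_le N c" "a = fseries h c" "supp_le M d" "b = fseries h d" by (metis AconeE)
    have s: "supp_le (max N M) c" "supp_le (max N M) d" using * by (auto intro: supp_le_mono)
    show "m0 a b = star_cone h a b"
      unfolding m0_def *(2,4) star_cone_fseries[OF h s]
      using s h by (simp add: coeffs_fseries supp_le_admissible)
  qed
  moreover have "star_hat_cone h = (SOME m. P m)" by (simp only: star_hat_cone_def P_def)
  ultimately have Ps: "P (star_hat_cone h)" by (simp only: someI[of P])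
  have lim: "limitin (top_cone h) (\<lambda>A. fseries h (Cmul (trunc A c) (trunc A d))) (m (fseries h c) (fseries h d))
      (finite_subsets_at_top triples)" if "P m" for m
  proof -
    have "limitin (prod_topology (top_cone h) (top_cone h)) (\<lambda>A. (fseries h (trunc A c), fseries h (trunc A d)))
      (fseries h c, fseries h d) (finite_subsets_at_top triples)"
      using limitin_trunc[OF h c] limitin_trunc[OF h d] by (simp add: limitin_pairwise comp_def)
    from continuous_map_limit[OF _ this, of "top_cone h" "\<lambda>(a, b). m a b"] that
    have "limitin (top_cone h) (\<lambda>A. m (fseries h (trunc A c)) (fseries h (trunc A d))) (m (fseries h c) (fseries h d))
      (finite_subsets_at_top triples)" by (simp add: P_def comp_def)
    thus ?thesis
      by (rule limitin_transform_eventually[rotated])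
         (auto intro: eventually_mono[OF eventually_finite_subset] fin[OF that])
  qed
  have m0: "m0 (fseries h c) (fseries h d) = fseries h (Cmul c d)"
    using c d h by (simp add: m0_def coeffs_fseries)
  have "star_hat_cone h (fseries h c) (fseries h d) \<in> Ahat_cone h"
    using lim[OF Ps] topspace_top_cone[OF h] unfolding limitin_def by blast
  then obtain e where e: "admissible e" "star_hat_cone h (fseries h c) (fseries h d) = fseries h e"
    by (rule Ahat_coneE)
  have "e = Cmul c d"
    by (rule limitin_top_cone_unique[OF h e(1) admissible_Cmul[OF c d] finite_subsets_at_top_neq_bot
          lim[OF Ps, unfolded e(2)] lim[OF Pm0, unfolded m0]])
  thus ?thesis using e by simp
qed

section \<open>Symbols\<close>

text \<open>
  The operator with Wick symbol \<open>z\<^sup>p zbar\<^sup>q\<close> acts on functions of \<open>w\<close>, \<open>zbar\<close> acting by multiplication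
  with \<open>w\<close> and \<open>z\<close> by differentiation, with the sign of the metric. Applied to \<open>\<langle>\<eta>,w\<rangle>\<^bsup>-x\<^esup>\<close> it gives the symbol
  \<open>Lsym x \<eta> w p q\<close>, whose restriction to \<open>w = \<eta>\<close> conjugate and \<open>y(\<eta>) = 1\<close> is the basis function
  up to a factorial. Composition of operators explains the formulas below: a factor on the right acts
  on \<open>\<langle>\<eta>,w\<rangle>\<^bsup>-x\<^esup>\<close> first, and this action can be written in terms of \<open>\<eta>\<close> and then commutes with
  the left factor.
\<close>

abbreviation up :: "'m \<Rightarrow> ('m \<Rightarrow> nat) \<Rightarrow> 'm \<Rightarrow> nat" where "up j p \<equiv> p(j := Suc (p j))"
abbreviation dn :: "'m \<Rightarrow> ('m \<Rightarrow> nat) \<Rightarrow> 'm \<Rightarrow> nat" where "dn j p \<equiv> p(j := p j - 1)"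

definition sg :: "'n option \<Rightarrow> complex" where "sg j = gmet j j"

lemma sg_sq [simp]: "sg j * sg j = 1" "sg j \<noteq> 0" "cmod (sg j) = 1"
  by (auto simp: sg_def gmet_def)

text \<open>If \<open>\<Lambda> p q\<close> is the value of a linear functional on \<open>z\<^sup>p zbar\<^sup>q\<close>, then \<open>kap \<Lambda> js p q\<close> is its value
  on the Wick product, for \<open>2h = 1\<close>, of this monomial with the letters \<open>js\<close> of a monomial in \<open>zbar\<close>
  on the right, multiplied one after the other.\<close>

fun kap :: "(('n option \<Rightarrow> nat) \<Rightarrow> ('n option \<Rightarrow> nat) \<Rightarrow> complex) \<Rightarrow> 'n option list
    \<Rightarrow> ('n option \<Rightarrow> nat) \<Rightarrow> ('n option \<Rightarrow> nat) \<Rightarrow> complex" where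
  "kap \<Lambda> [] p q = \<Lambda> p q"
| "kap \<Lambda> (j # js) p q = kap \<Lambda> js p (up j q) + sg j * of_nat (p j) * kap \<Lambda> js (dn j p) q"

text \<open>The terms with \<open>l\<close> contractions of the same product with \<open>zbar\<^sup>s\<close>, except for the factor \<open>1/l!\<close>.\<close>

fun vap :: "(('n::finite option \<Rightarrow> nat) \<Rightarrow> ('n option \<Rightarrow> nat) \<Rightarrow> complex) \<Rightarrow> nat
    \<Rightarrow> ('n option \<Rightarrow> nat) \<Rightarrow> ('n option \<Rightarrow> nat) \<Rightarrow> ('n option \<Rightarrow> nat) \<Rightarrow> complex" where
  "vap \<Lambda> 0 p q s = \<Lambda> p (q + s)"
| "vap \<Lambda> (Suc l) p q s = (\<Sum>i\<in>UNIV. sg i * of_nat (p i) * of_nat (s i) * vap \<Lambda> l (dn i p) q (dn i s))"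

lemma gsign_Cons: "gsign (i # is) = sg i * gsign is"
  unfolding gsign_def length_Cons prod.lessThan_Suc_shift by (simp add: sg_def)

lemma lower_Cons_head: "p - count_list (i # is) = dn i p - count_list is"
  by (auto simp: fun_eq_iff)

lemma fall_Cons_head: "fall (i # is) p = of_nat (p i) * fall is (dn i p)"
proof (cases "0 < p i")
  case True
  have "count_list (i # is) \<le> p \<longleftrightarrow> count_list is \<le> dn i p"
    unfolding le_fun_def count_list_Cons_upd
  proof (intro iff_allI)
    fix j show "((count_list is)(i := Suc (count_list is i))) j \<le> p j \<longleftrightarrow> count_list is j \<le> (dn i p) j"
      using True by auto
  qed
  thus ?thesis unfolding fall_def lower_Cons_head using mfact_lower[of p i, OF True] by (simp del: count_list.simps)
next
  case False
  hence "\<not> count_list (i # is) \<le> p" by (auto simp: le_fun_def intro!: exI[of _ i])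
  thus ?thesis using False by (simp add: fall_def del: count_list.simps)
qed

lemma vap_lists:
  "vap \<Lambda> l p q s = (\<Sum>is\<in>{is. length is = l}. gsign is * fall is p * fall is s
      * \<Lambda> (p - count_list is) (q + (s - count_list is)))"
proof (induction l arbitrary: p q s)
  case 0
  have nil: "p - count_list [] = p" for p :: "'a option \<Rightarrow> nat" by (simp add: fun_eq_iff)
  have e: "{is :: 'a option list. length is = 0} = {[]}" by auto
  have g: "gsign [] = 1" by (simp add: gsign_def)
  show ?case unfolding vap.simps e
    by (simp only: sum.insert finite.emptyI empty_iff not_False_eq_True sum.empty nil g fall_Nil mult_1 add_0_right)
next
  case (Suc l)
  let ?F = "\<lambda>is. gsign is * fall is p * fall is s * \<Lambda> (p - count_list is) (q + (s - count_list is))"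
  have "{is :: 'a option list. length is = Suc l} = (\<lambda>(i, is). i # is) ` (UNIV \<times> {is. length is = l})"
    by (auto simp: length_Suc_conv image_iff)
  moreover have "inj_on (\<lambda>(i, is). i # is) (UNIV \<times> {is :: 'a option list. length is = l})"
    by (auto simp: inj_on_def)
  ultimately have "(\<Sum>is\<in>{is. length is = Suc l}. ?F is) = (\<Sum>i\<in>UNIV. \<Sum>is\<in>{is. length is = l}. ?F (i # is))"
    by (simp add: sum.reindex sum.cartesian_product split_def)
  also have "\<dots> = (\<Sum>i\<in>UNIV. sg i * of_nat (p i) * of_nat (s i) * vap \<Lambda> l (dn i p) q (dn i s))"
    unfolding Suc.IH sum_distrib_left gsign_Cons fall_Cons_head lower_Cons_head
    by (intro sum.cong refl) (simp only: mult_ac)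
  finally show ?case unfolding vap.simps by (rule sym)
qed

text \<open>The Leibniz rule: an additional letter is either not contracted, or contracted in one of \<open>l\<close>
  places.\<close>

lemma vap_up:
  "vap \<Lambda> l p q (up j s) = vap \<Lambda> l p (up j q) s + of_nat l * sg j * of_nat (p j) * vap \<Lambda> (l - 1) (dn j p) q s"
proof (induction l arbitrary: p q s)
  case 0
  have "q + up j s = up j q + s" by (auto simp: fun_eq_iff)
  thus ?case by (simp only: vap.simps of_nat_0 mult_zero_left add_0_right)
next
  case (Suc m)
  have split: "sg i * of_nat (p i) * of_nat ((up j s) i) * vap \<Lambda> m (dn i p) q (dn i (up j s))
      = sg i * of_nat (p i) * of_nat (s i) * vap \<Lambda> m (dn i p) q (up j (dn i s))
        + (if i = j then sg j * of_nat (p j) * vap \<Lambda> m (dn j p) q s else 0)" for i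
  proof (cases "i = j")
    case True
    show ?thesis
    proof (cases "s j = 0")
      case False
      hence "up j (dn j s) = s" "dn j (up j s) = s" by auto
      thus ?thesis using True False by (simp add: algebra_simps)
    next
      case s: True
      hence "dn j (up j s) = s" by auto
      thus ?thesis using True s by simp
    qed
  next
    case False
    hence "dn i (up j s) = up j (dn i s)" by (auto simp: fun_eq_iff)
    thus ?thesis using False by simp
  qed
  have comm: "of_nat (p i) * of_nat ((dn i p) j) * vap \<Lambda> k (dn j (dn i p)) q t
      = of_nat (p j) * (of_nat ((dn j p) i) * vap \<Lambda> k (dn i (dn j p)) q t)" for i k t
  proof (cases "i = j")
    case False
    hence "dn j (dn i p) = dn i (dn j p)" by (auto simp: fun_eq_iff)
    thus ?thesis using False by simp
  qed simp
  have "vap \<Lambda> (Suc m) p q (up j s) = (\<Sum>i\<in>UNIV. sg i * of_nat (p i) * of_nat (s i) * vap \<Lambda> m (dn i p) q (up j (dn i s)))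
      + sg j * of_nat (p j) * vap \<Lambda> m (dn j p) q s"
    unfolding vap.simps split sum.distrib by simp
  also have "(\<Sum>i\<in>UNIV. sg i * of_nat (p i) * of_nat (s i) * vap \<Lambda> m (dn i p) q (up j (dn i s)))
      = vap \<Lambda> (Suc m) p (up j q) s + of_nat m * sg j * of_nat (p j) * vap \<Lambda> m (dn j p) q s"
  proof (cases m)
    case 0
    thus ?thesis unfolding Suc.IH by simp
  next
    case (Suc k)
    have "(\<Sum>i\<in>UNIV. sg i * of_nat (p i) * of_nat (s i) * (of_nat m * sg j * of_nat ((dn i p) j) * vap \<Lambda> k (dn j (dn i p)) q (dn i s)))
      = (\<Sum>i\<in>UNIV. of_nat m * sg j * (sg i * of_nat (s i) * (of_nat (p i) * of_nat ((dn i p) j) * vap \<Lambda> k (dn j (dn i p)) q (dn i s))))"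
      by (intro sum.cong refl) (simp only: mult_ac)
    also have "\<dots> = of_nat m * sg j * of_nat (p j) * vap \<Lambda> m (dn j p) q s"
      unfolding comm Suc vap.simps sum_distrib_left by (intro sum.cong refl) (simp only: mult_ac)
    finally show ?thesis
      unfolding Suc.IH distrib_left sum.distrib by (simp add: \<open>m = Suc k\<close>)
  qed
  finally show ?case unfolding diff_Suc_1 of_nat_Suc distrib_right mult_1 by (simp only: add_ac)
qed

lemma vap_eq_0: "length js < l \<Longrightarrow> vap \<Lambda> l p q (count_list js) = 0"
  unfolding vap_lists by (intro sum.neutral) (auto simp: fall_eq_0 msize_count_list)

lemma sum_vap_kap:
  "length js \<le> L \<Longrightarrow> (\<Sum>l\<le>L. vap \<Lambda> l p q (count_list js) / fact l) = kap \<Lambda> js p q"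
proof (induction js arbitrary: p q L)
  case Nil
  have "q + count_list [] = q" by (simp add: fun_eq_iff)
  hence "(\<Sum>l\<in>{0}. vap \<Lambda> l p q (count_list []) / fact l) = \<Lambda> p q" by simp
  moreover have "(\<Sum>l\<le>L. vap \<Lambda> l p q (count_list []) / fact l) = (\<Sum>l\<in>{0}. vap \<Lambda> l p q (count_list []) / fact l)"
    by (rule sum.mono_neutral_right) (auto simp: vap_eq_0)
  ultimately show ?case unfolding kap.simps by (rule trans[rotated])
next
  case (Cons j js)
  then obtain M where L: "L = Suc M" "length js \<le> M" by (cases L) auto
  have "(\<Sum>l\<le>L. vap \<Lambda> l p q (count_list (j # js)) / fact l)
    = (\<Sum>l\<le>L. vap \<Lambda> l p (up j q) (count_list js) / fact l)
      + (\<Sum>l\<le>Suc M. of_nat l * sg j * of_nat (p j) * vap \<Lambda> (l - 1) (dn j p) q (count_list js) / fact l)"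
    unfolding count_list_Cons_upd vap_up add_divide_distrib sum.distrib L(1) ..
  also have "(\<Sum>l\<le>Suc M. of_nat l * sg j * of_nat (p j) * vap \<Lambda> (l - 1) (dn j p) q (count_list js) / fact l)
    = (\<Sum>l\<le>M. sg j * of_nat (p j) * (vap \<Lambda> l (dn j p) q (count_list js) / fact l))"
  proof -
    have step: "of_nat (Suc l) * a * b * Y / fact (Suc l) = a * b * (Y / fact l)" for l and a b Y :: complex
      by (simp add: divide_simps del: of_nat_Suc)
    show ?thesis
      unfolding sum.atMost_Suc_shift step diff_Suc_1 by (simp only: of_nat_0 mult_zero_left div_0 add_0_left)
  qed
  also have "\<dots> = sg j * of_nat (p j) * kap \<Lambda> js (dn j p) q"
    unfolding sum_distrib_left[symmetric] Cons.IH[OF L(2)] ..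
  also have "(\<Sum>l\<le>L. vap \<Lambda> l p (up j q) (count_list js) / fact l) = kap \<Lambda> js p (up j q)"
    by (rule Cons.IH) (use Cons.prems in simp)
  finally show ?case unfolding kap.simps .
qed

text \<open>The Wick formula, a sum over words of contractions, agrees with successive multiplication by
  the letters, where every step contracts at most once.\<close>

lemma sum_lists_kap:
  assumes "length js \<le> L"
  shows "(\<Sum>is\<in>{is. length is \<le> L}. gsign is / fact (length is) * (fall is p * fall is (count_list js))
      * \<Lambda> (p - count_list is) (q + (count_list js - count_list is))) = kap \<Lambda> js p q"
    (is "sum ?F _ = _")
proof -
  have "sum ?F {is. length is \<le> L} = (\<Sum>l\<le>L. \<Sum>is\<in>{is \<in> {is. length is \<le> L}. length is = l}. ?F is)"
    by (rule sum.group[OF finite_lists_length_le' finite_atMost, symmetric]) auto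
  also have "\<dots> = (\<Sum>l\<le>L. vap \<Lambda> l p q (count_list js) / fact l)"
    unfolding vap_lists sum_divide_distrib by (intro sum.cong) auto
  finally show ?thesis using sum_vap_kap[OF assms] by simp
qed

text \<open>The polarisation of \<open>y\<close>, up to conjugation of the second argument.\<close>

definition lor :: "complex ^ 'n::finite option \<Rightarrow> complex ^ 'n option \<Rightarrow> complex" where
  "lor \<eta> w = - (\<Sum>j\<in>UNIV. sg j * \<eta> $ j * w $ j)"

definition Lsym :: "complex \<Rightarrow> complex ^ 'n::finite option \<Rightarrow> complex ^ 'n option
    \<Rightarrow> ('n option \<Rightarrow> nat) \<Rightarrow> ('n option \<Rightarrow> nat) \<Rightarrow> complex" where
  "Lsym x \<eta> w p q = pochhammer x (msize p) * mpow p \<eta> * mpow q w * lor \<eta> w powr (- x - of_nat (msize p))"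

lemma lor_vcnj: "lor \<eta> (vcnj \<eta>) = of_real (yfun \<eta>)"
proof -
  have "\<eta> $ j * cnj (\<eta> $ j) = of_real ((cmod (\<eta> $ j))\<^sup>2)" for j by (rule complex_norm_square[symmetric])
  thus ?thesis
    by (simp add: lor_def sum_option sg_def gmet_def yfun_def mult.assoc sum_negf)
qed

text \<open>Right multiplication by \<open>z\<^sup>r\<close> is multiplication by \<open>\<eta>\<^sup>r\<close>, with a shift of the parameter.\<close>

lemma Lsym_add:
  "Lsym x \<eta> w (p + r) q = pochhammer x (msize r) * mpow r \<eta> * Lsym (x + of_nat (msize r)) \<eta> w p q"
proof -
  have "pochhammer x (msize r + msize p) = pochhammer x (msize r) * pochhammer (x + of_nat (msize r)) (msize p)"
    by (rule pochhammer_product')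
  thus ?thesis by (simp add: Lsym_def msize_add mpow_add add.commute algebra_simps)
qed

lemma msize_up: "msize (up j p) = Suc (msize p)"
  by (simp add: msize_def sum.remove[of UNIV j])

lemma msize_dn: "0 < p j \<Longrightarrow> Suc (msize (dn j p)) = msize p"
  by (simp add: msize_def sum.remove[of UNIV j])

lemma mpow_up: "mpow (up j q) w = w $ j * mpow q w"
proof -
  have "mpow (up j q) w = (w $ j) ^ Suc (q j) * (\<Prod>k\<in>UNIV - {j}. (w $ k) ^ q k)"
    unfolding mpow_def by (subst prod.remove[of UNIV j]) (auto intro!: prod.cong)
  also have "mpow q w = (w $ j) ^ q j * (\<Prod>k\<in>UNIV - {j}. (w $ k) ^ q k)"
    unfolding mpow_def by (subst prod.remove[of UNIV j]) auto
  ultimately show ?thesis by simp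
qed

lemma mpow_line_derivative:
  "((\<lambda>\<tau>. mpow p (\<eta> + axis j (\<tau> * a))) has_field_derivative a * (of_nat (p j) * mpow (dn j p) \<eta>)) (at 0)"
proof -
  define R where "R = (\<Prod>k\<in>UNIV - {j}. (\<eta> $ k) ^ p k)"
  have 1: "mpow p (\<eta> + axis j t) = (\<eta> $ j + t) ^ p j * R" for t
    unfolding mpow_def R_def by (subst prod.remove[of UNIV j]) (auto simp: axis_def intro!: prod.cong)
  have 2: "mpow (dn j p) \<eta> = (\<eta> $ j) ^ (p j - 1) * R"
    unfolding mpow_def R_def by (subst prod.remove[of UNIV j]) (auto intro!: prod.cong)
  show ?thesis unfolding 1 2 by (auto intro!: derivative_eq_intros)
qed

lemma sum_axis_unit: "(\<Sum>j\<in>UNIV. f j * (axis i s :: complex ^ 'm::finite) $ j) = f i * s"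
  using sum_axis[of f i s "\<lambda>_. 1"] by simp

lemma lor_line: "lor (\<eta> + axis j s) (w + axis j t) = lor \<eta> w - sg j * (s * w $ j + t * \<eta> $ j + s * t)"
proof -
  have "lor (\<eta> + axis j s) (w + axis j t)
    = lor \<eta> w - ((\<Sum>k\<in>UNIV. (sg k * w $ k) * axis j s $ k) + (\<Sum>k\<in>UNIV. (sg k * \<eta> $ k) * axis j t $ k)
       + (\<Sum>k\<in>UNIV. (sg k * axis j s $ k) * axis j t $ k))"
    by (simp add: lor_def algebra_simps sum.distrib)
  also have "\<dots> = lor \<eta> w - sg j * (s * w $ j + t * \<eta> $ j + s * t)"
    unfolding sum_axis_unit by (simp add: axis_def algebra_simps)
  finally show ?thesis .
qed

text \<open>Differentiation in \<open>\<eta>\<^sub>j\<close> is multiplication by \<open>zbar\<^sub>j\<close> on the right, with a shift of the parameter.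
  On a line that moves both arguments, the derivative is this one, weighted by \<open>a\<close>, plus a multiple
  of \<open>b\<close> of which only the independence of \<open>a, b\<close> matters.\<close>

lemma Lsym_line_derivative:
  assumes "lor \<eta> w \<notin> \<real>\<^sub>\<le>\<^sub>0"
  shows "\<exists>D. \<forall>a b. ((\<lambda>\<tau>. Lsym x (\<eta> + axis j (\<tau> * a)) (w + axis j (\<tau> * b)) p q) has_field_derivative
      a * (sg j * x * kap (Lsym (x + 1) \<eta> w) [j] p q) + b * D) (at 0)"
proof -
  define n where "n = msize p"
  define u where "u = lor \<eta> w"
  define s where "s = - x - of_nat n"
  define D where "D = pochhammer x n * mpow p \<eta> * (of_nat (q j) * mpow (dn j q) w * u powr s
      + mpow q w * (s * u powr (s - 1) * (- sg j * \<eta> $ j)))"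
  have key: "sg j * x * kap (Lsym (x + 1) \<eta> w) [j] p q = pochhammer x n * (of_nat (p j) * mpow (dn j p) \<eta>) * mpow q w * u powr s
      + pochhammer x n * mpow p \<eta> * mpow q w * (s * u powr (s - 1) * (- sg j * w $ j))"
  proof -
    have x1: "x * pochhammer (x + 1) n = pochhammer x n * (x + of_nat n)"
      using pochhammer_rec[of x n] pochhammer_Suc[of x n] by simp
    have "sg j * x * Lsym (x + 1) \<eta> w p (up j q)
        = pochhammer x n * mpow p \<eta> * mpow q w * (s * u powr (s - 1) * (- sg j * w $ j))"
    proof -
      have "- (x + 1) - of_nat n = s - 1" by (simp add: s_def)
      hence "Lsym (x + 1) \<eta> w p (up j q) = pochhammer (x + 1) n * mpow p \<eta> * (w $ j * mpow q w) * u powr (s - 1)"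
        by (simp only: Lsym_def mpow_up n_def u_def)
      hence "sg j * x * Lsym (x + 1) \<eta> w p (up j q) = (x * pochhammer (x + 1) n) * sg j * mpow p \<eta> * (w $ j * mpow q w) * u powr (s - 1)"
        by (simp only: mult_ac)
      thus ?thesis unfolding x1 by (simp add: s_def algebra_simps)
    qed
    moreover have "sg j * x * (sg j * of_nat (p j) * Lsym (x + 1) \<eta> w (dn j p) q)
        = pochhammer x n * (of_nat (p j) * mpow (dn j p) \<eta>) * mpow q w * u powr s"
    proof (cases "p j = 0")
      case False
      then obtain m where m: "n = Suc m" "msize (dn j p) = m" using msize_dn[of p j] by (simp add: n_def)
      have "- (x + 1) - of_nat m = s" by (simp add: s_def m)
      hence "Lsym (x + 1) \<eta> w (dn j p) q = pochhammer (x + 1) m * mpow (dn j p) \<eta> * mpow q w * u powr s"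
        by (simp only: Lsym_def m u_def)
      hence "sg j * x * (sg j * of_nat (p j) * Lsym (x + 1) \<eta> w (dn j p) q)
        = (sg j * sg j) * (x * pochhammer (x + 1) m) * (of_nat (p j) * mpow (dn j p) \<eta>) * mpow q w * u powr s"
        by (simp only: mult_ac)
      thus ?thesis unfolding m(1) pochhammer_rec by simp
    qed simp
    ultimately show ?thesis by (simp add: distrib_left)
  qed
  have "((\<lambda>\<tau>. Lsym x (\<eta> + axis j (\<tau> * a)) (w + axis j (\<tau> * b)) p q) has_field_derivative
      a * (sg j * x * kap (Lsym (x + 1) \<eta> w) [j] p q) + b * D) (at 0)" for a b
  proof -
    have z: "axis j (0::complex) = 0" by (simp add: axis_def vec_eq_iff)
    have l: "((\<lambda>\<tau>. lor (\<eta> + axis j (\<tau> * a)) (w + axis j (\<tau> * b))) has_field_derivative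
        (- sg j * (a * w $ j + b * \<eta> $ j))) (at 0)"
      unfolding lor_line by (auto intro!: derivative_eq_intros simp: algebra_simps)
    have pw: "((\<lambda>z. z powr s) has_field_derivative s * u powr (s - 1)) (at (lor (\<eta> + axis j (0 * a)) (w + axis j (0 * b))))"
      using has_field_derivative_powr[OF assms, of s] by (simp add: z u_def)
    have P: "((\<lambda>\<tau>. lor (\<eta> + axis j (\<tau> * a)) (w + axis j (\<tau> * b)) powr s) has_field_derivative
        s * u powr (s - 1) * (- sg j * (a * w $ j + b * \<eta> $ j))) (at 0)"
      using DERIV_chain2[OF pw l] .
    have "((\<lambda>\<tau>. pochhammer x n * mpow p (\<eta> + axis j (\<tau> * a)) * mpow q (w + axis j (\<tau> * b))
        * lor (\<eta> + axis j (\<tau> * a)) (w + axis j (\<tau> * b)) powr s) has_field_derivative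
        (pochhammer x n * (a * (of_nat (p j) * mpow (dn j p) \<eta>)) * mpow q w
          + pochhammer x n * mpow p \<eta> * (b * (of_nat (q j) * mpow (dn j q) w))) * u powr s
        + pochhammer x n * mpow p \<eta> * mpow q w * (s * u powr (s - 1) * (- sg j * (a * w $ j + b * \<eta> $ j)))) (at 0)"
      by (rule derivative_eq_intros mpow_line_derivative P refl)+ (simp add: z u_def)
    moreover have "(pochhammer x n * (a * (of_nat (p j) * mpow (dn j p) \<eta>)) * mpow q w
          + pochhammer x n * mpow p \<eta> * (b * (of_nat (q j) * mpow (dn j q) w))) * u powr s
        + pochhammer x n * mpow p \<eta> * mpow q w * (s * u powr (s - 1) * (- sg j * (a * w $ j + b * \<eta> $ j)))
      = a * (sg j * x * kap (Lsym (x + 1) \<eta> w) [j] p q) + b * D"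
      unfolding key D_def by (simp add: algebra_simps)
    ultimately show ?thesis by (simp add: Lsym_def n_def s_def)
  qed
  thus ?thesis by blast
qed

lemma kap_line_derivative:
  assumes "lor \<eta> w \<notin> \<real>\<^sub>\<le>\<^sub>0"
  shows "\<exists>D. \<forall>a b. ((\<lambda>\<tau>. kap (Lsym x (\<eta> + axis j (\<tau> * a)) (w + axis j (\<tau> * b))) js p q) has_field_derivative
      a * (sg j * x * kap (Lsym (x + 1) \<eta> w) (js @ [j]) p q) + b * D) (at 0)"
proof (induction js arbitrary: p q)
  case Nil
  show ?case using Lsym_line_derivative[OF assms, of x j p q] by simp
next
  case (Cons i js)
  obtain D1 where D1: "\<And>a b. ((\<lambda>\<tau>. kap (Lsym x (\<eta> + axis j (\<tau> * a)) (w + axis j (\<tau> * b))) js p (up i q)) has_field_derivative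
      a * (sg j * x * kap (Lsym (x + 1) \<eta> w) (js @ [j]) p (up i q)) + b * D1) (at 0)" using Cons[of p "up i q"] by blast
  obtain D2 where D2: "\<And>a b. ((\<lambda>\<tau>. kap (Lsym x (\<eta> + axis j (\<tau> * a)) (w + axis j (\<tau> * b))) js (dn i p) q) has_field_derivative
      a * (sg j * x * kap (Lsym (x + 1) \<eta> w) (js @ [j]) (dn i p) q) + b * D2) (at 0)" using Cons[of "dn i p" q] by blast
  show ?case
    using DERIV_add[OF D1 DERIV_cmult[OF D2, of "sg i * of_nat (p i)"]]
    by (intro exI[of _ "D1 + sg i * of_nat (p i) * D2"]) (simp add: algebra_simps)
qed

section \<open>The ideal of the functions that vanish on the level set\<close>

lemma norm_powr_le:
  assumes "0 < m" "m \<le> Re u" "cmod u \<le> M"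
  shows "cmod (u powr (- x - of_nat n)) \<le> exp (cmod x * (\<bar>ln m\<bar> + \<bar>ln M\<bar> + pi)) * (1 / m) ^ n"
proof -
  have u: "u \<noteq> 0" "m \<le> cmod u" using assms complex_Re_le_cmod[of u] by auto
  have "ln m \<le> ln (cmod u)" "ln (cmod u) \<le> ln M" using assms u by auto
  hence "\<bar>ln (cmod u)\<bar> \<le> \<bar>ln m\<bar> + \<bar>ln M\<bar>" by linarith
  moreover have "\<bar>Im (Ln u)\<bar> \<le> pi" using mpi_less_Im_Ln[OF u(1)] Im_Ln_le_pi[OF u(1)] by linarith
  ultimately have Ln: "cmod (Ln u) \<le> \<bar>ln m\<bar> + \<bar>ln M\<bar> + pi"
    using cmod_le[of "Ln u"] u(1) by simp
  have "cmod (u powr (- x)) = exp (Re (- x * Ln u))" using u(1) by (simp add: powr_def)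
  also have "Re (- x * Ln u) \<le> cmod (- x * Ln u)" by (rule complex_Re_le_cmod)
  also have "\<dots> \<le> cmod x * (\<bar>ln m\<bar> + \<bar>ln M\<bar> + pi)" using Ln by (simp add: norm_mult mult_left_mono)
  finally have 1: "cmod (u powr (- x)) \<le> exp (cmod x * (\<bar>ln m\<bar> + \<bar>ln M\<bar> + pi))" by simp
  have "1 / cmod u \<le> 1 / m" using u assms(1) by (simp add: frac_le)
  hence 2: "(1 / cmod u) ^ n \<le> (1 / m) ^ n" by (intro power_mono) auto
  have "cmod (u powr (- x - of_nat n)) = cmod (u powr (- x)) * (1 / cmod u) ^ n"
    using u(1) by (simp add: powr_diff powr_nat' norm_divide norm_power power_divide)
  also have "\<dots> \<le> exp (cmod x * (\<bar>ln m\<bar> + \<bar>ln M\<bar> + pi)) * (1 / m) ^ n"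
    using 1 2 by (intro mult_mono) auto
  finally show ?thesis .
qed

lemma Lsym_bound:
  assumes "0 < m" "1 \<le> R"
  obtains B C where "1 \<le> B" "0 \<le> C"
    "\<And>\<eta> w p q. (\<And>j. cmod (\<eta> $ j) \<le> R) \<Longrightarrow> (\<And>j. cmod (w $ j) \<le> R) \<Longrightarrow> m \<le> Re (lor \<eta> w) \<Longrightarrow>
      cmod (lor \<eta> w) \<le> M \<Longrightarrow> cmod (Lsym x \<eta> w p q) \<le> C * (B ^ (msize p + msize q) * fact (msize p))"
proof -
  define \<Delta> where "\<Delta> = max 1 (cmod x)"
  define E where "E = exp (cmod x * (\<bar>ln m\<bar> + \<bar>ln M\<bar> + pi))"
  define B where "B = \<Delta> * R * max 1 (1 / m)"
  have m1: "1 \<le> max 1 (1 / m)" "1 \<le> \<Delta>" by (auto simp: \<Delta>_def)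
  have DR: "1 \<le> \<Delta> * R" using mult_mono[of 1 \<Delta> 1 R] m1 assms by simp
  have B: "1 \<le> B" using mult_mono[of 1 "\<Delta> * R" 1 "max 1 (1 / m)"] DR m1 by (simp add: B_def)
  have RB: "R \<le> B"
    using mult_mono[of 1 \<Delta> R R] mult_mono[of R "\<Delta> * R" 1 "max 1 (1 / m)"] m1 assms DR by (simp add: B_def)
  show thesis
  proof (rule that[OF B, of E])
    show "0 \<le> E" by (simp add: E_def)
    fix \<eta> w :: "complex ^ 'a option" and p q
    assume *: "\<And>j. cmod (\<eta> $ j) \<le> R" "\<And>j. cmod (w $ j) \<le> R" "m \<le> Re (lor \<eta> w)" "cmod (lor \<eta> w) \<le> M"
    have "cmod (Lsym x \<eta> w p q) \<le> (\<Delta> ^ msize p * fact (msize p)) * R ^ msize p * R ^ msize q * (E * (1 / m) ^ msize p)"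
      unfolding Lsym_def norm_mult E_def
      using assms m1 norm_powr_le[OF assms(1) *(3,4)] norm_pochhammer_le[of x \<Delta>] norm_mpow_le[of \<eta> R p] norm_mpow_le[of w R q] *
      by (intro mult_mono) (auto simp: \<Delta>_def)
    also have "\<dots> \<le> (\<Delta> ^ msize p * fact (msize p)) * R ^ msize p * B ^ msize q * (E * max 1 (1 / m) ^ msize p)"
      using assms m1 RB by (intro mult_mono power_mono order_refl) (auto simp: E_def)
    also have "\<dots> = E * (B ^ (msize p + msize q) * fact (msize p))"
      by (simp add: B_def power_add power_mult_distrib)
    finally show "cmod (Lsym x \<eta> w p q) \<le> E * (B ^ (msize p + msize q) * fact (msize p))" .
  qed
qed

lemma kap_bound:
  assumes \<Lambda>: "\<And>p q. cmod (\<Lambda> p q) \<le> C * (B ^ (msize p + msize q) * fact (msize p))" and "1 \<le> B" "0 \<le> C"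
  shows "cmod (kap \<Lambda> js p q)
    \<le> C * (B ^ (msize p + msize q + length js) * fact (msize p) * (1 + real (msize p)) ^ length js)"
proof (induction js arbitrary: p q)
  case Nil
  show ?case using \<Lambda> by simp
next
  case (Cons j js)
  define X where "X = C * (B ^ (msize p + msize q + length (j # js)) * fact (msize p) * (1 + real (msize p)) ^ length js)"
  have X: "0 \<le> X" using assms by (simp add: X_def)
  have 1: "cmod (kap \<Lambda> js p (up j q)) \<le> X"
    using Cons[of p "up j q"] by (simp add: X_def msize_up del: fun_upd_apply)
  have 2: "cmod (sg j * of_nat (p j) * kap \<Lambda> js (dn j p) q) \<le> real (msize p) * X"
  proof (cases "p j = 0")
    case False
    hence m: "msize p = Suc (msize (dn j p))" using msize_dn[of p j] by simp
    have "cmod (kap \<Lambda> js (dn j p) q) \<le> C * (B ^ (msize (dn j p) + msize q + length js)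
        * fact (msize (dn j p)) * (1 + real (msize (dn j p))) ^ length js)" by (rule Cons)
    also have "\<dots> \<le> X"
      unfolding X_def using assms m
      by (intro mult_mono power_mono power_increasing fact_mono) auto
    finally have "cmod (kap \<Lambda> js (dn j p) q) \<le> X" .
    hence "cmod (sg j * of_nat (p j) * kap \<Lambda> js (dn j p) q) \<le> real (p j) * X"
      by (simp add: norm_mult mult_left_mono)
    also have "\<dots> \<le> real (msize p) * X" using X index_le_msize[of p j] by (intro mult_right_mono) auto
    finally show ?thesis .
  qed (use X in simp)
  have "cmod (kap \<Lambda> (j # js) p q) \<le> X + real (msize p) * X"
    unfolding kap.simps by (rule order_trans[OF norm_triangle_ineq add_mono[OF 1 2]])
  also have "\<dots> = (1 + real (msize p)) * X" by (simp add: algebra_simps)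
  finally show ?case by (simp add: X_def mult_ac)
qed

lemma kap_Lsym_bound:
  assumes "0 < m" "1 \<le> R"
  obtains B C where "0 < B"
    "\<And>\<eta> w T. (\<And>j. cmod (\<eta> $ j) \<le> R) \<Longrightarrow> (\<And>j. cmod (w $ j) \<le> R) \<Longrightarrow> m \<le> Re (lor \<eta> w) \<Longrightarrow>
      cmod (lor \<eta> w) \<le> M \<Longrightarrow> T \<in> triples \<Longrightarrow>
      cmod (kap (Lsym x \<eta> w) js (zexp T) (zbexp T)) \<le> C * (B ^ deg T * fact (deg T))"
proof -
  obtain B C where BC: "1 \<le> B" "0 \<le> C"
    "\<And>(\<eta> :: complex ^ 'a option) w p q. (\<And>j. cmod (\<eta> $ j) \<le> R) \<Longrightarrow> (\<And>j. cmod (w $ j) \<le> R) \<Longrightarrow> m \<le> Re (lor \<eta> w) \<Longrightarrow>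
      cmod (lor \<eta> w) \<le> M \<Longrightarrow> cmod (Lsym x \<eta> w p q) \<le> C * (B ^ (msize p + msize q) * fact (msize p))"
    using Lsym_bound[OF assms, where M = M and x = x] by blast
  let ?k = "length js"
  show thesis
  proof (rule that[of "B * B * 2 ^ ?k" "C * B ^ ?k"])
    show "0 < B * B * 2 ^ ?k" using BC(1) by simp
    fix \<eta> w :: "complex ^ 'a option" and T :: "'a triple"
    assume *: "\<And>j. cmod (\<eta> $ j) \<le> R" "\<And>j. cmod (w $ j) \<le> R" "m \<le> Re (lor \<eta> w)" "cmod (lor \<eta> w) \<le> M"
      and T: "T \<in> triples"
    have "1 + real (deg T) \<le> 2 ^ deg T" using Suc_leI[OF less_exp[of "deg T"]] by (simp flip: of_nat_le_iff[where 'a=real])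
    hence "(1 + real (deg T)) ^ ?k \<le> (2 ^ deg T) ^ ?k" by (intro power_mono) auto
    hence p: "(1 + real (deg T)) ^ ?k \<le> (2 ^ ?k) ^ deg T" by (simp flip: power_mult add: mult.commute)
    have "cmod (kap (Lsym x \<eta> w) js (zexp T) (zbexp T))
        \<le> C * (B ^ (deg T + deg T + ?k) * fact (deg T) * (1 + real (deg T)) ^ ?k)"
      using kap_bound[OF BC(3)[OF *] BC(1,2), of js "zexp T" "zbexp T"]
      by (simp add: msize_enc_pair[OF T])
    also have "\<dots> \<le> C * (B ^ (deg T + deg T + ?k) * fact (deg T) * (2 ^ ?k) ^ deg T)"
      using BC p by (intro mult_left_mono) auto
    also have "\<dots> = C * B ^ ?k * ((B * B * 2 ^ ?k) ^ deg T * fact (deg T))"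
      by (simp add: power_add power_mult_distrib)
    finally show "cmod (kap (Lsym x \<eta> w) js (zexp T) (zbexp T))
      \<le> C * B ^ ?k * ((B * B * 2 ^ ?k) ^ deg T * fact (deg T))" .
  qed
qed

text \<open>Close to a diagonal point over the cone the arguments stay in a compact region where
  \<open>lor\<close> has positive real part, uniformly for all directions \<open>a\<close> on the unit circle. There the powers of
  \<open>lor\<close> are holomorphic and the bounds for the symbols are uniform.\<close>

lemma line_domain:
  fixes \<eta> :: "complex ^ 'n::finite option"
  assumes "\<eta> \<in> Cplus"
  obtains \<delta> m R M where "0 < \<delta>" "0 < m" "1 \<le> R"
    "\<And>a \<tau>. cmod a = 1 \<Longrightarrow> cmod \<tau> \<le> \<delta> \<Longrightarrow>
      (\<forall>k. cmod ((\<eta> + axis j (\<tau> * a)) $ k) \<le> R) \<and>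
      (\<forall>k. cmod ((vcnj \<eta> + axis j (\<tau> * cnj a)) $ k) \<le> R) \<and>
      m \<le> Re (lor (\<eta> + axis j (\<tau> * a)) (vcnj \<eta> + axis j (\<tau> * cnj a))) \<and>
      cmod (lor (\<eta> + axis j (\<tau> * a)) (vcnj \<eta> + axis j (\<tau> * cnj a))) \<le> M"
proof -
  define y where "y = yfun \<eta>"
  have y: "0 < y" using assms by (simp add: Cplus_def y_def)
  define R where "R = norm \<eta> + 1"
  define L where "L = 2 * R + 1"
  have R1: "1 \<le> R" by (simp add: R_def)
  hence L: "0 < L" by (simp add: L_def)
  define \<delta> where "\<delta> = min 1 (y / (2 * L))"
  have \<delta>: "0 < \<delta>" "\<delta> \<le> 1" "\<delta> * L \<le> y / 2" using y L by (auto simp: \<delta>_def min_def field_simps)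
  show thesis
  proof (rule that[of \<delta> "y / 2" R "y + y / 2"])
    fix a \<tau> :: complex assume a: "cmod a = 1" and \<tau>: "cmod \<tau> \<le> \<delta>"
    have \<eta>: "cmod (\<eta> $ k) \<le> R - 1" for k using Finite_Cartesian_Product.norm_nth_le[of \<eta> k] by (simp add: R_def)
    have \<tau>1: "cmod \<tau> \<le> 1" using \<tau> \<delta> by simp
    have 1: "cmod ((\<eta> + axis j (\<tau> * a)) $ k) \<le> R" for k
      using norm_triangle_ineq[of "\<eta> $ k" "\<tau> * a"] \<eta>[of k] \<tau>1 a by (auto simp: axis_def norm_mult)
    have 2: "cmod ((vcnj \<eta> + axis j (\<tau> * cnj a)) $ k) \<le> R" for k
      using norm_triangle_ineq[of "cnj (\<eta> $ k)" "\<tau> * cnj a"] \<eta>[of k] \<tau>1 a by (auto simp: axis_def norm_mult)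
    define d where "d = sg j * (\<tau> * a * vcnj \<eta> $ j + \<tau> * cnj a * \<eta> $ j + \<tau> * a * (\<tau> * cnj a))"
    have l: "lor (\<eta> + axis j (\<tau> * a)) (vcnj \<eta> + axis j (\<tau> * cnj a)) = of_real y - d"
      by (simp only: lor_line lor_vcnj y_def d_def)
    have "cmod d \<le> cmod (\<tau> * a * vcnj \<eta> $ j) + cmod (\<tau> * cnj a * \<eta> $ j) + cmod (\<tau> * a * (\<tau> * cnj a))"
      unfolding d_def norm_mult[of "sg j"] sg_sq by (simp only: mult_1) (intro norm_triangle_le add_right_mono norm_triangle_ineq)
    also have "\<dots> = cmod \<tau> * (2 * cmod (\<eta> $ j) + cmod \<tau>)"
      using a by (simp add: norm_mult algebra_simps)
    also have "\<dots> \<le> \<delta> * L"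
      using \<tau> \<tau>1 \<eta>[of j] L \<delta>(1) by (intro mult_mono) (auto simp: L_def)
    finally have d: "cmod d \<le> y / 2" using \<delta>(3) by simp
    have 3: "y / 2 \<le> Re (of_real y - d)" using d complex_Re_le_cmod[of d] by simp
    have 4: "cmod (of_real y - d) \<le> y + y / 2" using norm_triangle_ineq4[of "of_real y" d] d y by simp
    show "(\<forall>k. cmod ((\<eta> + axis j (\<tau> * a)) $ k) \<le> R) \<and>
      (\<forall>k. cmod ((vcnj \<eta> + axis j (\<tau> * cnj a)) $ k) \<le> R) \<and>
      y / 2 \<le> Re (lor (\<eta> + axis j (\<tau> * a)) (vcnj \<eta> + axis j (\<tau> * cnj a))) \<and>
      cmod (lor (\<eta> + axis j (\<tau> * a)) (vcnj \<eta> + axis j (\<tau> * cnj a))) \<le> y + y / 2"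
      using 1 2 3 4 unfolding l by blast
  qed (use \<delta> y R1 in auto)
qed

lemma axis_add: "axis j (s + t) = axis j s + (axis j t :: complex ^ 'm::finite)"
  by (simp add: axis_def vec_eq_iff)

text \<open>The line \<open>\<tau> \<mapsto> (\<eta> + \<tau> a e\<^sub>j, vcnj \<eta> + \<tau> cnj a e\<^sub>j)\<close> lies on the diagonal for real \<open>\<tau>\<close>. A symbol sum that
  vanishes on the diagonal is holomorphic along this line and vanishes at the real points, hence
  vanishes on the line, and locally uniform convergence allows termwise differentiation.\<close>

lemma symbol_line_sum:
  fixes c :: "'n::finite triple \<Rightarrow> complex"
  assumes c: "admissible c"
    and Z: "\<And>\<eta>. \<eta> \<in> Cplus \<Longrightarrow> ((\<lambda>T. c T / of_real (tfact T)
      * kap (Lsym x \<eta> (vcnj \<eta>)) js (zexp T) (zbexp T)) has_sum 0) triples"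
    and \<eta>: "\<eta> \<in> Cplus" and a: "cmod a = 1"
    and D: "\<And>T. ((\<lambda>\<tau>. kap (Lsym x (\<eta> + axis j (\<tau> * a)) (vcnj \<eta> + axis j (\<tau> * cnj a))) js
      (zexp T) (zbexp T)) has_field_derivative D T) (at 0)"
  shows "((\<lambda>T. c T / of_real (tfact T) * D T) has_sum 0) triples"
proof -
  obtain \<delta> m R M where dom: "0 < \<delta>" "0 < m" "1 \<le> R"
    "\<And>a \<tau>. cmod a = 1 \<Longrightarrow> cmod \<tau> \<le> \<delta> \<Longrightarrow>
      (\<forall>k. cmod ((\<eta> + axis j (\<tau> * a)) $ k) \<le> R) \<and>
      (\<forall>k. cmod ((vcnj \<eta> + axis j (\<tau> * cnj a)) $ k) \<le> R) \<and>
      m \<le> Re (lor (\<eta> + axis j (\<tau> * a)) (vcnj \<eta> + axis j (\<tau> * cnj a))) \<and>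
      cmod (lor (\<eta> + axis j (\<tau> * a)) (vcnj \<eta> + axis j (\<tau> * cnj a))) \<le> M"
    by (rule line_domain[OF \<eta>, of j]) blast
  obtain B C where B: "0 < B"
    "\<And>\<eta> w T. (\<And>j. cmod (\<eta> $ j) \<le> R) \<Longrightarrow> (\<And>j. cmod (w $ j) \<le> R) \<Longrightarrow> m \<le> Re (lor \<eta> w) \<Longrightarrow>
      cmod (lor \<eta> w) \<le> M \<Longrightarrow> T \<in> triples \<Longrightarrow>
      cmod (kap (Lsym x \<eta> w) js (zexp T) (zbexp T)) \<le> C * (B ^ deg T * fact (deg T))"
    using kap_Lsym_bound[OF dom(2,3), where M = M and x = x and js = js] by blast
  define k where "k T \<tau> = kap (Lsym x (\<eta> + axis j (\<tau> * a)) (vcnj \<eta> + axis j (\<tau> * cnj a))) js (zexp T) (zbexp T)" for T \<tau>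
  define f where "f T \<tau> = c T / of_real (tfact T) * k T \<tau>" for T \<tau>
  have bound: "cmod (f T \<tau>) \<le> C * (cmod (c T) * (B ^ deg T * fact (deg T) / tfact T))"
    if "T \<in> triples" "\<tau> \<in> cball 0 \<delta>" for T \<tau>
  proof -
    have "cmod (k T \<tau>) \<le> C * (B ^ deg T * fact (deg T))"
      unfolding k_def using dom(4)[OF a, of \<tau>] that by (intro B(2)) auto
    hence "cmod (c T) / tfact T * cmod (k T \<tau>) \<le> cmod (c T) / tfact T * (C * (B ^ deg T * fact (deg T)))"
      by (rule mult_left_mono) (simp add: less_imp_le)
    moreover have "cmod (f T \<tau>) = cmod (c T) / tfact T * cmod (k T \<tau>)"
      using tfact_pos[of T] by (simp add: f_def norm_mult norm_divide del: tfact_pos)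
    ultimately show ?thesis by (simp add: mult_ac)
  qed
  have sumM: "(\<lambda>T. C * (cmod (c T) * (B ^ deg T * fact (deg T) / tfact T))) summable_on triples"
    by (rule summable_on_cmult_right[OF summable_coeffs[OF c B(1)]])
  define g where "g \<tau> = (\<Sum>\<^sub>\<infinity>T\<in>triples. f T \<tau>)" for \<tau>
  have lim: "uniform_limit (cball 0 \<delta>) (\<lambda>F \<tau>. \<Sum>T\<in>F. f T \<tau>) g (finite_subsets_at_top triples)"
    unfolding g_def by (rule Weierstrass_m_test_general[OF bound sumM])
  have diff: "(f T) field_differentiable (at \<tau>0)" if \<tau>0: "\<tau>0 \<in> cball 0 \<delta>" for T \<tau>0
  proof -
    define \<eta>' w' where "\<eta>' = \<eta> + axis j (\<tau>0 * a)" and "w' = vcnj \<eta> + axis j (\<tau>0 * cnj a)"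
    have "lor \<eta>' w' \<notin> \<real>\<^sub>\<le>\<^sub>0"
      using dom(2) dom(4)[OF a, of \<tau>0] \<tau>0 by (auto simp: \<eta>'_def w'_def complex_nonpos_Reals_iff)
    then obtain E where "((\<lambda>\<tau>. kap (Lsym x (\<eta>' + axis j (\<tau> * a)) (w' + axis j (\<tau> * cnj a))) js (zexp T) (zbexp T))
        has_field_derivative E) (at (\<tau>0 - \<tau>0))"
      using kap_line_derivative[of \<eta>' w' x j js "zexp T" "zbexp T"] by auto
    moreover have "((\<lambda>\<tau>. \<tau> - \<tau>0) has_field_derivative 1) (at \<tau>0)" by (auto intro!: derivative_eq_intros)
    ultimately have "((\<lambda>\<tau>. kap (Lsym x (\<eta>' + axis j ((\<tau> - \<tau>0) * a)) (w' + axis j ((\<tau> - \<tau>0) * cnj a))) js (zexp T) (zbexp T))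
        has_field_derivative E * 1) (at \<tau>0)" by (rule DERIV_chain2)
    moreover have "\<eta>' + axis j ((\<tau> - \<tau>0) * a) = \<eta> + axis j (\<tau> * a)"
      "w' + axis j ((\<tau> - \<tau>0) * cnj a) = vcnj \<eta> + axis j (\<tau> * cnj a)" for \<tau>
      by (simp_all add: \<eta>'_def w'_def add.assoc flip: axis_add, simp_all add: algebra_simps)
    ultimately have "(k T has_field_derivative E * 1) (at \<tau>0)" by (simp add: k_def[abs_def])
    from DERIV_cmult[OF this] show ?thesis unfolding f_def[abs_def] field_differentiable_def by blast
  qed
  have hol: "(\<lambda>\<tau>. \<Sum>T\<in>F. f T \<tau>) holomorphic_on cball 0 \<delta>" for F
    unfolding holomorphic_on_def
    by (intro ballI field_differentiable_sum field_differentiable_at_within[OF diff])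
  have g_hol: "g holomorphic_on ball 0 \<delta>"
    by (rule holomorphic_uniform_limit[OF _ lim finite_subsets_at_top_neq_bot])
       (auto intro!: always_eventually holomorphic_on_imp_continuous_on hol holomorphic_on_subset[OF hol])
  have g_real: "g (of_real \<tau>) = 0" if \<tau>: "\<bar>\<tau>\<bar> < \<delta>" for \<tau>
  proof -
    define \<eta>' where "\<eta>' = \<eta> + axis j (of_real \<tau> * a)"
    have v: "vcnj \<eta>' = vcnj \<eta> + axis j (of_real \<tau> * cnj a)"
      by (auto simp: \<eta>'_def vec_eq_iff axis_def)
    have "cmod (of_real \<tau>) \<le> \<delta>" using \<tau> by simp
    from dom(4)[OF a this] have "m \<le> Re (lor \<eta>' (vcnj \<eta>'))" unfolding v unfolding \<eta>'_def by (elim conjE)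
    hence "\<eta>' \<in> Cplus" using dom(2) by (simp add: lor_vcnj Cplus_def)
    note Z = infsumI[OF Z[OF this]]
    show ?thesis
      unfolding g_def f_def k_def v[symmetric] unfolding \<eta>'_def[symmetric] by (rule Z)
  qed
  have g0: "g \<tau> = 0" if "\<tau> \<in> ball 0 \<delta>" for \<tau>
  proof (rule analytic_continuation[OF g_hol open_ball connected_ball, of "of_real ` {- \<delta><..<\<delta>}" 0])
    show "(0::complex) islimpt of_real ` {- \<delta><..<\<delta>}"
      unfolding islimpt_approachable
    proof (intro allI impI)
      fix e :: real assume "0 < e"
      thus "\<exists>x'\<in>complex_of_real ` {- \<delta><..<\<delta>}. x' \<noteq> 0 \<and> dist x' 0 < e"
        using dom(1) by (intro bexI[OF _ imageI[of "min e \<delta> / 2"]]) (auto simp: min_def)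
    qed
  qed (use that dom(1) g_real in auto)
  have dsum: "deriv (\<lambda>\<tau>. \<Sum>T\<in>F. f T \<tau>) 0 = (\<Sum>T\<in>F. c T / of_real (tfact T) * D T)" for F
    unfolding f_def k_def by (intro DERIV_imp_deriv DERIV_sum DERIV_cmult D)
  have "((\<lambda>F. (deriv ^^ 1) (\<lambda>\<tau>. \<Sum>T\<in>F. f T \<tau>) 0) \<longlongrightarrow> (deriv ^^ 1) g 0) (finite_subsets_at_top triples)"
    using dom(1)
    by (intro higher_deriv_complex_uniform_limit[where A = "ball 0 \<delta>"] uniform_limit_on_subset[OF lim]
        always_eventually allI holomorphic_on_subset[OF hol]) auto
  moreover have "deriv g 0 = 0"
  proof -
    have "(g has_field_derivative 0) (at 0)"
      by (rule has_field_derivative_transform_within_open[OF DERIV_const[of 0] open_ball, of 0 0 \<delta>])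
         (use g0 dom(1) in auto)
    thus ?thesis by (rule DERIV_imp_deriv)
  qed
  ultimately show ?thesis by (simp add: dsum has_sum_def)
qed

text \<open>With \<open>D\<^sub>1, D\<^sub>2\<close> the derivatives in \<open>\<eta>\<^sub>j\<close> and \<open>w\<^sub>j\<close>, the lines with \<open>a = 1\<close> and \<open>a = \<i>\<close> give the vanishing of
  the sums of \<open>D\<^sub>1 + D\<^sub>2\<close> and of \<open>\<i> (D\<^sub>1 - D\<^sub>2)\<close>, hence of the sum of \<open>D\<^sub>1\<close>.\<close>

lemma symbol_derivative_sum:
  fixes c :: "'n::finite triple \<Rightarrow> complex"
  assumes c: "admissible c" and x: "x \<noteq> 0"
    and Z: "\<And>\<eta>. \<eta> \<in> Cplus \<Longrightarrow> ((\<lambda>T. c T / of_real (tfact T)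
      * kap (Lsym x \<eta> (vcnj \<eta>)) js (zexp T) (zbexp T)) has_sum 0) triples"
    and \<eta>: "\<eta> \<in> Cplus"
  shows "((\<lambda>T. c T / of_real (tfact T)
      * kap (Lsym (x + 1) \<eta> (vcnj \<eta>)) (js @ [j]) (zexp T) (zbexp T)) has_sum 0) triples"
proof -
  define K where "K T = kap (Lsym (x + 1) \<eta> (vcnj \<eta>)) (js @ [j]) (zexp T) (zbexp T)" for T
  have "lor \<eta> (vcnj \<eta>) \<notin> \<real>\<^sub>\<le>\<^sub>0" using \<eta> by (auto simp: lor_vcnj Cplus_def)
  hence ex: "\<exists>D. \<forall>a b. ((\<lambda>\<tau>. kap (Lsym x (\<eta> + axis j (\<tau> * a)) (vcnj \<eta> + axis j (\<tau> * b))) js (zexp T) (zbexp T))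
      has_field_derivative a * (sg j * x * K T) + b * D) (at 0)" for T
    unfolding K_def by (rule kap_line_derivative)
  define D where "D T = (SOME D. \<forall>a b. ((\<lambda>\<tau>. kap (Lsym x (\<eta> + axis j (\<tau> * a)) (vcnj \<eta> + axis j (\<tau> * b))) js (zexp T) (zbexp T))
      has_field_derivative a * (sg j * x * K T) + b * D) (at 0))" for T
  have D: "((\<lambda>\<tau>. kap (Lsym x (\<eta> + axis j (\<tau> * a)) (vcnj \<eta> + axis j (\<tau> * b))) js (zexp T) (zbexp T))
      has_field_derivative a * (sg j * x * K T) + b * D T) (at 0)" for T a b
    using someI_ex[OF ex[of T]] unfolding D_def[symmetric] by (elim allE)
  have S: "((\<lambda>T. c T / of_real (tfact T) * (a * (sg j * x * K T) + cnj a * D T)) has_sum 0) triples"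
    if "cmod a = 1" for a
    by (rule symbol_line_sum[OF c Z \<eta> that D])
  have "((\<lambda>T. c T / of_real (tfact T) * (1 * (sg j * x * K T) + cnj 1 * D T)
      + (- \<i>) * (c T / of_real (tfact T) * (\<i> * (sg j * x * K T) + cnj \<i> * D T))) has_sum (0 + (- \<i>) * 0)) triples"
    by (intro has_sum_add has_sum_cmult_right S) auto
  hence "((\<lambda>T. (1 / (2 * (sg j * x))) * (c T / of_real (tfact T) * (1 * (sg j * x * K T) + cnj 1 * D T)
      + (- \<i>) * (c T / of_real (tfact T) * (\<i> * (sg j * x * K T) + cnj \<i> * D T)))) has_sum
      (1 / (2 * (sg j * x))) * (0 + (- \<i>) * 0)) triples"
    by (rule has_sum_cmult_right)
  moreover have "(1 / (2 * (sg j * x))) * (c T / of_real (tfact T) * (1 * (sg j * x * K T) + cnj 1 * D T)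
      + (- \<i>) * (c T / of_real (tfact T) * (\<i> * (sg j * x * K T) + cnj \<i> * D T))) = c T / of_real (tfact T) * K T" for T
  proof -
    have "A * (1 * k + cnj 1 * d) + (- \<i>) * (A * (\<i> * k + cnj \<i> * d)) = 2 * (A * k)" for A k d :: complex
      by (simp add: algebra_simps)
    hence "(1 / (2 * (sg j * x))) * (c T / of_real (tfact T) * (1 * (sg j * x * K T) + cnj 1 * D T)
      + (- \<i>) * (c T / of_real (tfact T) * (\<i> * (sg j * x * K T) + cnj \<i> * D T)))
      = (1 / (2 * (sg j * x))) * (2 * (c T / of_real (tfact T) * (sg j * x * K T)))" by (simp only:)
    thus ?thesis using x by simp
  qed
  ultimately show ?thesis unfolding K_def by simp
qed

lemma Lsym_diag:
  assumes "\<eta> \<in> Cplus" "T \<in> triples"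
  shows "Lsym x \<eta> (vcnj \<eta>) (zexp T) (zbexp T)
    = of_real (yfun \<eta>) powr (- x) * (pochhammer x (deg T) * (epoly T \<eta> / of_real (yfun \<eta>) ^ deg T))"
proof -
  have "of_real (yfun \<eta>) \<noteq> (0 :: complex)" using assms by (simp add: Cplus_def)
  thus ?thesis
    by (simp add: Lsym_def lor_vcnj msize_enc_pair[OF assms(2)] epoly_zmono zmono_def powr_diff powr_nat')
qed

lemma fbasis_level:
  assumes "yfun w = 1" "T \<in> triples"
  shows "fbasis h T w = Lsym (1 / (2 * h)) w (vcnj w) (zexp T) (zbexp T)
    / of_real (tfact T)"
proof -
  have w: "w \<in> Cplus" using assms by (simp add: Cplus_def)
  show ?thesis
    unfolding fbasis_Cplus[OF w] Lsym_diag[OF w assms(2)] by (simp add: assms(1))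
qed

definition vanish_level :: "(complex ^ 'n::finite option \<Rightarrow> complex) \<Rightarrow> bool" where
  "vanish_level a \<longleftrightarrow> (\<forall>w. yfun w = 1 \<longrightarrow> a w = 0)"

text \<open>By homogeneity the vanishing on the level set extends to the cone, where the symbols can be
  differentiated.\<close>

lemma symbol_sum:
  fixes c :: "'n::finite triple \<Rightarrow> complex"
  assumes c: "admissible c" and van: "vanish_level (fseries h c)" and \<eta>: "\<eta> \<in> Cplus"
  shows "((\<lambda>T. c T / of_real (tfact T)
      * Lsym (1 / (2 * h)) \<eta> (vcnj \<eta>) (zexp T) (zbexp T)) has_sum 0) triples"
proof -
  define y where "y = yfun \<eta>"
  have y: "0 < y" using \<eta> by (simp add: Cplus_def y_def)
  define w where "w = (\<chi> j. of_real (1 / sqrt y) * \<eta> $ j)"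
  have k: "(cmod (of_real (1 / sqrt y)))\<^sup>2 = 1 / y" using y by (simp add: power_divide norm_divide)
  have w: "yfun w = 1" using y unfolding w_def yfun_scale k by (simp add: y_def)
  hence wC: "w \<in> Cplus" by (simp add: Cplus_def)
  have "((\<lambda>T. c T * fbasis h T w) has_sum 0) triples"
    using fseries_has_sum[OF c, of h w] van w by (simp add: vanish_level_def)
  hence "((\<lambda>T. of_real y powr (- (1 / (2 * h))) * (c T * fbasis h T w)) has_sum (of_real y powr (- (1 / (2 * h))) * 0)) triples"
    by (rule has_sum_cmult_right)
  hence Z: "((\<lambda>T. of_real y powr (- (1 / (2 * h))) * (c T * fbasis h T w)) has_sum 0) triples"
    by (simp only: mult_zero_right)
  have e: "of_real y powr (- (1 / (2 * h))) * (c T * fbasis h T w) = c T / of_real (tfact T)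
      * Lsym (1 / (2 * h)) \<eta> (vcnj \<eta>) (zexp T) (zbexp T)" if T: "T \<in> triples" for T
  proof -
    have "epoly T w = of_real (1 / y) ^ deg T * epoly T \<eta>" unfolding w_def epoly_scale[OF T] k ..
    thus ?thesis
      unfolding fbasis_Cplus[OF wC] Lsym_diag[OF \<eta> T] w by (simp add: y_def power_divide mult_ac)
  qed
  show ?thesis by (rule iffD1[OF has_sum_cong[OF e] Z])
qed

text \<open>Every letter costs a division by the current parameter; the parameters that occur are
  \<open>1/(2h), 1/(2h) + 1, ...\<close>.\<close>

lemma symbol_kap_sum:
  fixes c :: "'n::finite triple \<Rightarrow> complex"
  assumes c: "admissible c" and van: "vanish_level (fseries h c)"
    and h: "\<And>k::nat. 1 / (2 * h) + of_nat k \<noteq> 0" and \<eta>: "\<eta> \<in> Cplus"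
  shows "((\<lambda>T. c T / of_real (tfact T)
      * kap (Lsym (1 / (2 * h) + of_nat (length js)) \<eta> (vcnj \<eta>)) js (zexp T) (zbexp T)) has_sum 0) triples"
  using \<eta>
proof (induction js arbitrary: \<eta> rule: rev_induct)
  case Nil
  thus ?case using symbol_sum[OF c van Nil] by simp
next
  case (snoc j js)
  from symbol_derivative_sum[OF c h snoc.IH snoc.prems, of j]
  show ?case by (simp add: add_ac)
qed

text \<open>The evaluations are continuous.\<close>

lemma fseries_bound:
  obtains K where "0 \<le> K"
    "\<And>c :: 'n::finite triple \<Rightarrow> complex. admissible c \<Longrightarrow> cmod (fseries h c w) \<le> K * nrm (1/2) c"
proof -
  obtain B where B: "0 < B"
    "\<And>T. T \<in> triples \<Longrightarrow> cmod (fbasis h T w) \<le> B ^ deg T * fact (deg T) / tfact T"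
    by (rule fbasis_bound[of h w]) blast
  define c1 :: "'n triple \<Rightarrow> complex" where "c1 T = of_real (fact (deg T) powr (1/2))" for T
  define s where "s T = cmod (c1 T) * (B ^ deg T * fact (deg T) / tfact T)" for T
  have "grows (1/2) 1 c1" by (simp add: grows_def c1_def)
  hence sum: "s summable_on triples" unfolding s_def[abs_def] by (rule summable_grows[OF _ B(1)])
  show thesis
  proof (rule that[of "infsum s triples"])
    have "0 \<le> s T" for T using B(1) by (simp add: s_def less_imp_le)
    thus "0 \<le> infsum s triples" by (intro infsum_nonneg)
    fix c :: "'n triple \<Rightarrow> complex" assume c: "admissible c"
    have "((\<lambda>T. nrm (1/2) c * s T) has_sum (nrm (1/2) c * infsum s triples)) triples"
      by (intro has_sum_cmult_right has_sum_infsum sum)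
    from norm_infsum_le[OF fseries_has_sum[OF c] this]
    have "cmod (fseries h c w) \<le> nrm (1/2) c * infsum s triples"
    proof -
      have "cmod (c T * fbasis h T w) \<le> nrm (1/2) c * s T" if T: "T \<in> triples" for T
      proof -
        have "cmod (c T) \<le> nrm (1/2) c * cmod (c1 T)"
          using grows_nrm[OF c, of "1/2"] T by (simp add: grows_def c1_def)
        hence "cmod (c T) * cmod (fbasis h T w) \<le> nrm (1/2) c * cmod (c1 T) * (B ^ deg T * fact (deg T) / tfact T)"
          using B T nrm_nonneg[OF c, of "1/2"] by (intro mult_mono) auto
        thus ?thesis by (simp add: norm_mult s_def mult.assoc)
      qed
      thus ?thesis
        using \<open>(\<And>x. x \<in> triples \<Longrightarrow> cmod (c x * fbasis h x w) \<le> nrm (1/2) c * s x) \<Longrightarrow>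
          cmod (fseries h c w) \<le> nrm (1/2) c * infsum s triples\<close> by blast
    qed
    thus "cmod (fseries h c w) \<le> infsum s triples * nrm (1/2) c" by (simp only: mult.commute)
  qed
qed

lemma fseries_tendsto:
  assumes c: "admissible c" and C: "eventually (\<lambda>k. admissible (C k)) F"
    and lim: "\<And>r. 0 < r \<Longrightarrow> eventually (\<lambda>k. nrm (1/2) (C k - c) < r) F"
  shows "((\<lambda>k. fseries h (C k) w) \<longlongrightarrow> fseries h c w) F"
proof (rule tendstoI)
  fix e :: real assume e: "0 < e"
  obtain K where K: "0 \<le> K" "\<And>c. admissible c \<Longrightarrow> cmod (fseries h c w) \<le> K * nrm (1/2) c"
    by (rule fseries_bound[of h w]) blast
  have "eventually (\<lambda>k. nrm (1/2) (C k - c) < e / (K + 1)) F" using e K(1) by (intro lim) auto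
  with C show "eventually (\<lambda>k. dist (fseries h (C k) w) (fseries h c w) < e) F"
  proof eventually_elim
    case (elim k)
    have ad: "admissible (C k - c)" using elim c by (intro admissible_diff)
    have "dist (fseries h (C k) w) (fseries h c w) = cmod (fseries h (C k - c) w)"
      by (simp add: fseries_diff[OF elim(1) c] dist_norm)
    also have "\<dots> \<le> K * nrm (1/2) (C k - c)" by (rule K(2)[OF ad])
    also have "\<dots> \<le> (K + 1) * nrm (1/2) (C k - c)"
      using nrm_nonneg[OF ad, of "1/2"] by (intro mult_right_mono) auto
    also have "\<dots> < e" using elim(2) K(1) by (simp add: field_simps)
    finally show ?case .
  qed
qed

lemma fseries_Cmul_tendsto:
  assumes c: "admissible c" and d: "admissible d"
    and C: "eventually (\<lambda>k. admissible (C k)) F" "\<And>\<epsilon> r. 0 < \<epsilon> \<Longrightarrow> \<epsilon> < 1 \<Longrightarrow> 0 < r \<Longrightarrow> eventually (\<lambda>k. nrm \<epsilon> (C k - c) < r) F"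
    and D: "eventually (\<lambda>k. admissible (D k)) F" "\<And>\<epsilon> r. 0 < \<epsilon> \<Longrightarrow> \<epsilon> < 1 \<Longrightarrow> 0 < r \<Longrightarrow> eventually (\<lambda>k. nrm \<epsilon> (D k - d) < r) F"
  shows "((\<lambda>k. fseries h (Cmul (C k) (D k)) w) \<longlongrightarrow> fseries h (Cmul c d) w) F"
proof (rule fseries_tendsto[OF admissible_Cmul[OF c d]])
  show "eventually (\<lambda>k. admissible (Cmul (C k) (D k))) F"
    using C(1) D(1) by eventually_elim (rule admissible_Cmul)
  fix r :: real assume r: "0 < r"
  obtain \<delta> where \<delta>: "0 < \<delta>" "\<And>c' d'. admissible c' \<Longrightarrow> admissible d' \<Longrightarrow>
    nrm (1/2 / 2) (c' - c) < \<delta> \<Longrightarrow> nrm (1/2 / 2) (d' - d) < \<delta> \<Longrightarrow> nrm (1/2) (Cmul c' d' - Cmul c d) < r"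
    by (rule Cmul_continuous[of "1/2" r c d]) (use r c d in auto)
  have "eventually (\<lambda>k. nrm (1/2 / 2) (C k - c) < \<delta>) F" "eventually (\<lambda>k. nrm (1/2 / 2) (D k - d) < \<delta>) F"
    by (rule C(2) D(2); simp add: \<delta>(1))+
  with C(1) D(1) show "eventually (\<lambda>k. nrm (1/2) (Cmul (C k) (D k) - Cmul c d) < r) F"
    by eventually_elim (rule \<delta>(2))
qed

lemma eventually_admissible_trunc:
  "eventually (\<lambda>A. admissible (trunc A c)) (finite_subsets_at_top triples)"
  by (rule eventually_mono[OF eventually_finite_subset]) (auto intro: admissible_trunc)

definition word :: "('m::finite \<Rightarrow> nat) \<Rightarrow> 'm list" where "word s = (SOME js. count_list js = s)"

lemma count_list_word: "count_list (word s) = s"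
  unfolding word_def by (rule someI_ex[OF ex_count_list])

lemma length_word: "length (word s) = msize s"
  by (metis count_list_word msize_count_list)

text \<open>The right factor with exponents \<open>r, s\<close> is multiplication by \<open>zbar\<^sup>s\<close>, which acts through \<open>kap\<close>, followed by
  multiplication by \<open>z\<^sup>r\<close>, which produces the factor in front of the inner sum.\<close>

lemma fseries_Cmul_finite:
  fixes c d :: "'n::finite triple \<Rightarrow> complex"
  assumes w: "yfun w = 1" and A: "finite A" "A \<subseteq> triples" and B: "finite B" "B \<subseteq> triples"
  shows "fseries h (Cmul (trunc A c) (trunc B d)) w
    = (\<Sum>y\<in>B. d y / of_real (tfact y) * (pochhammer (1 / (2 * h)) (deg y) * mpow (zexp y) w)
        * (\<Sum>x\<in>A. c x / of_real (tfact x) * kap (Lsym (1 / (2 * h) + of_nat (deg y)) w (vcnj w))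
            (word (zbexp y)) (zexp x) (zbexp x)))"
proof -
  define x0 where "x0 = 1 / (2 * h)"
  obtain N where N: "A \<union> B \<subseteq> triples_le N" using A B by (auto intro: finite_triplesE[of "A \<union> B"])
  have sc: "supp_le N (trunc A c)" and sd: "supp_le N (trunc B d)" using N by (auto intro: supp_le_trunc)
  define M where "M y = pochhammer x0 (deg y) * mpow (zexp y) w" for y
  define K where "K x y = kap (Lsym (x0 + of_nat (deg y)) w (vcnj w)) (word (zbexp y)) (zexp x) (zbexp x)" for x y
  define E where "E x y = c x / of_real (tfact x) * (d y / of_real (tfact y)) * (M y * K x y)" for x y
  have inner: "(\<Sum>is\<in>{is. length is \<le> N}. gsign is / fact (length is) * (fall is (zexp x) * fall is (zbexp y))
      * Lsym x0 w (vcnj w) (zexp x - count_list is + zexp y) (zbexp x + (zbexp y - count_list is))) = M y * K x y"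
    if y: "y \<in> triples_le N" for x y
  proof -
    have y': "y \<in> triples" "length (word (zbexp y)) \<le> N"
      using y by (auto simp: triples_le_def length_word msize_enc_pair)
    show ?thesis
      unfolding K_def sum_lists_kap[OF y'(2), symmetric] count_list_word sum_distrib_left Lsym_add M_def
      using y'(1) by (intro sum.cong refl) (simp add: msize_enc_pair mult_ac)
  qed
  have "fseries h (Cmul (trunc A c) (trunc B d)) w
    = (\<Sum>T\<in>triples_le (N + N). Cmul (trunc A c) (trunc B d) T * fbasis h T w)"
    unfolding fseries_supp[OF Cmul_supp[OF sc sd]] by (simp add: sum_fun_apply fscale_def)
  also have "\<dots> = (\<Sum>T\<in>triples_le (N + N). Cmul (trunc A c) (trunc B d) T / of_real (tfact T)
      * Lsym x0 w (vcnj w) (zexp T) (zbexp T))"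
    by (intro sum.cong refl) (simp add: fbasis_level[OF w] triples_le_def x0_def)
  also have "\<dots> = (\<Sum>x\<in>triples_le N. \<Sum>y\<in>triples_le N. trunc A c x / of_real (tfact x) * (trunc B d y / of_real (tfact y))
      * (M y * K x y))"
    unfolding sum_Cmul_fall[OF sc sd] by (intro sum.cong refl arg_cong2[where f = "(*)"] inner)
  also have "\<dots> = (\<Sum>x\<in>A. \<Sum>y\<in>B. E x y)"
  proof -
    have "(\<Sum>y\<in>triples_le N. trunc A c x / of_real (tfact x) * (trunc B d y / of_real (tfact y)) * (M y * K x y))
      = (if x \<in> A then \<Sum>y\<in>B. E x y else 0)" for x
    proof (cases "x \<in> A")
      case True
      thus ?thesis unfolding if_P[OF True]
        by (intro sum.mono_neutral_cong_right finite_triples_le) (use N in \<open>auto simp: trunc_def E_def\<close>)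
    qed (simp add: trunc_def)
    thus ?thesis
      using N by (simp add: finite_triples_le Int_absorb1 flip: sum.inter_restrict)
  qed
  also have "\<dots> = (\<Sum>y\<in>B. d y / of_real (tfact y) * M y * (\<Sum>x\<in>A. c x / of_real (tfact x) * K x y))"
    unfolding sum_distrib_left E_def by (subst sum.swap) (intro sum.cong refl, simp only: mult_ac)
  finally show ?thesis unfolding M_def K_def x0_def .
qed

lemma allowed_shift_nonzero:
  assumes "h \<in> allowed"
  shows "1 / (2 * h) + of_nat k \<noteq> 0"
proof
  assume *: "1 / (2 * h) + of_nat k = 0"
  have h: "2 * h \<noteq> 0" using assms by (simp add: allowed_def)
  have k: "1 / (2 * h) = - of_nat k" using * by (simp add: add_eq_0_iff2)
  have "2 * h = 1 / (1 / (2 * h))" by simp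
  also have "\<dots> = - 1 / of_nat k" unfolding k by simp
  finally have e: "2 * h = - 1 / of_nat k" .
  have "k \<ge> 1" using k h by (cases k) auto
  hence "2 * h \<noteq> - 1 / of_nat k" using assms unfolding allowed_def by blast
  thus False using e by contradiction
qed

text \<open>For a finite right factor the formula of the preceding lemma is a finite combination of symbol
  sums, each of which vanishes. The general case follows by approximation, since product and
  evaluations are continuous.\<close>

lemma ideal_left:
  fixes c d :: "'n::finite triple \<Rightarrow> complex"
  assumes h: "h \<in> allowed" and c: "admissible c" and d: "admissible d" and van: "vanish_level (fseries h c)"
  shows "vanish_level (fseries h (Cmul c d))"
  unfolding vanish_level_def
proof (intro allI impI)
  fix w :: "complex ^ 'n option" assume w: "yfun w = 1"
  hence wC: "w \<in> Cplus" by (simp add: Cplus_def)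
  let ?F = "finite_subsets_at_top (triples :: 'n triple set)"
  have fin: "fseries h (Cmul c (trunc B d)) w = 0" if B: "finite B" "B \<subseteq> triples" for B
  proof -
    let ?k = "\<lambda>y x. kap (Lsym (1 / (2 * h) + of_nat (deg y)) w (vcnj w))
            (word (zbexp y)) (zexp x) (zbexp x)"
    let ?m = "\<lambda>y. d y / of_real (tfact y) * (pochhammer (1 / (2 * h)) (deg y) * mpow (zexp y) w)"
    have "((\<lambda>A. \<Sum>x\<in>A. c x / of_real (tfact x) * ?k y x) \<longlongrightarrow> 0) ?F" if "y \<in> B" for y
    proof -
      have "length (word (zbexp y)) = deg y" using that B by (auto simp: length_word msize_enc_pair)
      with symbol_kap_sum[OF c van allowed_shift_nonzero[OF h] wC, of "word (zbexp y)"]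
      show ?thesis by (simp add: has_sum_def)
    qed
    hence "((\<lambda>A. \<Sum>y\<in>B. ?m y * (\<Sum>x\<in>A. c x / of_real (tfact x) * ?k y x)) \<longlongrightarrow> (\<Sum>y\<in>B. ?m y * 0)) ?F"
      by (intro tendsto_intros)
    hence "((\<lambda>A. fseries h (Cmul (trunc A c) (trunc B d)) w) \<longlongrightarrow> (\<Sum>y\<in>B. ?m y * 0)) ?F"
      by (rule Lim_transform_eventually)
         (rule eventually_mono[OF eventually_finite_subset], elim conjE,
          rule fseries_Cmul_finite[OF w _ _ B, symmetric])
    moreover have "((\<lambda>A. fseries h (Cmul (trunc A c) (trunc B d)) w) \<longlongrightarrow> fseries h (Cmul c (trunc B d)) w) ?F"
      by (intro fseries_Cmul_tendsto c admissible_trunc B eventually_admissible_trunc trunc_tendsto always_eventually)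
         (auto simp: nrm_zero admissible_trunc[OF B])
    ultimately have "fseries h (Cmul c (trunc B d)) w = (\<Sum>y\<in>B. ?m y * 0)"
      using tendsto_unique[OF finite_subsets_at_top_neq_bot] by blast
    thus ?thesis by simp
  qed
  have "((\<lambda>B. fseries h (Cmul c (trunc B d)) w) \<longlongrightarrow> fseries h (Cmul c d) w) ?F"
    by (intro fseries_Cmul_tendsto c d eventually_admissible_trunc trunc_tendsto always_eventually) (auto simp: nrm_zero c)
  moreover have "((\<lambda>B. fseries h (Cmul c (trunc B d)) w) \<longlongrightarrow> 0) ?F"
    by (rule Lim_transform_eventually[OF tendsto_const])
       (auto intro!: eventually_mono[OF eventually_finite_subset] simp: fin)
  ultimately show "fseries h (Cmul c d) w = 0"
    using tendsto_unique[OF finite_subsets_at_top_neq_bot] by blast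
qed

subsection \<open>Transposition\<close>

text \<open>Exchanging \<open>P\<close> and \<open>Q\<close> corresponds to conjugating the argument and reverses products. This
  exchanges the two sides of the ideal property.\<close>

definition tswap :: "'n triple \<Rightarrow> 'n triple" where "tswap = (\<lambda>(P, Q, \<alpha>). (Q, P, \<alpha>))"

lemma tswap_simps [simp]: "tswap (tswap T) = T" "deg (tswap T) = deg T" "tswap T \<in> triples \<longleftrightarrow> T \<in> triples"
  by (cases T; auto simp: tswap_def triples_def)+

lemma enc_pair_tswap: "zexp (tswap T) = zbexp T" "zbexp (tswap T) = zexp T"
  by (cases T; simp add: tswap_def enc_pair_def)+

lemma pcoeff_tswap: "pcoeff (c \<circ> tswap) p q = pcoeff c q p"
  by (simp add: pcoeff_def dec_def tswap_def)

lemma Cmul_tswap: "Cmul c d (tswap T) = Cmul (d \<circ> tswap) (c \<circ> tswap) T"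
proof (cases "T \<in> triples")
  case True
  hence T': "tswap T \<in> triples" by simp
  show ?thesis
    unfolding Cmul_def if_P[OF True] if_P[OF T'] pcoeff_tswap enc_pair_tswap
    by (subst sum.swap) (intro sum.cong refl, simp_all add: add.commute mult_ac)
qed (simp add: Cmul_def)

lemma admissible_tswap: "admissible c \<Longrightarrow> admissible (c \<circ> tswap)"
proof -
  assume c: "admissible c"
  have "grows \<epsilon> C (c \<circ> tswap)" if "grows \<epsilon> C c" for \<epsilon> C
    unfolding grows_def
  proof
    fix T :: "'a triple" assume "T \<in> triples"
    hence "tswap T \<in> triples" by simp
    with that show "cmod ((c \<circ> tswap) T) \<le> C * fact (deg T) powr \<epsilon>" unfolding grows_def comp_def by (metis tswap_simps(2))
  qed
  thus ?thesis using c unfolding admissible_iff by (metis comp_apply tswap_simps(3))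
qed

lemma yfun_vcnj [simp]: "yfun (vcnj w) = yfun w" by (simp add: yfun_def)

lemma vcnj_vcnj [simp]: "vcnj (vcnj w) = w" by (simp add: vec_eq_iff)

lemma fseries_tswap: "fseries h (c \<circ> tswap) w = fseries h c (vcnj w)"
proof -
  have fb: "fbasis h (tswap T) w = fbasis h T (vcnj w)" for T
  proof (cases "w \<in> Cplus")
    case True
    hence v: "vcnj w \<in> Cplus" by (simp add: Cplus_def)
    show ?thesis
      unfolding fbasis_Cplus[OF True] fbasis_Cplus[OF v]
      by (simp add: epoly_zmono zmono_def enc_pair_tswap tfact_def mult_ac)
  next
    case False
    thus ?thesis by (simp add: fbasis_outside Cplus_def)
  qed
  have "bij_betw tswap triples triples" by (rule bij_betw_byWitness[where f' = tswap]) auto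
  from infsum_reindex_bij_betw[OF this, of "\<lambda>T. c (tswap T) * fbasis h T w"]
  show ?thesis by (simp add: fseries_def fb)
qed

lemma ideal_right:
  fixes c d :: "'n::finite triple \<Rightarrow> complex"
  assumes h: "h \<in> allowed" and c: "admissible c" and d: "admissible d" and van: "vanish_level (fseries h c)"
  shows "vanish_level (fseries h (Cmul d c))"
proof -
  have "vanish_level (fseries h (c \<circ> tswap))"
    using van by (simp add: vanish_level_def fseries_tswap)
  from ideal_left[OF h admissible_tswap[OF c] admissible_tswap[OF d] this]
  have *: "vanish_level (fseries h (Cmul (c \<circ> tswap) (d \<circ> tswap)))" .
  have "Cmul d c = Cmul (c \<circ> tswap) (d \<circ> tswap) \<circ> tswap"
    by (rule ext) (simp add: Cmul_tswap[symmetric])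
  thus ?thesis using * by (simp add: vanish_level_def fseries_tswap)
qed

section \<open>Functions on the ball\<close>

text \<open>The point over \<open>v\<close> on the level set \<open>y = 1\<close> whose coordinate \<open>z\<^sup>0\<close> is positive.\<close>

definition sec :: "complex ^ 'n::finite \<Rightarrow> complex ^ 'n option" where
  "sec v = (\<chi> j. of_real (1 / sqrt (1 - (norm v)\<^sup>2)) * (case j of None \<Rightarrow> 1 | Some i \<Rightarrow> v $ i))"

lemma norm_vec_sq: "(norm (v :: complex ^ 'n::finite))\<^sup>2 = (\<Sum>i\<in>UNIV. (cmod (v $ i))\<^sup>2)"
  by (simp add: norm_vec_def L2_set_def sum_nonneg)

lemma yfun_proj:
  assumes "w $ None \<noteq> 0"
  shows "yfun w = (cmod (w $ None))\<^sup>2 * (1 - (norm (proj w))\<^sup>2)"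
  using assms
  by (simp add: yfun_def norm_vec_sq proj_def norm_divide power_divide right_diff_distrib sum_distrib_left)

lemma level_None_nonzero: "0 < yfun w \<Longrightarrow> w $ None \<noteq> 0"
  using sum_nonneg[of UNIV "\<lambda>i. (cmod (w $ Some i))\<^sup>2"] by (auto simp: yfun_def)

lemma sec_level:
  assumes "v \<in> Dball"
  shows "yfun (sec v) = 1" "proj (sec v) = v"
proof -
  define s where "s = 1 / sqrt (1 - (norm v)\<^sup>2)"
  have pos: "0 < 1 - (norm v)\<^sup>2" using assms by (simp add: Dball_def)
  hence s: "0 < s" "s\<^sup>2 * (1 - (norm v)\<^sup>2) = 1" by (simp_all add: s_def power_divide)
  have N: "sec v $ None = of_real s" by (simp add: sec_def s_def)
  show p: "proj (sec v) = v" using s pos by (simp add: proj_def sec_def vec_eq_iff)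
  show "yfun (sec v) = 1" using yfun_proj[of "sec v"] s p N by simp
qed

lemma proj_Dball:
  assumes "yfun w = 1"
  shows "proj w \<in> Dball"
proof -
  have "w $ None \<noteq> 0" using assms by (intro level_None_nonzero) simp
  with yfun_proj[of w] assms have "0 < (cmod (w $ None))\<^sup>2 * (1 - (norm (proj w))\<^sup>2)" by simp
  thus ?thesis by (simp add: Dball_def zero_less_mult_iff)
qed

lemma fseries_unit_scale:
  assumes "cmod k = 1"
  shows "fseries h c (\<chi> j. k * w $ j) = fseries h c w"
  unfolding fseries_def
proof (rule infsum_cong)
  fix T :: "'a triple" assume T: "T \<in> triples"
  have y: "yfun (\<chi> j. k * w $ j) = yfun w" using assms by (simp add: yfun_scale)
  hence "(\<chi> j. k * w $ j) \<in> Cplus \<longleftrightarrow> w \<in> Cplus" by (simp add: Cplus_def)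
  thus "c T * fbasis h T (\<chi> j. k * w $ j) = c T * fbasis h T w"
    using assms by (cases "w \<in> Cplus") (simp_all add: fbasis_Cplus fbasis_outside y epoly_scale[OF T])
qed

lemma fseries_level:
  assumes "yfun w = 1" "yfun w' = 1" "proj w = proj w'"
  shows "fseries h c w = fseries h c w'"
proof -
  have n: "w $ None \<noteq> 0" "w' $ None \<noteq> 0" using assms by (auto intro!: level_None_nonzero)
  define k where "k = w $ None / w' $ None"
  have "w $ j = k * w' $ j" for j
  proof (cases j)
    case (Some i)
    have "w $ Some i / w $ None = w' $ Some i / w' $ None"
      using assms(3) by (simp add: proj_def vec_eq_iff)
    hence "w $ Some i = w $ None * (w' $ Some i / w' $ None)" using n by (simp add: field_simps)
    thus ?thesis by (simp add: Some k_def)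
  qed (use n in \<open>simp add: k_def\<close>)
  hence "w = (\<chi> j. k * w' $ j)" by (simp add: vec_eq_iff)
  moreover have "(cmod k)\<^sup>2 = 1"
  proof -
    have "yfun w = (cmod k)\<^sup>2 * yfun w'" using yfun_scale[of k w'] calculation by simp
    thus ?thesis using assms by simp
  qed
  hence "cmod k = 1" using power2_eq_iff_nonneg[of "cmod k" 1] by simp
  ultimately show ?thesis using fseries_unit_scale by metis
qed

lemma red_fseries: "red (fseries h c) v = (if v \<in> Dball then fseries h c (sec v) else 0)"
proof (cases "v \<in> Dball")
  case True
  have "(THE e. \<forall>w. yfun w = 1 \<and> proj w = v \<longrightarrow> fseries h c w = e) = fseries h c (sec v)"
  proof (rule the_equality)
    show "\<forall>w. yfun w = 1 \<and> proj w = v \<longrightarrow> fseries h c w = fseries h c (sec v)"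
      using sec_level[OF True] by (auto intro: fseries_level)
    show "e = fseries h c (sec v)" if "\<forall>w. yfun w = 1 \<and> proj w = v \<longrightarrow> fseries h c w = e" for e
      using that sec_level[OF True] by auto
  qed
  thus ?thesis using True by (simp add: red_def)
qed (simp add: red_def)

lemma red_diff:
  assumes "admissible c" "admissible d"
  shows "red (fseries h (c - d)) = red (fseries h c) - red (fseries h d)"
proof
  fix v
  have "red (fseries h (c - d)) v = (if v \<in> Dball then (fseries h c - fseries h d) (sec v) else 0)"
    by (simp only: red_fseries fseries_diff[OF assms, symmetric])
  thus "red (fseries h (c - d)) v = (red (fseries h c) - red (fseries h d)) v"
    by (simp add: red_fseries)
qed

lemma red_fscale: "red (fseries h (fscale k c)) = fscale k (red (fseries h c))"
proof
  fix v
  show "red (fseries h (fscale k c)) v = fscale k (red (fseries h c)) v"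
    unfolding fscale_def[of k "red (fseries h c)"] red_fseries by (simp add: fseries_fscale fscale_def[of k "fseries h c"])
qed

lemma red_eq_0_iff: "red (fseries h c) = 0 \<longleftrightarrow> vanish_level (fseries h c)"
proof
  assume r: "red (fseries h c) = 0"
  show "vanish_level (fseries h c)"
    unfolding vanish_level_def
  proof (intro allI impI)
    fix w :: "complex ^ 'a option" assume w: "yfun w = 1"
    have "fseries h c w = fseries h c (sec (proj w))"
      using sec_level[OF proj_Dball[OF w]] w by (intro fseries_level) auto
    also have "\<dots> = red (fseries h c) (proj w)" using proj_Dball[OF w] by (simp add: red_fseries)
    finally show "fseries h c w = 0" using r by simp
  qed
next
  assume "vanish_level (fseries h c)"
  thus "red (fseries h c) = 0"
    by (intro ext) (simp add: red_fseries vanish_level_def sec_level)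
qed

lemma star_ball_eq:
  fixes c d :: "'n::finite triple \<Rightarrow> complex"
  assumes h: "h \<in> allowed" and c: "admissible c" and d: "admissible d"
  shows "star_ball h (red (fseries h c)) (red (fseries h d)) = red (fseries h (Cmul c d))"
  unfolding star_ball_def
proof (rule the_equality)
  note h0 = allowed_nonzero[OF h]
  show "\<forall>a'\<in>Ahat_cone h. \<forall>b'\<in>Ahat_cone h. red a' = red (fseries h c) \<and> red b' = red (fseries h d) \<longrightarrow>
      red (fseries h (Cmul c d)) = red (star_hat_cone h a' b')"
  proof (intro ballI impI)
    fix a' b' assume ab: "a' \<in> Ahat_cone h" "b' \<in> Ahat_cone h" "red a' = red (fseries h c) \<and> red b' = red (fseries h d)"
    obtain c' where c': "admissible c'" "a' = fseries h c'" using ab(1) by (rule Ahat_coneE)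
    obtain d' where d': "admissible d'" "b' = fseries h d'" using ab(2) by (rule Ahat_coneE)
    have vc: "vanish_level (fseries h (c - c'))"
      unfolding red_eq_0_iff[symmetric] red_diff[OF c c'(1)] using ab(3) c'(2) by simp
    have vd: "vanish_level (fseries h (d - d'))"
      unfolding red_eq_0_iff[symmetric] red_diff[OF d d'(1)] using ab(3) d'(2) by simp
    have ad: "admissible (c - c')" "admissible (d - d')" using c d c' d' by (auto intro: admissible_diff)
    have e: "Cmul c d - Cmul c' d' = Cmul (c - c') d + Cmul c' (d - d')"
      by (simp add: Cmul_diff_left Cmul_diff_right)
    have "vanish_level (fseries h (Cmul c d - Cmul c' d'))"
      using ideal_left[OF h ad(1) d vc] ideal_right[OF h ad(2) c'(1) vd]
      unfolding e fseries_add[OF admissible_Cmul[OF ad(1) d] admissible_Cmul[OF c'(1) ad(2)]]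
      by (simp add: vanish_level_def)
    hence "red (fseries h (Cmul c d)) = red (fseries h (Cmul c' d'))"
      unfolding red_eq_0_iff[symmetric] red_diff[OF admissible_Cmul[OF c d] admissible_Cmul[OF c'(1) d'(1)]] by simp
    thus "red (fseries h (Cmul c d)) = red (star_hat_cone h a' b')"
      unfolding c'(2) d'(2) star_hat_cone_fseries[OF h0 c'(1) d'(1)] .
  qed
  fix e assume "\<forall>a'\<in>Ahat_cone h. \<forall>b'\<in>Ahat_cone h. red a' = red (fseries h c) \<and> red b' = red (fseries h d) \<longrightarrow>
      e = red (star_hat_cone h a' b')"
  hence "e = red (star_hat_cone h (fseries h c) (fseries h d))"
    using fseries_Ahat_cone[OF c] fseries_Ahat_cone[OF d] by blast
  thus "e = red (fseries h (Cmul c d))" by (simp only: star_hat_cone_fseries[OF h0 c d])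
qed

section \<open>The topology of the quotient\<close>

lemma openin_top_ball:
  fixes U :: "(complex ^ 'n::finite \<Rightarrow> complex) set"
  shows "openin (top_ball h) U \<longleftrightarrow> U \<subseteq> Ahat_ball h \<and> openin (top_cone h) {a \<in> Ahat_cone h. red a \<in> U}"
proof -
  have "istopology (\<lambda>U :: (complex ^ 'n \<Rightarrow> complex) set. U \<subseteq> Ahat_ball h \<and> openin (top_cone h) {a \<in> Ahat_cone h. red a \<in> U})"
    unfolding istopology_def
  proof (intro conjI allI impI)
    fix S T :: "(complex ^ 'n \<Rightarrow> complex) set"
    assume "S \<subseteq> Ahat_ball h \<and> openin (top_cone h) {a \<in> Ahat_cone h. red a \<in> S}"
      and "T \<subseteq> Ahat_ball h \<and> openin (top_cone h) {a \<in> Ahat_cone h. red a \<in> T}"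
    moreover have "{a \<in> Ahat_cone h. red a \<in> S \<inter> T} = {a \<in> Ahat_cone h. red a \<in> S} \<inter> {a \<in> Ahat_cone h. red a \<in> T}"
      by auto
    ultimately show "S \<inter> T \<subseteq> Ahat_ball h" "openin (top_cone h) {a \<in> Ahat_cone h. red a \<in> S \<inter> T}"
      by auto
  next
    fix K :: "(complex ^ 'n \<Rightarrow> complex) set set"
    assume *: "\<forall>S\<in>K. S \<subseteq> Ahat_ball h \<and> openin (top_cone h) {a \<in> Ahat_cone h. red a \<in> S}"
    thus "\<Union> K \<subseteq> Ahat_ball h" by blast
    have "{a \<in> Ahat_cone h. red a \<in> \<Union> K} = (\<Union>S\<in>K. {a \<in> Ahat_cone h. red a \<in> S})" by auto
    thus "openin (top_cone h) {a \<in> Ahat_cone h. red a \<in> \<Union> K}" using * by auto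
  qed
  thus ?thesis unfolding top_ball_def by (simp add: topology_inverse')
qed

lemma topspace_top_ball:
  assumes "h \<noteq> 0"
  shows "topspace (top_ball h) = (Ahat_ball h :: (complex ^ 'n::finite \<Rightarrow> complex) set)"
proof
  show "topspace (top_ball h) \<subseteq> (Ahat_ball h :: (complex ^ 'n \<Rightarrow> complex) set)" by (auto simp: topspace_def openin_top_ball)
  have "{a \<in> Ahat_cone h. red a \<in> (Ahat_ball h :: (complex ^ 'n \<Rightarrow> complex) set)} = topspace (top_cone h)"
    unfolding topspace_top_cone[OF assms] by (auto simp: Ahat_ball_def)
  hence "openin (top_ball h) (Ahat_ball h :: (complex ^ 'n \<Rightarrow> complex) set)"
    unfolding openin_top_ball by (simp only: openin_topspace order_refl simp_thms)
  thus "(Ahat_ball h :: (complex ^ 'n \<Rightarrow> complex) set) \<subseteq> topspace (top_ball h)" by (rule openin_subset)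
qed

lemma limitin_top_ball:
  assumes h: "h \<noteq> 0" and lim: "limitin (top_cone h) A a F"
  shows "limitin (top_ball h) (\<lambda>k. red (A k)) (red a) F"
  unfolding limitin_def
proof (intro conjI allI impI)
  have a: "a \<in> Ahat_cone h" using lim topspace_top_cone[OF h] by (auto simp: limitin_def)
  thus "red a \<in> topspace (top_ball h)" unfolding topspace_top_ball[OF h] by (simp add: Ahat_ball_def)
  fix U assume U: "openin (top_ball h) U \<and> red a \<in> U"
  hence "openin (top_cone h) {a \<in> Ahat_cone h. red a \<in> U}" by (simp add: openin_top_ball)
  moreover have "a \<in> {a \<in> Ahat_cone h. red a \<in> U}" using U a by simp
  ultimately have "eventually (\<lambda>k. A k \<in> {a \<in> Ahat_cone h. red a \<in> U}) F"
    using lim unfolding limitin_def by blast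
  thus "eventually (\<lambda>k. red (A k) \<in> U) F" by eventually_elim simp
qed

section \<open>Change of the parameter\<close>

definition rescale :: "complex \<Rightarrow> complex \<Rightarrow> ('n triple \<Rightarrow> complex) \<Rightarrow> 'n triple \<Rightarrow> complex" where
  "rescale h h' c = (\<lambda>T. c T * (pochhammer (1 / (2 * h)) (deg T) / pochhammer (1 / (2 * h')) (deg T)))"

lemma allowed_pochhammer_nonzero: "h \<in> allowed \<Longrightarrow> pochhammer (1 / (2 * h)) n \<noteq> 0"
  unfolding pochhammer_prod using allowed_shift_nonzero by (simp add: add.commute)

text \<open>At \<open>y = 1\<close> the basis functions for two parameters are proportional.\<close>

lemma red_rescale:
  fixes c :: "'n::finite triple \<Rightarrow> complex"
  assumes "h' \<in> allowed"
  shows "red (fseries h c) = red (fseries h' (rescale h h' c))"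
proof
  fix v :: "complex ^ 'n"
  have "fseries h c w = fseries h' (rescale h h' c) w" if w: "yfun w = 1" for w
  proof -
    have wC: "w \<in> Cplus" using w by (simp add: Cplus_def)
    show ?thesis
      unfolding fseries_def
      by (intro infsum_cong)
         (simp add: fbasis_Cplus[OF wC] w rescale_def allowed_pochhammer_nonzero[OF assms])
  qed
  thus "red (fseries h c) v = red (fseries h' (rescale h h' c)) v"
    by (simp add: red_fseries sec_level)
qed

lemma pochhammer_lower_bound:
  assumes "\<And>j::nat. \<delta> * (real j + 1) \<le> cmod (u + of_nat j)" "0 \<le> \<delta>"
  shows "\<delta> ^ n * fact n \<le> cmod (pochhammer u n)"
proof (induction n)
  case (Suc n)
  have "\<delta> ^ n * fact n * (\<delta> * (real n + 1)) \<le> cmod (pochhammer u n) * cmod (u + of_nat n)"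
    using assms by (intro mult_mono Suc assms(1)) auto
  thus ?case unfolding pochhammer_Suc norm_mult by (simp add: mult_ac add_ac)
qed simp

text \<open>The distances \<open>|x + j|\<close> are positive for allowed parameters and asymptotic to \<open>j\<close>, so they lie
  between positive multiples of \<open>j + 1\<close>. This is stable under small changes of \<open>x = 1/(2k)\<close>.\<close>

lemma allowed_local_bounds:
  assumes "h \<in> allowed"
  obtains r \<delta> \<Delta> where "0 < r" "0 < \<delta>" "1 \<le> \<Delta>" "cball h r \<subseteq> allowed"
    "\<And>k n. k \<in> cball h r \<Longrightarrow> \<delta> ^ n * fact n \<le> cmod (pochhammer (1 / (2 * k)) n)"
    "\<And>k n. k \<in> cball h r \<Longrightarrow> cmod (pochhammer (1 / (2 * k)) n) \<le> \<Delta> ^ n * fact n"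
proof -
  have h0: "h \<noteq> 0" using assms by (rule allowed_nonzero)
  define x where "x = 1 / (2 * h)"
  obtain J :: nat where J: "2 * cmod x + 1 \<le> real J" using real_arch_simple by blast
  \<comment> \<open>From \<open>j = J\<close> on, \<open>|x + j|\<close> is at least half of \<open>j + 1\<close>; the finitely many other quotients are
    positive.\<close>
  define S where "S = insert (1/2) ((\<lambda>j. cmod (x + of_nat j) / (real j + 1)) ` {..<J})"
  define d where "d = Min S / 2"
  have S: "finite S" "S \<noteq> {}" "\<And>s. s \<in> S \<Longrightarrow> 0 < s"
    using allowed_shift_nonzero[OF assms] by (auto simp: S_def x_def)
  have d: "0 < d" using S by (simp add: d_def)
  have dS: "2 * d \<le> s" if "s \<in> S" for s using S(1) that by (simp add: d_def)
  have xj: "2 * d * (real j + 1) \<le> cmod (x + of_nat j)" for j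
  proof (cases "j < J")
    case True
    hence "2 * d \<le> cmod (x + of_nat j) / (real j + 1)" by (intro dS) (simp add: S_def)
    thus ?thesis by (simp add: field_simps)
  next
    case False
    hence "2 * cmod x + 1 \<le> real j" using J by simp
    moreover have "real j - cmod x \<le> cmod (x + of_nat j)"
      using norm_triangle_ineq2[of "of_nat j" "- x"] by (simp add: add.commute)
    ultimately have "1/2 * (real j + 1) \<le> cmod (x + of_nat j)" by simp
    moreover have "2 * d * (real j + 1) \<le> 1/2 * (real j + 1)" by (intro mult_right_mono dS) (auto simp: S_def)
    ultimately show ?thesis by linarith
  qed
  have "isCont (\<lambda>k. 1 / (2 * k)) h" using h0 by (intro continuous_intros) auto
  hence "eventually (\<lambda>k. dist (1 / (2 * k)) x < d) (at h)"
    unfolding isCont_def x_def using d by (rule tendstoD)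
  moreover have "eventually (\<lambda>k. k \<noteq> 0) (at h)" using h0 by (intro eventually_neq_at_within)
  ultimately have "eventually (\<lambda>k. dist (1 / (2 * k)) x < d \<and> k \<noteq> 0) (at h)" by (rule eventually_conj)
  then obtain r where r: "0 < r" "\<And>k. k \<noteq> h \<Longrightarrow> dist k h < r \<Longrightarrow> dist (1 / (2 * k)) x < d \<and> k \<noteq> 0"
    by (auto simp: eventually_at)
  have near: "dist (1 / (2 * k)) x < d \<and> k \<noteq> 0" if "k \<in> cball h (r / 2)" for k
  proof (cases "k = h")
    case False
    moreover have "dist k h < r" using that r(1) by (simp add: dist_commute)
    ultimately show ?thesis by (rule r(2))
  qed (use d h0 in \<open>simp add: x_def\<close>)
  have lower: "d * (real j + 1) \<le> cmod (1 / (2 * k) + of_nat j)" if k: "k \<in> cball h (r / 2)" for k j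
  proof -
    have "cmod (x + of_nat j) \<le> cmod (1 / (2 * k) + of_nat j) + cmod (x - 1 / (2 * k))"
      using norm_triangle_ineq[of "1 / (2 * k) + of_nat j" "x - 1 / (2 * k)"] by (simp add: add.commute)
    moreover have "cmod (x - 1 / (2 * k)) < d" using near[OF k] by (simp add: dist_norm norm_minus_commute)
    moreover have "d \<le> d * (real j + 1)" using d by simp
    ultimately show ?thesis using xj[of j] by (simp add: algebra_simps)
  qed
  show thesis
  proof (rule that[of "r / 2" d "cmod x + d + 1"])
    show "cball h (r / 2) \<subseteq> allowed"
    proof
      fix k assume k: "k \<in> cball h (r / 2)"
      have "2 * k \<noteq> - 1 / of_nat n" if "1 \<le> n" for n
      proof
        assume e: "2 * k = - 1 / of_nat n"
        have "1 / (2 * k) + of_nat n = 0" unfolding e using that by simp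
        with lower[OF k, of n] d show False by (simp add: mult_le_0_iff)
      qed
      thus "k \<in> allowed" using near[OF k] by (auto simp: allowed_def)
    qed
    fix k n assume k: "k \<in> cball h (r / 2)"
    show "d ^ n * fact n \<le> cmod (pochhammer (1 / (2 * k)) n)"
      using lower[OF k] d by (intro pochhammer_lower_bound) auto
    have "cmod (1 / (2 * k)) \<le> cmod x + cmod (1 / (2 * k) - x)"
      using norm_triangle_ineq[of x "1 / (2 * k) - x"] by simp
    also have "cmod (1 / (2 * k) - x) \<le> d" using near[OF k] by (simp add: dist_norm)
    finally show "cmod (pochhammer (1 / (2 * k)) n) \<le> (cmod x + d + 1) ^ n * fact n"
      using d by (intro norm_pochhammer_le) auto
  qed (use r d in auto)
qed

lemma grows_geometric:
  assumes "\<epsilon> < \<epsilon>'" "0 < B"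
  obtains K where "0 < K" "\<And>(c :: 'n::finite triple \<Rightarrow> complex) f C. grows \<epsilon> C c \<Longrightarrow>
    (\<And>T. T \<in> triples \<Longrightarrow> cmod (f T) \<le> B ^ deg T) \<Longrightarrow> grows \<epsilon>' (K * C) (\<lambda>T. c T * f T)"
proof -
  obtain K where K: "0 < K" "\<And>n::nat. B ^ n * fact n powr \<epsilon> \<le> K * fact n powr \<epsilon>'"
    by (rule power_mult_fact_powr_le[OF assms]) blast
  show thesis
  proof (rule that[OF K(1)])
    fix c f :: "'n triple \<Rightarrow> complex" and C
    assume c: "grows \<epsilon> C c" and f: "\<And>T. T \<in> triples \<Longrightarrow> cmod (f T) \<le> B ^ deg T"
    show "grows \<epsilon>' (K * C) (\<lambda>T. c T * f T)"
      unfolding grows_def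
    proof
      fix T :: "'n triple" assume T: "T \<in> triples"
      have "cmod (c T * f T) \<le> (C * fact (deg T) powr \<epsilon>) * B ^ deg T"
        unfolding norm_mult using c T f[OF T] grows_nonneg[OF c] by (intro mult_mono) (auto simp: grows_def)
      also have "\<dots> = C * (B ^ deg T * fact (deg T) powr \<epsilon>)" by simp
      also have "\<dots> \<le> C * (K * fact (deg T) powr \<epsilon>')" using grows_nonneg[OF c] by (intro mult_left_mono K)
      finally show "cmod (c T * f T) \<le> K * C * fact (deg T) powr \<epsilon>'" by (simp only: mult_ac)
    qed
  qed
qed

lemma pochhammer_quotient_bound:
  assumes "cmod a \<le> \<Delta> ^ n * fact n" "\<delta> ^ n * fact n \<le> cmod b" "0 < \<delta>" "0 \<le> \<Delta>"
  shows "cmod (a / b) \<le> (\<Delta> / \<delta>) ^ n"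
proof -
  have "cmod (a / b) \<le> (\<Delta> ^ n * fact n) / (\<delta> ^ n * fact n)"
    unfolding norm_divide using assms by (intro frac_le) auto
  thus ?thesis by (simp add: power_divide)
qed

text \<open>The coefficients, for the parameter \<open>h0\<close>, of the product for the parameter \<open>k\<close>.\<close>

definition ball_product :: "complex \<Rightarrow> ('n::finite triple \<Rightarrow> complex) \<Rightarrow> ('n triple \<Rightarrow> complex) \<Rightarrow> complex \<Rightarrow> 'n triple \<Rightarrow> complex" where
  "ball_product h0 c d k = rescale k h0 (Cmul (rescale h0 k c) (rescale h0 k d))"

lemma rescale_grows_uniform:
  assumes h: "h \<in> allowed" and h0: "h0 \<in> allowed"
  obtains r where "0 < r" "cball h r \<subseteq> allowed"
    "\<And>\<epsilon> \<epsilon>'. \<epsilon> < \<epsilon>' \<Longrightarrow> \<exists>K>0. \<forall>k\<in>cball h r. \<forall>(c :: 'n::finite triple \<Rightarrow> complex) C. grows \<epsilon> C c \<longrightarrow>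
      grows \<epsilon>' (K * C) (rescale h0 k c) \<and> grows \<epsilon>' (K * C) (rescale k h0 c)"
proof -
  obtain r \<delta> \<Delta> where r: "0 < r" "0 < \<delta>" "1 \<le> \<Delta>" "cball h r \<subseteq> allowed"
    "\<And>k n. k \<in> cball h r \<Longrightarrow> \<delta> ^ n * fact n \<le> cmod (pochhammer (1 / (2 * k)) n)"
    "\<And>k n. k \<in> cball h r \<Longrightarrow> cmod (pochhammer (1 / (2 * k)) n) \<le> \<Delta> ^ n * fact n"
    by (rule allowed_local_bounds[OF h]) blast
  obtain r0 \<delta>0 \<Delta>0 where r0: "0 < r0" "0 < \<delta>0" "1 \<le> \<Delta>0" "cball h0 r0 \<subseteq> allowed"
    "\<And>k n. k \<in> cball h0 r0 \<Longrightarrow> \<delta>0 ^ n * fact n \<le> cmod (pochhammer (1 / (2 * k)) n)"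
    "\<And>k n. k \<in> cball h0 r0 \<Longrightarrow> cmod (pochhammer (1 / (2 * k)) n) \<le> \<Delta>0 ^ n * fact n"
    by (rule allowed_local_bounds[OF h0]) blast
  define B where "B = max (\<Delta>0 / \<delta>) (\<Delta> / \<delta>0)"
  have B: "0 < B" "\<Delta>0 / \<delta> \<le> B" "\<Delta> / \<delta>0 \<le> B" using r r0 by (auto simp: B_def less_max_iff_disj)
  have h0c: "h0 \<in> cball h0 r0" using r0(1) by simp
  have q1: "cmod (pochhammer (1 / (2 * h0)) n / pochhammer (1 / (2 * k)) n) \<le> B ^ n" if "k \<in> cball h r" for k n
  proof -
    have "cmod (pochhammer (1 / (2 * h0)) n / pochhammer (1 / (2 * k)) n) \<le> (\<Delta>0 / \<delta>) ^ n"
      using r0(6)[OF h0c] r(5)[OF that] r(2) r0(3) by (intro pochhammer_quotient_bound) auto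
    also have "\<dots> \<le> B ^ n" using B r r0 by (intro power_mono) auto
    finally show ?thesis .
  qed
  have q2: "cmod (pochhammer (1 / (2 * k)) n / pochhammer (1 / (2 * h0)) n) \<le> B ^ n" if "k \<in> cball h r" for k n
  proof -
    have "cmod (pochhammer (1 / (2 * k)) n / pochhammer (1 / (2 * h0)) n) \<le> (\<Delta> / \<delta>0) ^ n"
      using r(6)[OF that] r0(5)[OF h0c] r0(2) r(3) by (intro pochhammer_quotient_bound) auto
    also have "\<dots> \<le> B ^ n" using B r r0 by (intro power_mono) auto
    finally show ?thesis .
  qed
  show thesis
  proof (rule that[OF r(1,4)])
    fix \<epsilon> \<epsilon>' :: real assume "\<epsilon> < \<epsilon>'"
    then obtain K where K: "0 < K" "\<And>(c :: 'n triple \<Rightarrow> complex) f C. grows \<epsilon> C c \<Longrightarrow>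
      (\<And>T. T \<in> triples \<Longrightarrow> cmod (f T) \<le> B ^ deg T) \<Longrightarrow> grows \<epsilon>' (K * C) (\<lambda>T. c T * f T)"
      using grows_geometric[OF _ B(1)] by blast
    show "\<exists>K>0. \<forall>k\<in>cball h r. \<forall>(c :: 'n triple \<Rightarrow> complex) C. grows \<epsilon> C c \<longrightarrow>
      grows \<epsilon>' (K * C) (rescale h0 k c) \<and> grows \<epsilon>' (K * C) (rescale k h0 c)"
      unfolding rescale_def using K(1) q1 q2 by (intro exI[of _ K] conjI ballI allI impI K(2)) auto
  qed
qed

lemma ball_product_grows:
  fixes c d :: "'n::finite triple \<Rightarrow> complex"
  assumes h: "h \<in> allowed" and h0: "h0 \<in> allowed" and c: "admissible c" and d: "admissible d"
  obtains r where "0 < r" "cball h r \<subseteq> allowed"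
    "\<And>\<epsilon>. 0 < \<epsilon> \<Longrightarrow> \<epsilon> < 1 \<Longrightarrow> \<exists>C. \<forall>k\<in>cball h r. grows \<epsilon> C (ball_product h0 c d k)"
proof -
  obtain r where r: "0 < r" "cball h r \<subseteq> allowed"
    "\<And>\<epsilon> \<epsilon>'. \<epsilon> < \<epsilon>' \<Longrightarrow> \<exists>K>0. \<forall>k\<in>cball h r. \<forall>(c :: 'n::finite triple \<Rightarrow> complex) C. grows \<epsilon> C c \<longrightarrow>
      grows \<epsilon>' (K * C) (rescale h0 k c) \<and> grows \<epsilon>' (K * C) (rescale k h0 c)"
    by (rule rescale_grows_uniform[OF h h0]) blast
  show thesis
  proof (rule that[OF r(1,2)])
    fix \<epsilon> :: real assume \<epsilon>: "0 < \<epsilon>" "\<epsilon> < 1"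
    obtain C where C: "grows (\<epsilon> / 4) C c" using admissible_growsE[OF c, of "\<epsilon> / 4"] \<epsilon> by auto
    obtain D where D: "grows (\<epsilon> / 4) D d" using admissible_growsE[OF d, of "\<epsilon> / 4"] \<epsilon> by auto
    obtain K1 where K1: "\<forall>k\<in>cball h r. \<forall>(c :: 'n triple \<Rightarrow> complex) C. grows (\<epsilon> / 4) C c \<longrightarrow>
      grows (\<epsilon> / 2) (K1 * C) (rescale h0 k c) \<and> grows (\<epsilon> / 2) (K1 * C) (rescale k h0 c)"
      using r(3)[of "\<epsilon> / 4" "\<epsilon> / 2"] \<epsilon> by auto
    obtain K2 where K2: "0 < K2" "\<And>(c :: 'n triple \<Rightarrow> complex) d C D. grows (\<epsilon> / 2) C c \<Longrightarrow> grows (\<epsilon> / 2) D d \<Longrightarrow>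
      grows (3 * \<epsilon> / 4) (K2 * C * D) (Cmul c d)"
      by (rule Cmul_grows[of "\<epsilon> / 2" "3 * \<epsilon> / 4"]) (use \<epsilon> in auto)
    obtain K3 where K3: "\<forall>k\<in>cball h r. \<forall>(c :: 'n triple \<Rightarrow> complex) C. grows (3 * \<epsilon> / 4) C c \<longrightarrow>
      grows \<epsilon> (K3 * C) (rescale h0 k c) \<and> grows \<epsilon> (K3 * C) (rescale k h0 c)"
      using r(3)[of "3 * \<epsilon> / 4" \<epsilon>] \<epsilon> by auto
    show "\<exists>C. \<forall>k\<in>cball h r. grows \<epsilon> C (ball_product h0 c d k)"
    proof (intro exI ballI)
      fix k assume k: "k \<in> cball h r"
      have "grows (\<epsilon> / 2) (K1 * C) (rescale h0 k c)" "grows (\<epsilon> / 2) (K1 * D) (rescale h0 k d)"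
        using K1 k C D by blast+
      from K2(2)[OF this] show "grows \<epsilon> (K3 * (K2 * (K1 * C) * (K1 * D))) (ball_product h0 c d k)"
        unfolding ball_product_def using K3 k by blast
    qed
  qed
qed

lemma ball_product_outside: "T \<notin> triples \<Longrightarrow> ball_product h0 c d k T = 0"
  by (simp add: ball_product_def rescale_def Cmul_def)

lemma admissible_rescale:
  fixes c :: "'n::finite triple \<Rightarrow> complex"
  assumes h: "h \<in> allowed" and h0: "h0 \<in> allowed" and c: "admissible c"
  shows "admissible (rescale h0 h c)"
  unfolding admissible_iff
proof (intro conjI allI impI)
  show "rescale h0 h c T = 0" if "T \<notin> triples" for T
    using admissible_outside[OF c that] by (simp add: rescale_def)
  fix \<epsilon> :: real assume \<epsilon>: "0 < \<epsilon> \<and> \<epsilon> < 1"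
  obtain r where r: "0 < r" "cball h r \<subseteq> allowed"
    "\<And>\<epsilon> \<epsilon>'. \<epsilon> < \<epsilon>' \<Longrightarrow> \<exists>K>0. \<forall>k\<in>cball h r. \<forall>(c :: 'n::finite triple \<Rightarrow> complex) C. grows \<epsilon> C c \<longrightarrow>
      grows \<epsilon>' (K * C) (rescale h0 k c) \<and> grows \<epsilon>' (K * C) (rescale k h0 c)"
    by (rule rescale_grows_uniform[OF h h0]) blast
  obtain C where C: "grows (\<epsilon> / 2) C c" using admissible_growsE[OF c, of "\<epsilon> / 2"] \<epsilon> by auto
  have "h \<in> cball h r" using r(1) by simp
  with r(3)[of "\<epsilon> / 2" \<epsilon>] C \<epsilon> show "\<exists>C. grows \<epsilon> C (rescale h0 h c)" by (metis half_gt_zero_iff field_sum_of_halves less_add_same_cancel1)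
qed

lemma star_ball_rescaled:
  fixes c d :: "'n::finite triple \<Rightarrow> complex"
  assumes h: "h \<in> allowed" and h0: "h0 \<in> allowed" and c: "admissible c" and d: "admissible d"
  shows "star_ball h (red (fseries h0 c)) (red (fseries h0 d)) = red (fseries h0 (ball_product h0 c d h))"
  unfolding red_rescale[OF h, of h0 c] red_rescale[OF h, of h0 d]
    star_ball_eq[OF h admissible_rescale[OF h h0 c] admissible_rescale[OF h h0 d]]
  unfolding ball_product_def by (rule red_rescale[OF h0])

lemma ball_product_holomorphic:
  assumes "S \<subseteq> allowed" and h0: "h0 \<in> allowed"
  shows "(\<lambda>k. ball_product h0 c d k T) holomorphic_on S"
proof (cases "T \<in> triples")
  case True
  have poch: "(\<lambda>k. pochhammer (1 / (2 * k)) n) holomorphic_on S" for n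
  proof -
    have nz: "2 * k \<noteq> 0" if "k \<in> S" for k using allowed_nonzero[of k] assms that by auto
    show ?thesis unfolding pochhammer_prod by (intro holomorphic_intros) (erule nz)
  qed
  have nz: "pochhammer (1 / (2 * k)) n \<noteq> 0" if "k \<in> S" for k n
    using assms that by (intro allowed_pochhammer_nonzero) auto
  have pc: "(\<lambda>k. pcoeff (rescale h0 k c) p q) holomorphic_on S" for c and p q :: "'a option \<Rightarrow> nat"
    unfolding pcoeff_def rescale_def using nz
    by (cases "msize p = msize q") (auto intro!: holomorphic_intros poch)
  show ?thesis
    unfolding ball_product_def rescale_def[of _ h0] Cmul_def if_P[OF True]
    by (intro holomorphic_intros poch pc) (simp_all add: allowed_pochhammer_nonzero[OF h0])
next
  case False
  thus ?thesis by (simp add: ball_product_outside)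
qed

section \<open>Holomorphic dependence\<close>

text \<open>Taylor's formula on the disc of half the radius; every point of it is the centre of a disc of
  radius \<open>r/2\<close> on which \<open>f\<close> is bounded by \<open>B\<close>, so that Cauchy's estimate bounds the second
  derivative.\<close>

lemma difference_quotient_bound:
  assumes hol: "f holomorphic_on cball h r" and r: "0 < r" and B: "\<And>z. z \<in> cball h r \<Longrightarrow> cmod (f z) \<le> B"
    and k: "k \<noteq> h" "dist k h \<le> r / 2"
  shows "cmod ((f k - f h) / (k - h) - deriv f h) \<le> 8 * B / r\<^sup>2 * cmod (k - h)"
proof -
  have holb: "f holomorphic_on ball h r" by (rule holomorphic_on_subset[OF hol]) auto
  have d2: "cmod ((deriv ^^ 2) f z) \<le> 8 * B / r\<^sup>2" if z: "z \<in> cball h (r / 2)" for z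
  proof -
    have sub: "cball z (r / 2) \<subseteq> cball h r" using z by (simp add: cball_subset_cball_iff dist_commute)
    have "cmod ((deriv ^^ 2) f z) \<le> fact 2 * B / (r / 2) ^ 2"
    proof (rule Cauchy_inequality)
      show "f holomorphic_on ball z (r / 2)"
        by (rule holomorphic_on_subset[OF hol]) (use sub ball_subset_cball in blast)
      show "continuous_on (cball z (r / 2)) f"
        by (rule holomorphic_on_imp_continuous_on[OF holomorphic_on_subset[OF hol sub]])
      show "cmod (f x) \<le> B" if "cmod (z - x) = r / 2" for x
        using that sub by (intro B) (auto simp: dist_norm subset_iff)
    qed (use r in auto)
    thus ?thesis by (simp add: power2_eq_square fact_numeral)
  qed
  have "cmod ((deriv ^^ 0) f k - (\<Sum>i\<le>1. (deriv ^^ i) f h * (k - h) ^ i / fact i)) \<le> 8 * B / r\<^sup>2 * cmod (k - h) ^ Suc 1 / fact 1"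
  proof (rule complex_Taylor[where S = "cball h (r / 2)" and f = "\<lambda>i. (deriv ^^ i) f"])
    fix i z assume z: "z \<in> cball h (r / 2)"
    have zb: "z \<in> ball h r" using z r by auto
    have "(deriv ^^ i) f holomorphic_on ball h r" by (rule holomorphic_higher_deriv[OF holb open_ball])
    from holomorphic_derivI[OF this open_ball zb]
    show "((deriv ^^ i) f has_field_derivative (deriv ^^ Suc i) f z) (at z within cball h (r / 2))" by simp
  qed (use d2 r k in \<open>auto simp: numeral_2_eq_2 dist_commute\<close>)
  hence T: "cmod (f k - f h - deriv f h * (k - h)) \<le> 8 * B / r\<^sup>2 * (cmod (k - h) * cmod (k - h))"
    by (simp add: power2_eq_square algebra_simps)
  have "(f k - f h) / (k - h) - deriv f h = (f k - f h - deriv f h * (k - h)) / (k - h)"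
    using k(1) by (simp add: field_simps)
  hence "cmod ((f k - f h) / (k - h) - deriv f h) = cmod (f k - f h - deriv f h * (k - h)) / cmod (k - h)"
    by (simp add: norm_divide)
  also have "\<dots> \<le> 8 * B / r\<^sup>2 * (cmod (k - h) * cmod (k - h)) / cmod (k - h)"
    using T by (intro divide_right_mono) auto
  also have "\<dots> = 8 * B / r\<^sup>2 * cmod (k - h)" using k(1) by simp
  finally show ?thesis .
qed

lemma deriv_bound:
  assumes hol: "f holomorphic_on cball h r" and r: "0 < r" and B: "\<And>z. z \<in> cball h r \<Longrightarrow> cmod (f z) \<le> B"
  shows "cmod (deriv f h) \<le> B / r"
proof -
  have "cmod ((deriv ^^ 1) f h) \<le> fact 1 * B / r ^ 1"
  proof (rule Cauchy_inequality)
    show "f holomorphic_on ball h r" by (rule holomorphic_on_subset[OF hol]) auto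
    show "continuous_on (cball h r) f" by (rule holomorphic_on_imp_continuous_on[OF hol])
    show "cmod (f x) \<le> B" if "cmod (h - x) = r" for x using that by (intro B) (simp add: dist_norm)
  qed (rule r)
  thus ?thesis by simp
qed

theorem theorem5p18:
  fixes a b :: "complex ^ ('n::finite) \<Rightarrow> complex" and h0 :: complex
  assumes "h0 \<in> allowed" and "a \<in> Ahat_ball h0" and "b \<in> Ahat_ball h0"
  shows "holomorphic_into (top_ball h0) allowed (\<lambda>h. star_ball h a b)"
proof -
  note h0 = assms(1) and h0' = allowed_nonzero[OF assms(1)]
  obtain c where c: "admissible c" "a = red (fseries h0 c)"
    using assms(2) unfolding Ahat_ball_def by (auto elim!: Ahat_coneE)
  obtain d where d: "admissible d" "b = red (fseries h0 d)"
    using assms(3) unfolding Ahat_ball_def by (auto elim!: Ahat_coneE)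
  define G where "G = ball_product h0 c d"
  have star: "star_ball h a b = red (fseries h0 (G h))" if "h \<in> allowed" for h
    unfolding c(2) d(2) G_def by (rule star_ball_rescaled[OF that h0 c(1) d(1)])
  have G0: "G h T = 0" if "T \<notin> triples" for h T using that by (simp add: G_def ball_product_outside)
  have G_adm: "admissible (G h)" if h: "h \<in> allowed" for h
    unfolding G_def ball_product_def
    by (intro admissible_rescale admissible_Cmul h h0 c d)
  show ?thesis
    unfolding holomorphic_into_def
  proof (intro conjI ballI)
    show "(\<lambda>h. star_ball h a b) ` allowed \<subseteq> topspace (top_ball h0)"
      unfolding topspace_top_ball[OF h0'] Ahat_ball_def
      by (auto simp: star intro!: imageI fseries_Ahat_cone G_adm)
  next
    fix h assume h: "h \<in> allowed"
    obtain r where r: "0 < r" "cball h r \<subseteq> allowed"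
      and bd: "\<And>\<epsilon>. 0 < \<epsilon> \<Longrightarrow> \<epsilon> < 1 \<Longrightarrow> \<exists>C. \<forall>k\<in>cball h r. grows \<epsilon> C (G k)"
      unfolding G_def by (rule ball_product_grows[OF h h0 c(1) d(1)]) blast
    have hol: "(\<lambda>k. G k T) holomorphic_on cball h r" for T
      unfolding G_def by (rule ball_product_holomorphic[OF r(2) h0])
    \<comment> \<open>The derivative is taken entry by entry; Cauchy's estimate keeps it in the algebra.\<close>
    define D where "D T = deriv (\<lambda>k. G k T) h" for T
    define Q where "Q k = fscale (1 / (k - h)) (G k - G h)" for k
    have D_adm: "admissible D"
      unfolding admissible_iff
    proof (intro conjI allI impI)
      show "D T = 0" if "T \<notin> triples" for T using that by (simp add: D_def G0)
      fix \<epsilon> :: real assume "0 < \<epsilon> \<and> \<epsilon> < 1"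
      then obtain C where C: "\<forall>k\<in>cball h r. grows \<epsilon> C (G k)" using bd by blast
      have "grows \<epsilon> (C / r) D"
        unfolding grows_def D_def
      proof
        fix T :: "'n triple" assume "T \<in> triples"
        hence "cmod (deriv (\<lambda>k. G k T) h) \<le> C * fact (deg T) powr \<epsilon> / r"
          using C by (intro deriv_bound[OF hol r(1)]) (auto simp: grows_def)
        thus "cmod (deriv (\<lambda>k. G k T) h) \<le> C / r * fact (deg T) powr \<epsilon>" by simp
      qed
      thus "\<exists>C. grows \<epsilon> C D" by blast
    qed
    have Q_adm: "admissible (Q k)" if "k \<in> allowed" for k
      unfolding Q_def by (intro admissible_fscale admissible_diff G_adm that h)
    have near: "eventually (\<lambda>k. k \<in> allowed \<and> k \<noteq> h \<and> dist k h \<le> r / 2) (at h within allowed)"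
      unfolding eventually_at using r(1) by (intro exI[of _ "r / 2"]) auto
    have "limitin (top_cone h0) (\<lambda>k. fseries h0 (Q k)) (fseries h0 D) (at h within allowed)"
    proof (rule limitin_top_cone[OF h0' D_adm])
      show "eventually (\<lambda>k. admissible (Q k)) (at h within allowed)"
        using near by eventually_elim (simp add: Q_adm)
      fix \<epsilon> e :: real assume \<epsilon>: "0 < \<epsilon>" "\<epsilon> < 1" and e: "0 < e"
      obtain C where C: "\<forall>k\<in>cball h r. grows \<epsilon> C (G k)" using bd \<epsilon> by blast
      hence C0: "0 \<le> C" using r(1) grows_nonneg[of \<epsilon> C "G h"] by simp
      define M where "M = 8 * C / r\<^sup>2"
      have M: "0 \<le> M" using C0 by (simp add: M_def)
      have bound: "nrm \<epsilon> (Q k - D) \<le> M * cmod (k - h)" if k: "k \<noteq> h" "dist k h \<le> r / 2" for k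
      proof (rule nrm_le, unfold grows_def, rule ballI)
        fix T :: "'n triple" assume "T \<in> triples"
        hence "cmod ((G k T - G h T) / (k - h) - deriv (\<lambda>k. G k T) h)
          \<le> 8 * (C * fact (deg T) powr \<epsilon>) / r\<^sup>2 * cmod (k - h)"
          using C by (intro difference_quotient_bound[OF hol r(1) _ k]) (auto simp: grows_def)
        thus "cmod ((Q k - D) T) \<le> M * cmod (k - h) * fact (deg T) powr \<epsilon>"
          by (simp add: Q_def D_def fscale_def M_def mult_ac)
      qed
      have "((\<lambda>k. M * cmod (k - h)) \<longlongrightarrow> M * cmod (h - h)) (at h within allowed)"
        by (intro tendsto_intros)
      hence "eventually (\<lambda>k. M * cmod (k - h) < e) (at h within allowed)"
        by (rule order_tendstoD(2)) (use e in simp)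
      with near show "eventually (\<lambda>k. nrm \<epsilon> (Q k - D) < e) (at h within allowed)"
        by eventually_elim (use bound in fastforce)
    qed
    from limitin_top_ball[OF h0' this]
    have "limitin (top_ball h0) (\<lambda>k. red (fseries h0 (Q k))) (red (fseries h0 D)) (at h within allowed)" .
    moreover have "eventually (\<lambda>k. red (fseries h0 (Q k)) = fscale (1 / (k - h)) (star_ball k a b - star_ball h a b))
        (at h within allowed)"
      using near
    proof eventually_elim
      case (elim k)
      hence k: "k \<in> allowed" by simp
      show ?case unfolding Q_def star[OF k] star[OF h] red_fscale red_diff[OF G_adm[OF k] G_adm[OF h]] ..
    qed
    ultimately have "limitin (top_ball h0) (\<lambda>k. fscale (1 / (k - h)) (star_ball k a b - star_ball h a b))
        (red (fseries h0 D)) (at h within allowed)"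
      by (rule limitin_transform_eventually[rotated])
    thus "\<exists>D. limitin (top_ball h0) (\<lambda>k. fscale (1 / (k - h)) (star_ball k a b - star_ball h a b)) D (at h within allowed)"
      by blast
  qed
qed

end
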